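(* Let $\eta$ be a constant three-form on a connected open set $U\subset C^n$ containing the origin $0$ which satisfies (i) $\eta_X\eta_Y=0$ for all $X,Y$, and (ii) $\{\eta_X,\tau_{can}\}=0$ for all $X$. Then there exists a unique almost para-complex structure $$\tau=\exp\Big(2\sum_{i=1}^{2n}x^i\,\eta_{\partial_i}\Big)\tau_{can}$$ on $U$ such that a) $\tau_0=\tau_{can}$, and b) $M(U,\eta):=(U,g=g_{can},\tau)$ is a flat nearly para-Kähler manifold. Any flat nearly para-Kähler manifold is locally isomorphic to a flat nearly para-Kähler manifold of the form $M(U,\eta)$.
   Context: $C^n=\mathbb{R}^n\oplus e\mathbb{R}^n$ ($e^2=1$) is the real vector space with basis $(e_1,\dots,e_n,f_1,\dots,f_n)$, $f_i=ee_i$, with standard para-complex structure $\tau_{can}e_i=f_i$, $\tau_{can}f_i=e_i$, and standard scalar product $g_{can}(e_i,e_j)=-g_{can}(f_i,f_j)=\delta_{ij}$, $g_{can}(e_i,f_j)=0$. $x^1,\dots,x^{2n}$ are linear coordinates on $C^n=\mathbb{R}^{2n}$ and $\partial_i=\partial/\partial x^i$. For a three-form $\eta$ the endomorphisms $\eta_X$ are defined by $g_{can}(\eta_XY,Z)=\eta(X,Y,Z)$. $\{A,B\}:=AB+BA$. An almost para-complex structure is an endomorphism field $\tau$ with $\tau^2=\mathrm{Id}$ whose two eigendistributions have the same dimension; $\tau_0$ is its value at the origin. $(M,\tau,g)$ is almost para-Hermitian if $g(\tau\cdot,\tau\cdot)=-g$, and nearly para-Kähler if moreover the Levi-Civita connection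 $D$ of $g$ satisfies $(D_X\tau)Y=-(D_Y\tau)X$ for all vector fields $X,Y$. It is flat if $g$ is flat. Isomorphisms of nearly para-Kähler manifolds are isometries intertwining the endomorphism fields $\tau$; "locally isomorphic" means that each point has an open neighborhood isomorphic to some $M(U,\eta)$.
   Formalization: Uniqueness of τ under a) and b) alone is false (τ_can also satisfies them when η≠0); uniqueness is stated and proved among the structures that also satisfy D_Xτ = 2η_Xτ, a relation that is also proved for the displayed τ. *)

theory Defs
  imports "HOL-Analysis.Analysis"
begin

section \<open>Smooth maps between normed spaces\<close>

text \<open>Intended for open \<open>S\<close>: the derivatives are the unrestricted ones at the points of \<open>S\<close>.\<close>

primrec Ck_on :: "nat \<Rightarrow> 'a::real_normed_vector set \<Rightarrow> ('a \<Rightarrow> 'b::real_normed_vector) \<Rightarrow> bool" where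
  "Ck_on 0 S f \<longleftrightarrow> continuous_on S f"
| "Ck_on (Suc k) S f \<longleftrightarrow> (\<forall>x\<in>S. f differentiable (at x)) \<and>
     (\<forall>v. Ck_on k S (\<lambda>x. frechet_derivative f (at x) v))"

definition smooth_on :: "'a::real_normed_vector set \<Rightarrow> ('a \<Rightarrow> 'b::real_normed_vector) \<Rightarrow> bool" where
  "smooth_on S f \<longleftrightarrow> (\<forall>k. Ck_on k S f)"


section \<open>Levi-Civita connection and curvature on an open set of the model space\<close>

text \<open>
  A metric in a chart is a function \<open>g\<close> with \<open>g x u v\<close> the value at the point \<open>x\<close> on the
  tangent vectors \<open>u\<close>, \<open>v\<close>; vector fields are functions \<open>'e \<Rightarrow> 'e\<close> and endomorphism fields
  functions \<open>'e \<Rightarrow> 'e \<Rightarrow> 'e\<close>. The Levi-Civita connection is \<open>D\<^sub>X Y = dY(X) + \<Gamma>(X,Y)\<close>, where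
  symmetry of \<open>\<Gamma>\<close> is vanishing torsion and the second identity is \<open>Dg = 0\<close>; for
  nondegenerate \<open>g\<close> these two conditions determine \<open>\<Gamma>\<close> at every point.
\<close>

definition christoffel ::
  "('e::euclidean_space \<Rightarrow> 'e \<Rightarrow> 'e \<Rightarrow> real) \<Rightarrow> 'e \<Rightarrow> 'e \<Rightarrow> 'e \<Rightarrow> 'e" where
  "christoffel g x = (THE \<Gamma>. bilinear \<Gamma> \<and> (\<forall>u v. \<Gamma> u v = \<Gamma> v u) \<and>
     (\<forall>u v w. frechet_derivative (\<lambda>y. g y v w) (at x) u = g x (\<Gamma> u v) w + g x v (\<Gamma> u w)))"

definition cov_deriv ::
  "('e::euclidean_space \<Rightarrow> 'e \<Rightarrow> 'e \<Rightarrow> real) \<Rightarrow> ('e \<Rightarrow> 'e) \<Rightarrow> ('e \<Rightarrow> 'e) \<Rightarrow> 'e \<Rightarrow> 'e" where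
  "cov_deriv g X Y x = frechet_derivative Y (at x) (X x) + christoffel g x (X x) (Y x)"

definition cov_deriv_endo ::
  "('e::euclidean_space \<Rightarrow> 'e \<Rightarrow> 'e \<Rightarrow> real) \<Rightarrow> ('e \<Rightarrow> 'e \<Rightarrow> 'e) \<Rightarrow> ('e \<Rightarrow> 'e) \<Rightarrow> ('e \<Rightarrow> 'e) \<Rightarrow> 'e \<Rightarrow> 'e" where
  "cov_deriv_endo g \<tau> X Y x = cov_deriv g X (\<lambda>y. \<tau> y (Y y)) x - \<tau> x (cov_deriv g X Y x)"

definition lie_bracket :: "('e::euclidean_space \<Rightarrow> 'e) \<Rightarrow> ('e \<Rightarrow> 'e) \<Rightarrow> 'e \<Rightarrow> 'e" where
  "lie_bracket X Y x = frechet_derivative Y (at x) (X x) - frechet_derivative X (at x) (Y x)"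

definition curvature ::
  "('e::euclidean_space \<Rightarrow> 'e \<Rightarrow> 'e \<Rightarrow> real) \<Rightarrow> ('e \<Rightarrow> 'e) \<Rightarrow> ('e \<Rightarrow> 'e) \<Rightarrow> ('e \<Rightarrow> 'e) \<Rightarrow> 'e \<Rightarrow> 'e" where
  "curvature g X Y Z x =
     cov_deriv g X (cov_deriv g Y Z) x - cov_deriv g Y (cov_deriv g X Z) x
       - cov_deriv g (lie_bracket X Y) Z x"


section \<open>Manifolds with a metric and an endomorphism field\<close>

text \<open>
  The atlas is a family indexed by the type \<open>'i\<close>, the chart with index \<open>i\<close> being the map
  \<open>cmap M i\<close> on \<open>cdom M i\<close>. Tensor fields are given by their coordinate expressions:
  \<open>metric M i x u v\<close> and \<open>endo M i x v\<close> are the components in chart \<open>i\<close> at the coordinate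
  point \<open>x\<close>. Only points \<open>x\<close> in the image of the chart are relevant.
\<close>

record ('i, 'm, 'e) tensor_manifold =
  mtop :: "'m topology"
  cdom :: "'i \<Rightarrow> 'm set"
  cmap :: "'i \<Rightarrow> 'm \<Rightarrow> 'e"
  metric :: "'i \<Rightarrow> 'e \<Rightarrow> 'e \<Rightarrow> 'e \<Rightarrow> real"
  endo :: "'i \<Rightarrow> 'e \<Rightarrow> 'e \<Rightarrow> 'e"

definition cimg :: "('i, 'm, 'e) tensor_manifold \<Rightarrow> 'i \<Rightarrow> 'e set" where
  "cimg M i = cmap M i ` cdom M i"

definition coord_dom ::
  "('i, 'm, 'e) tensor_manifold \<Rightarrow> ('j, 'l, 'f) tensor_manifold \<Rightarrow> ('m \<Rightarrow> 'l) \<Rightarrow> 'i \<Rightarrow> 'j \<Rightarrow> 'e set" where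
  "coord_dom M N f i j = cmap M i ` (cdom M i \<inter> f -` cdom N j)"

definition coord_rep ::
  "('i, 'm, 'e) tensor_manifold \<Rightarrow> ('j, 'l, 'f) tensor_manifold \<Rightarrow> ('m \<Rightarrow> 'l) \<Rightarrow> 'i \<Rightarrow> 'j \<Rightarrow> 'e \<Rightarrow> 'f" where
  "coord_rep M N f i j = (\<lambda>x. cmap N j (f (inv_into (cdom M i) (cmap M i) x)))"

definition smooth_map ::
  "('i, 'm, 'e::euclidean_space) tensor_manifold \<Rightarrow> ('j, 'l, 'f::euclidean_space) tensor_manifold \<Rightarrow>
   ('m \<Rightarrow> 'l) \<Rightarrow> bool" where
  "smooth_map M N f \<longleftrightarrow> continuous_map (mtop M) (mtop N) f \<and>
     (\<forall>i j. smooth_on (coord_dom M N f i j) (coord_rep M N f i j))"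

definition preserves_metric ::
  "('i, 'm, 'e::euclidean_space) tensor_manifold \<Rightarrow> ('j, 'l, 'f::euclidean_space) tensor_manifold \<Rightarrow>
   ('m \<Rightarrow> 'l) \<Rightarrow> bool" where
  "preserves_metric M N f \<longleftrightarrow> (\<forall>i j. \<forall>x\<in>coord_dom M N f i j.
     let F = coord_rep M N f i j; dF = frechet_derivative F (at x) in
       \<forall>u v. metric N j (F x) (dF u) (dF v) = metric M i x u v)"

definition intertwines_endo ::
  "('i, 'm, 'e::euclidean_space) tensor_manifold \<Rightarrow> ('j, 'l, 'f::euclidean_space) tensor_manifold \<Rightarrow>
   ('m \<Rightarrow> 'l) \<Rightarrow> bool" where
  "intertwines_endo M N f \<longleftrightarrow> (\<forall>i j. \<forall>x\<in>coord_dom M N f i j.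
     let F = coord_rep M N f i j; dF = frechet_derivative F (at x) in
       \<forall>v. dF (endo M i x v) = endo N j (F x) (dF v))"

text \<open>
  The coordinate representations of the identity map are the transition maps, so the
  conditions on \<open>id\<close> below are smoothness of the transition maps and the transformation
  laws of the two tensor fields.
\<close>

definition smooth_manifold :: "('i, 'm, 'e::euclidean_space) tensor_manifold \<Rightarrow> bool" where
  "smooth_manifold M \<longleftrightarrow>
     Hausdorff_space (mtop M) \<and> second_countable (mtop M) \<and>
     (\<Union>i. cdom M i) = topspace (mtop M) \<and>
     (\<forall>i. openin (mtop M) (cdom M i) \<and> open (cimg M i) \<and>
        homeomorphic_map (subtopology (mtop M) (cdom M i)) (top_of_set (cimg M i)) (cmap M i)) \<and>
     smooth_map M M id"

definition pseudo_riemannian :: "('i, 'm, 'e::euclidean_space) tensor_manifold \<Rightarrow> bool" where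
  "pseudo_riemannian M \<longleftrightarrow> smooth_manifold M \<and> preserves_metric M M id \<and>
     (\<forall>i. (\<forall>u v. smooth_on (cimg M i) (\<lambda>x. metric M i x u v)) \<and>
       (\<forall>x\<in>cimg M i. bilinear (metric M i x) \<and>
         (\<forall>u v. metric M i x u v = metric M i x v u) \<and>
         (\<forall>u. (\<forall>v. metric M i x u v = 0) \<longrightarrow> u = 0)))"

definition almost_para_complex :: "('i, 'm, 'e::euclidean_space) tensor_manifold \<Rightarrow> bool" where
  "almost_para_complex M \<longleftrightarrow> smooth_manifold M \<and> intertwines_endo M M id \<and>
     (\<forall>i. (\<forall>v. smooth_on (cimg M i) (\<lambda>x. endo M i x v)) \<and>
       (\<forall>x\<in>cimg M i. linear (endo M i x) \<and> (\<forall>v. endo M i x (endo M i x v) = v) \<and>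
         dim {v. endo M i x v = v} = dim {v. endo M i x v = - v}))"

definition almost_para_hermitian :: "('i, 'm, 'e::euclidean_space) tensor_manifold \<Rightarrow> bool" where
  "almost_para_hermitian M \<longleftrightarrow> pseudo_riemannian M \<and> almost_para_complex M \<and>
     (\<forall>i. \<forall>x\<in>cimg M i. \<forall>u v.
        metric M i x (endo M i x u) (endo M i x v) = - metric M i x u v)"

definition nearly_para_kaehler :: "('i, 'm, 'e::euclidean_space) tensor_manifold \<Rightarrow> bool" where
  "nearly_para_kaehler M \<longleftrightarrow> almost_para_hermitian M \<and>
     (\<forall>i X Y. smooth_on (cimg M i) X \<longrightarrow> smooth_on (cimg M i) Y \<longrightarrow>
        (\<forall>x\<in>cimg M i. cov_deriv_endo (metric M i) (endo M i) X Y x =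
                        - cov_deriv_endo (metric M i) (endo M i) Y X x))"

definition flat :: "('i, 'm, 'e::euclidean_space) tensor_manifold \<Rightarrow> bool" where
  "flat M \<longleftrightarrow> pseudo_riemannian M \<and>
     (\<forall>i X Y Z. smooth_on (cimg M i) X \<longrightarrow> smooth_on (cimg M i) Y \<longrightarrow> smooth_on (cimg M i) Z \<longrightarrow>
        (\<forall>x\<in>cimg M i. curvature (metric M i) X Y Z x = 0))"

definition flat_nearly_para_kaehler :: "('i, 'm, 'e::euclidean_space) tensor_manifold \<Rightarrow> bool" where
  "flat_nearly_para_kaehler M \<longleftrightarrow> nearly_para_kaehler M \<and> flat M"

definition para_kaehler_iso ::
  "('i, 'm, 'e::euclidean_space) tensor_manifold \<Rightarrow> ('j, 'l, 'f::euclidean_space) tensor_manifold \<Rightarrow>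
   ('m \<Rightarrow> 'l) \<Rightarrow> bool" where
  "para_kaehler_iso M N f \<longleftrightarrow> homeomorphic_map (mtop M) (mtop N) f \<and>
     smooth_map M N f \<and> smooth_map N M (inv_into (topspace (mtop M)) f) \<and>
     preserves_metric M N f \<and> intertwines_endo M N f"

definition isomorphic ::
  "('i, 'm, 'e::euclidean_space) tensor_manifold \<Rightarrow> ('j, 'l, 'f::euclidean_space) tensor_manifold \<Rightarrow> bool" where
  "isomorphic M N \<longleftrightarrow> (\<exists>f. para_kaehler_iso M N f)"

definition open_submanifold ::
  "('i, 'm, 'e) tensor_manifold \<Rightarrow> 'm set \<Rightarrow> ('i, 'm, 'e) tensor_manifold" where
  "open_submanifold M V = M\<lparr>mtop := subtopology (mtop M) V, cdom := \<lambda>i. cdom M i \<inter> V\<rparr>"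


section \<open>The model space and the manifolds determined by a three-form\<close>

text \<open>The pair \<open>(a, b)\<close> stands for \<open>a + e b\<close>.\<close>

type_synonym 'n para_space = "(real, 'n) vec \<times> (real, 'n) vec"

definition tau_can :: "'n::finite para_space \<Rightarrow> 'n para_space" where
  "tau_can v = (snd v, fst v)"

definition g_can :: "'n::finite para_space \<Rightarrow> 'n para_space \<Rightarrow> real" where
  "g_can u v = fst u \<bullet> fst v - snd u \<bullet> snd v"

definition three_form :: "('e::real_vector \<Rightarrow> 'e \<Rightarrow> 'e \<Rightarrow> real) \<Rightarrow> bool" where
  "three_form \<eta> \<longleftrightarrow>
     (\<forall>v w. linear (\<lambda>u. \<eta> u v w)) \<and> (\<forall>u w. linear (\<lambda>v. \<eta> u v w)) \<and> (\<forall>u v. linear (\<lambda>w. \<eta> u v w)) \<and>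
     (\<forall>u v w. \<eta> v u w = - \<eta> u v w) \<and> (\<forall>u v w. \<eta> u w v = - \<eta> u v w)"

text \<open>\<open>eta_op \<eta> X\<close> is \<open>\<eta>\<^sub>X\<close>; it exists uniquely since \<open>g_can\<close> is nondegenerate.\<close>

definition eta_op ::
  "('n::finite para_space \<Rightarrow> 'n para_space \<Rightarrow> 'n para_space \<Rightarrow> real) \<Rightarrow> 'n para_space \<Rightarrow>
   'n para_space \<Rightarrow> 'n para_space" where
  "eta_op \<eta> X = (THE A. \<forall>Y Z. g_can (A Y) Z = \<eta> X Y Z)"

definition anticommutator :: "('e \<Rightarrow> 'e) \<Rightarrow> ('e \<Rightarrow> 'e) \<Rightarrow> 'e \<Rightarrow> 'e::real_vector" where
  "anticommutator A B = (\<lambda>v. A (B v) + B (A v))"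

definition endo_exp :: "('e \<Rightarrow> 'e) \<Rightarrow> 'e \<Rightarrow> 'e::real_normed_vector" where
  "endo_exp A v = (\<Sum>k. (1 / fact k) *\<^sub>R (A ^^ k) v)"

definition admissible ::
  "'n::finite para_space set \<Rightarrow> ('n para_space \<Rightarrow> 'n para_space \<Rightarrow> 'n para_space \<Rightarrow> real) \<Rightarrow> bool" where
  "admissible U \<eta> \<longleftrightarrow> open U \<and> connected U \<and> 0 \<in> U \<and> three_form \<eta> \<and>
     (\<forall>X Y. eta_op \<eta> X \<circ> eta_op \<eta> Y = (\<lambda>_. 0)) \<and>
     (\<forall>X. anticommutator (eta_op \<eta> X) tau_can = (\<lambda>_. 0))"

text \<open>
  \<open>Basis\<close> consists of the vectors \<open>e\<^sub>i\<close> and \<open>f\<^sub>i\<close>; the Euclidean product with a basis vector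
  \<open>b\<close> (not \<open>g_can\<close>) gives the corresponding linear coordinate.
\<close>

definition tau_eta ::
  "('n::finite para_space \<Rightarrow> 'n para_space \<Rightarrow> 'n para_space \<Rightarrow> real) \<Rightarrow>
   'n para_space \<Rightarrow> 'n para_space \<Rightarrow> 'n para_space" where
  "tau_eta \<eta> x = endo_exp (\<lambda>v. 2 *\<^sub>R (\<Sum>b\<in>Basis. (x \<bullet> b) *\<^sub>R eta_op \<eta> b v)) \<circ> tau_can"

definition can_manifold ::
  "'n::finite para_space set \<Rightarrow> ('n para_space \<Rightarrow> 'n para_space \<Rightarrow> 'n para_space) \<Rightarrow>
   (unit, 'n para_space, 'n para_space) tensor_manifold" where
  "can_manifold U \<tau> = \<lparr>mtop = top_of_set U, cdom = (\<lambda>_. U), cmap = (\<lambda>_ x. x),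
     metric = (\<lambda>_ _. g_can), endo = (\<lambda>_. \<tau>)\<rparr>"

definition M_eta ::
  "'n::finite para_space set \<Rightarrow> ('n para_space \<Rightarrow> 'n para_space \<Rightarrow> 'n para_space \<Rightarrow> real) \<Rightarrow>
   (unit, 'n para_space, 'n para_space) tensor_manifold" where
  "M_eta U \<eta> = can_manifold U (tau_eta \<eta>)"

text \<open>
  \<open>\<eta>\<close> is the three-form of \<open>(U, g_can, \<tau>)\<close>: \<open>D\<^sub>X \<tau> = 2 \<eta>\<^sub>X \<tau>\<close>, that is
  \<open>\<eta>\<^sub>X = 1/2 (D\<^sub>X \<tau>) \<tau>\<close>. Uniqueness of the structure \<open>\<tau>\<close> belonging to \<open>\<eta>\<close> refers to this
  relation; without it the constant structure \<open>tau_can\<close> would be a second flat nearly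
  para-Kaehler structure with the same value at the origin.
\<close>

definition has_three_form ::
  "'n::finite para_space set \<Rightarrow> ('n para_space \<Rightarrow> 'n para_space \<Rightarrow> 'n para_space) \<Rightarrow>
   ('n para_space \<Rightarrow> 'n para_space \<Rightarrow> 'n para_space \<Rightarrow> real) \<Rightarrow> bool" where
  "has_three_form U \<tau> \<eta> \<longleftrightarrow>
     (\<forall>X Y. smooth_on U X \<longrightarrow> smooth_on U Y \<longrightarrow> (\<forall>x\<in>U.
        cov_deriv_endo (\<lambda>_. g_can) \<tau> X Y x = 2 *\<^sub>R eta_op \<eta> (X x) (\<tau> x (Y x))))"

end

theory Submission
  imports Defs
begin

text \<open>
  Since \<open>\<eta>\<^sub>X \<eta>\<^sub>Y = 0\<close>, the exponential series stops after the linear term, so that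
  \<open>\<tau>\<^sub>x = (1 + 2 \<eta>\<^sub>x) \<tau>\<^sub>c\<^sub>a\<^sub>n\<close> and all properties of \<open>M(U, \<eta>)\<close> are linear algebra. Uniqueness: along any
  solution \<open>\<eta>\<^sub>Y \<tau>\<close> has derivative \<open>2 \<eta>\<^sub>Y \<eta>\<^sub>X \<tau> = 0\<close>, hence \<open>d\<tau>(X) = 2 \<eta>\<^sub>X \<tau>\<close> is the constant \<open>2 \<eta>\<^sub>X \<tau>\<^sub>c\<^sub>a\<^sub>n\<close>.

  Conversely, vanishing curvature makes the equation of parallel fields completely integrable. A
  parallel frame, adapted at one point to \<open>g\<close> and \<open>\<tau>\<close>, has a closed dual coframe, whose primitive is an
  isometric chart into \<open>C\<^sup>n\<close>. There the nearly Kaehler condition says that \<open>d\<^sub>W d\<^sub>X \<tau> Y\<close> is skew in \<open>X, Y\<close>,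
  and it is symmetric in \<open>W, X\<close>; so it vanishes and \<open>\<tau>\<^sub>x = \<tau>\<^sub>c\<^sub>a\<^sub>n + A\<^sub>x\<close> is affine. Comparing terms in
  \<open>\<tau>\<^sup>2 = 1\<close> shows that \<open>A\<^sub>X A\<^sub>Y Z\<close> is totally skew and \<open>A\<close> anticommutes with \<open>\<tau>\<^sub>c\<^sub>a\<^sub>n\<close>, which forces
  \<open>A\<^sub>X A\<^sub>Y = 0\<close>; then \<open>\<eta>\<^sub>X = 1/2 A\<^sub>X \<tau>\<^sub>c\<^sub>a\<^sub>n\<close>.
\<close>

subsection \<open>Calculus of \<open>C\<^sup>k\<close> maps\<close>

text \<open>The connection is a definite description, so existence of the Christoffel symbols and
  their smooth dependence on the point must be extracted from the Koszul formula; smoothness comes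
  from a regularity statement for invertible linear systems. Operator fields are handled vector by
  vector, as in the definitions, which ask for smoothness of \<open>\<lambda>x. \<tau> x v\<close>
  with \<open>v\<close> fixed; in finite dimension nothing is lost.

  The parallel equation is overdetermined. Solving it along rays is easy; the content lies in the
  derivative transverse to the rays, and only there curvature enters. Adapting the frame at one
  point settles the metric everywhere, because parallel transport preserves inner products. It fixes
  the endomorphism field at that point only: this field need not be parallel, and its deviation is
  what \<eta> records. That \<open>g\<close> has neutral signature is forced: the eigenspaces of the
  endomorphism are isotropic and of equal dimension, so the metric pairs them with each
  other.\<close>

lemma has_frechet_derivative:
  "f differentiable (at x) \<Longrightarrow> (f has_derivative frechet_derivative f (at x)) (at x)"
  by (simp add: frechet_derivative_works)

lemma frechet_derivative_eqI:
  "(f has_derivative f') (at x) \<Longrightarrow> frechet_derivative f (at x) = f'"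
  by (rule frechet_derivative_at[symmetric])

text \<open>At an interior point the set of derivatives depends on nearby values only, so the choice
  behind \<open>frechet_derivative\<close> picks the same map on both sides, differentiable or
  not.\<close>

lemma frechet_derivative_cong_open:
  assumes "open S" "x \<in> S" "\<And>y. y \<in> S \<Longrightarrow> f y = g y"
  shows "frechet_derivative f (at x) = frechet_derivative g (at x)"
proof -
  have "(f has_derivative D) (at x) \<longleftrightarrow> (g has_derivative D) (at x)" for D
    using assms has_derivative_transform_within_open[of f D x UNIV S g]
      has_derivative_transform_within_open[of g D x UNIV S f] by auto
  then show ?thesis
    by (simp add: frechet_derivative_def)
qed

lemma Ck_on_cong:
  assumes "open S" "\<And>x. x \<in> S \<Longrightarrow> f x = g x" "Ck_on k S f"
  shows "Ck_on k S g"
  using assms(2,3)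
proof (induction k arbitrary: f g)
  case 0
  then show ?case by (simp cong: continuous_on_cong)
next
  case (Suc k)
  have "g differentiable (at x)" if "x \<in> S" for x
    using has_derivative_transform_within_open[OF has_frechet_derivative \<open>open S\<close> that, of f g] Suc.prems that
    by (auto simp: differentiable_def)
  moreover have "frechet_derivative f (at x) v = frechet_derivative g (at x) v" if "x \<in> S" for x v
    using frechet_derivative_cong_open[OF \<open>open S\<close> that] Suc.prems(1) by metis
  ultimately show ?case
    using Suc.IH[of "\<lambda>x. frechet_derivative f (at x) v" "\<lambda>x. frechet_derivative g (at x) v" for v] Suc.prems(2)
    by auto
qed

lemma Ck_on_subset: "Ck_on k S f \<Longrightarrow> T \<subseteq> S \<Longrightarrow> Ck_on k T f"
  by (induction k arbitrary: f) (auto intro: continuous_on_subset)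

lemma Ck_on_SucD: "Ck_on (Suc k) S f \<Longrightarrow> Ck_on k S f"
proof (induction k arbitrary: f)
  case 0
  then show ?case
    by (auto intro!: continuous_at_imp_continuous_on differentiable_imp_continuous_within)
next
  case (Suc k)
  show ?case
    unfolding Ck_on.simps(2)[of k] using Suc.prems Suc.IH unfolding Ck_on.simps(2)[of "Suc k"] by blast
qed

lemma Ck_on_continuous: "Ck_on k S f \<Longrightarrow> continuous_on S f"
  by (induction k) (auto dest: Ck_on_SucD simp del: Ck_on.simps(2))

text \<open>Turns a derivative formula valid on the open set \<open>S\<close> into the recursive
  definition; most regularity arguments below enter through it.\<close>

lemma Ck_on_SucI:
  assumes "open S" "\<And>x. x \<in> S \<Longrightarrow> (f has_derivative f' x) (at x)"
    and "\<And>v. Ck_on k S (\<lambda>x. f' x v)"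
  shows "Ck_on (Suc k) S f"
proof -
  have "Ck_on k S (\<lambda>x. frechet_derivative f (at x) v)" for v
    using assms(2,3) by (intro Ck_on_cong[OF \<open>open S\<close> _ assms(3)[of v]])
      (metis frechet_derivative_eqI)
  with assms(2) show ?thesis
    by (auto simp: differentiable_def)
qed

lemma Ck_on_const: "Ck_on k S (\<lambda>x. c)"
proof (induction k arbitrary: c)
  case (Suc k)
  then show ?case
    by (simp add: frechet_derivative_eqI[OF has_derivative_const])
qed simp

lemma Ck_on_bounded_linear:
  assumes "bounded_linear L" "open S"
  shows "Ck_on k S L"
proof (cases k)
  case 0
  then show ?thesis
    by (simp add: assms(1) linear_continuous_on)
next
  case (Suc m)
  show ?thesis unfolding Suc
    by (rule Ck_on_SucI[OF assms(2) bounded_linear_imp_has_derivative[OF assms(1)] Ck_on_const])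
qed

lemma Ck_on_add:
  assumes "open S" "Ck_on k S f" "Ck_on k S g"
  shows "Ck_on k S (\<lambda>x. f x + g x)"
  using assms(2,3)
proof (induction k arbitrary: f g)
  case 0
  then show ?case by (simp add: continuous_on_add)
next
  case (Suc k)
  show ?case
  proof (rule Ck_on_SucI[OF \<open>open S\<close>])
    fix x assume "x \<in> S"
    with Suc.prems show "((\<lambda>x. f x + g x) has_derivative
        (\<lambda>v. frechet_derivative f (at x) v + frechet_derivative g (at x) v)) (at x)"
      by (auto intro!: has_derivative_add has_frechet_derivative)
  qed (use Suc in auto)
qed

lemma Ck_on_sum:
  assumes "open S" "\<And>i. i \<in> I \<Longrightarrow> Ck_on k S (f i)"
  shows "Ck_on k S (\<lambda>x. \<Sum>i\<in>I. f i x)"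
  using assms(2)
proof (induction I rule: infinite_finite_induct)
  case (insert i I)
  then show ?case by (simp add: Ck_on_add[OF \<open>open S\<close>])
qed (simp_all add: Ck_on_const)

lemma Ck_on_bilinear:
  assumes "bounded_bilinear B" "open S" "Ck_on k S f" "Ck_on k S g"
  shows "Ck_on k S (\<lambda>x. B (f x) (g x))"
  using assms(3,4)
proof (induction k arbitrary: f g)
  case 0
  then show ?case by (simp add: bounded_bilinear.continuous_on[OF assms(1)])
next
  case (Suc k)
  show ?case
  proof (rule Ck_on_SucI[OF \<open>open S\<close>])
    fix x assume "x \<in> S"
    with Suc.prems show "((\<lambda>x. B (f x) (g x)) has_derivative
        (\<lambda>v. B (f x) (frechet_derivative g (at x) v) + B (frechet_derivative f (at x) v) (g x))) (at x)"
      by (auto intro!: bounded_bilinear.FDERIV[OF assms(1)] has_frechet_derivative)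
  next
    fix v
    from Suc.prems have "Ck_on k S f" "Ck_on k S g" by (auto dest: Ck_on_SucD simp del: Ck_on.simps)
    with Suc show "Ck_on k S (\<lambda>x. B (f x) (frechet_derivative g (at x) v) + B (frechet_derivative f (at x) v) (g x))"
      by (intro Ck_on_add[OF \<open>open S\<close>] Suc.IH) auto
  qed
qed

lemmas Ck_on_scaleR = Ck_on_bilinear[OF bounded_bilinear_scaleR]
  and Ck_on_inner = Ck_on_bilinear[OF bounded_bilinear_inner]

lemma Ck_on_linear_comp:
  assumes "bounded_linear L" "open S" "Ck_on k S f"
  shows "Ck_on k S (\<lambda>x. L (f x))"
  using assms(3)
proof (induction k arbitrary: f)
  case 0
  then show ?case by (simp add: bounded_linear.continuous_on[OF assms(1)])
next
  case (Suc k)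
  show ?case
  proof (rule Ck_on_SucI[OF \<open>open S\<close>])
    fix x assume "x \<in> S"
    with Suc.prems show "((\<lambda>x. L (f x)) has_derivative (\<lambda>v. L (frechet_derivative f (at x) v))) (at x)"
      by (auto intro!: bounded_linear.has_derivative[OF assms(1)] has_frechet_derivative)
  qed (use Suc in auto)
qed

lemma Ck_on_minus: "open S \<Longrightarrow> Ck_on k S f \<Longrightarrow> Ck_on k S (\<lambda>x. - f x)"
  by (rule Ck_on_linear_comp[OF bounded_linear_minus[OF bounded_linear_ident]])

lemma Ck_on_diff:
  "open S \<Longrightarrow> Ck_on k S f \<Longrightarrow> Ck_on k S g \<Longrightarrow> Ck_on k S (\<lambda>x. f x - g x)"
  using Ck_on_add[of S k f "\<lambda>x. - g x"] Ck_on_minus[of S k g] by simp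

lemma linear_sum_Basis:
  fixes L :: "'a::euclidean_space \<Rightarrow> 'b::real_vector"
  assumes "linear L"
  shows "L v = (\<Sum>b\<in>Basis. (v \<bullet> b) *\<^sub>R L b)"
proof -
  have "L v = L (\<Sum>b\<in>Basis. (v \<bullet> b) *\<^sub>R b)" by (simp add: euclidean_representation)
  also have "\<dots> = (\<Sum>b\<in>Basis. (v \<bullet> b) *\<^sub>R L b)"
    by (simp add: linear_sum[OF assms] linear_scale[OF assms])
  finally show ?thesis .
qed

text \<open>Expanding \<open>w x\<close> in the basis gives a finite sum of scalar functions times
  the columns \<open>L x b\<close>. Regularity of the operator family is therefore only asked column
  by column, and no space of operators appears.\<close>

lemma Ck_on_apply:
  fixes w :: "'a::real_normed_vector \<Rightarrow> 'b::euclidean_space" and L :: "'a \<Rightarrow> 'b \<Rightarrow> 'c::real_normed_vector"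
  assumes "open S" "\<And>x. x \<in> S \<Longrightarrow> linear (L x)" "\<And>b. b \<in> Basis \<Longrightarrow> Ck_on k S (\<lambda>x. L x b)" "Ck_on k S w"
  shows "Ck_on k S (\<lambda>x. L x (w x))"
proof (rule Ck_on_cong[OF assms(1)])
  show "(\<Sum>b\<in>Basis. (w x \<bullet> b) *\<^sub>R L x b) = L x (w x)" if "x \<in> S" for x
    using linear_sum_Basis[OF assms(2)[OF that], of "w x"] by simp
  show "Ck_on k S (\<lambda>x. \<Sum>b\<in>Basis. (w x \<bullet> b) *\<^sub>R L x b)"
    by (intro Ck_on_sum Ck_on_scaleR Ck_on_inner Ck_on_const assms)
qed

text \<open>The chain rule writes the derivative as the linear family
  \<open>frechet_derivative f (at (g x))\<close> applied to the derivative of \<open>g\<close>. The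
  columns of that family are compositions one class lower, so \<open>Ck_on_apply\<close> closes the
  induction.\<close>

lemma Ck_on_compose:
  fixes g :: "'a::real_normed_vector \<Rightarrow> 'b::euclidean_space" and f :: "'b \<Rightarrow> 'c::real_normed_vector"
  assumes "open S" "Ck_on k T f" "Ck_on k S g" "g ` S \<subseteq> T"
  shows "Ck_on k S (\<lambda>x. f (g x))"
  using assms(2,3)
proof (induction k arbitrary: f)
  case 0
  then show ?case using assms(4) continuous_on_compose2[of T f S g] by simp
next
  case (Suc k)
  show ?case
  proof (rule Ck_on_SucI[OF \<open>open S\<close>])
    fix x assume "x \<in> S"
    with Suc.prems assms(4) show "((\<lambda>x. f (g x)) has_derivative
        (\<lambda>v. frechet_derivative f (at (g x)) (frechet_derivative g (at x) v))) (at x)"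
      by (intro has_derivative_compose[of g _ x UNIV f] has_frechet_derivative) auto
  next
    fix v
    show "Ck_on k S (\<lambda>x. frechet_derivative f (at (g x)) (frechet_derivative g (at x) v))"
    proof (rule Ck_on_apply[OF \<open>open S\<close>])
      show "linear (frechet_derivative f (at (g x)))" if "x \<in> S" for x
        using Suc.prems(1) assms(4) that by (auto intro!: linear_frechet_derivative)
      show "Ck_on k S (\<lambda>x. frechet_derivative f (at (g x)) b)" for b
        using Suc.prems Ck_on_SucD[OF Suc.prems(2)] by (intro Suc.IH[of "\<lambda>y. frechet_derivative f (at y) b"]) auto
      show "Ck_on k S (\<lambda>x. frechet_derivative g (at x) v)"
        using Suc.prems(2) by simp
    qed
  qed
qed

subsection \<open>Smooth maps\<close>

lemma smooth_onD: "smooth_on S f \<Longrightarrow> Ck_on k S f"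
  by (simp add: smooth_on_def)

lemma smooth_on_differentiable: "smooth_on S f \<Longrightarrow> x \<in> S \<Longrightarrow> f differentiable (at x)"
  using smooth_onD[of S f "Suc 0"] by simp

lemma smooth_on_has_derivative:
  "smooth_on S f \<Longrightarrow> x \<in> S \<Longrightarrow> (f has_derivative frechet_derivative f (at x)) (at x)"
  by (rule has_frechet_derivative[OF smooth_on_differentiable])

lemma smooth_on_frechet: "smooth_on S f \<Longrightarrow> smooth_on S (\<lambda>x. frechet_derivative f (at x) v)"
  unfolding smooth_on_def by (metis Ck_on.simps(2))

lemma smooth_on_continuous: "smooth_on S f \<Longrightarrow> continuous_on S f"
  unfolding smooth_on_def by (metis Ck_on.simps(1))

lemma smooth_on_subset: "smooth_on S f \<Longrightarrow> T \<subseteq> S \<Longrightarrow> smooth_on T f"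
  unfolding smooth_on_def using Ck_on_subset by blast

lemma smooth_on_cong: "open S \<Longrightarrow> (\<And>x. x \<in> S \<Longrightarrow> f x = g x) \<Longrightarrow> smooth_on S f \<Longrightarrow> smooth_on S g"
  unfolding smooth_on_def using Ck_on_cong by blast

lemma smooth_on_const: "smooth_on S (\<lambda>x. c)"
  by (simp add: smooth_on_def Ck_on_const)

lemma smooth_on_bounded_linear: "bounded_linear L \<Longrightarrow> open S \<Longrightarrow> smooth_on S L"
  by (simp add: smooth_on_def Ck_on_bounded_linear)

lemma smooth_on_ident: "open S \<Longrightarrow> smooth_on S (\<lambda>x. x)"
  by (rule smooth_on_bounded_linear[OF bounded_linear_ident])

lemma smooth_on_add: "open S \<Longrightarrow> smooth_on S f \<Longrightarrow> smooth_on S g \<Longrightarrow> smooth_on S (\<lambda>x. f x + g x)"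
  by (simp add: smooth_on_def Ck_on_add)

lemma smooth_on_diff: "open S \<Longrightarrow> smooth_on S f \<Longrightarrow> smooth_on S g \<Longrightarrow> smooth_on S (\<lambda>x. f x - g x)"
  by (simp add: smooth_on_def Ck_on_diff)

lemma smooth_on_minus: "open S \<Longrightarrow> smooth_on S f \<Longrightarrow> smooth_on S (\<lambda>x. - f x)"
  by (simp add: smooth_on_def Ck_on_minus)

lemma smooth_on_sum: "open S \<Longrightarrow> (\<And>i. i \<in> I \<Longrightarrow> smooth_on S (f i)) \<Longrightarrow> smooth_on S (\<lambda>x. \<Sum>i\<in>I. f i x)"
  by (simp add: smooth_on_def Ck_on_sum)

lemma smooth_on_bilinear:
  "bounded_bilinear B \<Longrightarrow> open S \<Longrightarrow> smooth_on S f \<Longrightarrow> smooth_on S g \<Longrightarrow> smooth_on S (\<lambda>x. B (f x) (g x))"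
  by (simp add: smooth_on_def Ck_on_bilinear)

lemmas smooth_on_scaleR = smooth_on_bilinear[OF bounded_bilinear_scaleR]
  and smooth_on_inner = smooth_on_bilinear[OF bounded_bilinear_inner]

lemma smooth_on_apply:
  fixes w :: "'a::real_normed_vector \<Rightarrow> 'b::euclidean_space" and L :: "'a \<Rightarrow> 'b \<Rightarrow> 'c::real_normed_vector"
  shows "open S \<Longrightarrow> (\<And>x. x \<in> S \<Longrightarrow> linear (L x)) \<Longrightarrow> (\<And>b. smooth_on S (\<lambda>x. L x b)) \<Longrightarrow>
    smooth_on S w \<Longrightarrow> smooth_on S (\<lambda>x. L x (w x))"
  unfolding smooth_on_def using Ck_on_apply[of S L _ w] by auto

lemma smooth_on_compose:
  fixes g :: "'a::real_normed_vector \<Rightarrow> 'b::euclidean_space" and f :: "'b \<Rightarrow> 'c::real_normed_vector"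
  shows "open S \<Longrightarrow> smooth_on T f \<Longrightarrow> smooth_on S g \<Longrightarrow> g ` S \<subseteq> T \<Longrightarrow> smooth_on S (\<lambda>x. f (g x))"
  unfolding smooth_on_def using Ck_on_compose[of S _ T f g] by auto

section \<open>Differentiating families of linear maps\<close>

lemma linear_family_frechet_derivative:
  fixes L :: "'a::real_normed_vector \<Rightarrow> 'b::euclidean_space \<Rightarrow> 'c::real_normed_vector"
  assumes "open S" "x \<in> S" "\<And>x. x \<in> S \<Longrightarrow> linear (L x)"
    and L: "\<And>b. (\<lambda>x. L x b) differentiable (at x)"
  shows "frechet_derivative (\<lambda>y. L y c) (at x) v =
    (\<Sum>b\<in>Basis. (c \<bullet> b) *\<^sub>R frechet_derivative (\<lambda>y. L y b) (at x) v)"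
proof -
  have "((\<lambda>y. \<Sum>b\<in>Basis. (c \<bullet> b) *\<^sub>R L y b) has_derivative
      (\<lambda>v. \<Sum>b\<in>Basis. (c \<bullet> b) *\<^sub>R frechet_derivative (\<lambda>y. L y b) (at x) v)) (at x)"
    by (intro has_derivative_sum has_derivative_scaleR_right has_frechet_derivative[OF L])
  then have "((\<lambda>y. L y c) has_derivative
      (\<lambda>v. \<Sum>b\<in>Basis. (c \<bullet> b) *\<^sub>R frechet_derivative (\<lambda>y. L y b) (at x) v)) (at x)"
    by (rule has_derivative_transform_within_open[OF _ assms(1,2)])
      (metis linear_sum_Basis[OF assms(3)])
  then show ?thesis
    by (metis (no_types, lifting) frechet_derivative_eqI)
qed

lemma linear_frechet_derivative_family:
  fixes L :: "'a::real_normed_vector \<Rightarrow> 'b::euclidean_space \<Rightarrow> 'c::real_normed_vector"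
  assumes "open S" "x \<in> S" "\<And>x. x \<in> S \<Longrightarrow> linear (L x)"
    and "\<And>b. (\<lambda>x. L x b) differentiable (at x)"
  shows "linear (\<lambda>c. frechet_derivative (\<lambda>y. L y c) (at x) v)"
proof -
  have "linear (\<lambda>c. \<Sum>b\<in>Basis. (c \<bullet> b) *\<^sub>R frechet_derivative (\<lambda>y. L y b) (at x) v)"
    by (rule linearI) (simp_all add: inner_add_left scaleR_add_left sum.distrib scaleR_sum_right)
  moreover have "(\<lambda>c. frechet_derivative (\<lambda>y. L y c) (at x) v) =
      (\<lambda>c. \<Sum>b\<in>Basis. (c \<bullet> b) *\<^sub>R frechet_derivative (\<lambda>y. L y b) (at x) v)"
    by (rule ext) (rule linear_family_frechet_derivative[OF assms])
  ultimately show ?thesis by simp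
qed

text \<open>The Leibniz rule for evaluating a moving operator on a moving vector, the form in which
  the covariant derivatives below are computed. In the basis it is the product rule for a finite
  sum.\<close>

lemma linear_family_has_derivative:
  fixes w :: "'a::real_normed_vector \<Rightarrow> 'b::euclidean_space" and L :: "'a \<Rightarrow> 'b \<Rightarrow> 'c::real_normed_vector"
  assumes "open S" "x \<in> S" "\<And>x. x \<in> S \<Longrightarrow> linear (L x)"
    and L: "\<And>b. (\<lambda>x. L x b) differentiable (at x)" and w: "(w has_derivative w') (at x)"
  shows "((\<lambda>x. L x (w x)) has_derivative (\<lambda>v. frechet_derivative (\<lambda>y. L y (w x)) (at x) v + L x (w' v))) (at x)"
proof -
  have *: "(\<Sum>b\<in>Basis. (w y \<bullet> b) *\<^sub>R L y b) = L y (w y)" if "y \<in> S" for y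
    using linear_sum_Basis[OF assms(3)[OF that], of "w y"] by simp
  note 1 = linear_family_frechet_derivative[OF assms(1-4)]
  have "((\<lambda>y. \<Sum>b\<in>Basis. (w y \<bullet> b) *\<^sub>R L y b) has_derivative
      (\<lambda>v. \<Sum>b\<in>Basis. (w x \<bullet> b) *\<^sub>R frechet_derivative (\<lambda>y. L y b) (at x) v + (w' v \<bullet> b) *\<^sub>R L x b)) (at x)"
    by (intro has_derivative_sum has_derivative_scaleR has_frechet_derivative[OF L] has_derivative_inner_left w)
  moreover have "(\<Sum>b\<in>Basis. (w x \<bullet> b) *\<^sub>R frechet_derivative (\<lambda>y. L y b) (at x) v + (w' v \<bullet> b) *\<^sub>R L x b) =
      frechet_derivative (\<lambda>y. L y (w x)) (at x) v + L x (w' v)" for v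
    by (subst linear_sum_Basis[OF assms(3)[OF assms(2)], of "w' v"]) (simp add: sum.distrib 1[symmetric])
  ultimately have "((\<lambda>y. \<Sum>b\<in>Basis. (w y \<bullet> b) *\<^sub>R L y b) has_derivative
      (\<lambda>v. frechet_derivative (\<lambda>y. L y (w x)) (at x) v + L x (w' v))) (at x)"
    by simp
  then show ?thesis
    by (rule has_derivative_transform_within_open[OF _ assms(1,2) *])
qed

subsection \<open>Symmetry of second derivatives\<close>

text \<open>Two applications of the mean value theorem, along \<open>u\<close> and then along
  \<open>v\<close>. The left-hand side is symmetric in \<open>u\<close> and \<open>v\<close> while
  the right-hand side is a mixed second derivative taken in one fixed order.\<close>

lemma second_difference_eq:
  fixes f :: "'a::real_normed_vector \<Rightarrow> real"
  assumes f: "\<And>y. y \<in> ball x d \<Longrightarrow> (f has_derivative f' y) (at y)"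
    and f': "\<And>y. y \<in> ball x d \<Longrightarrow> ((\<lambda>y. f' y u) has_derivative f2 y) (at y)"
    and h: "0 < h" "h * norm u + h * norm v < d"
  shows "\<exists>p\<in>ball x d. f (x + h *\<^sub>R u + h *\<^sub>R v) - f (x + h *\<^sub>R u) - f (x + h *\<^sub>R v) + f x = h * h * f2 p v"
proof -
  have in_ball: "x + s *\<^sub>R u + t *\<^sub>R v \<in> ball x d" if "0 \<le> s" "s \<le> h" "0 \<le> t" "t \<le> h" for s t
  proof -
    have "norm (s *\<^sub>R u + t *\<^sub>R v) \<le> norm (s *\<^sub>R u) + norm (t *\<^sub>R v)" by (rule norm_triangle_ineq)
    also have "\<dots> \<le> h * norm u + h * norm v"
      using that by (auto intro!: add_mono mult_right_mono)
    also have "\<dots> < d" by (rule h)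
    finally show ?thesis by (metis add.assoc add_diff_cancel_left' dist_commute dist_norm mem_ball)
  qed
  have "\<exists>z>0. z < h \<and> (f (x + h *\<^sub>R u + h *\<^sub>R v) - f (x + h *\<^sub>R u)) - (f (x + 0 *\<^sub>R u + h *\<^sub>R v) - f (x + 0 *\<^sub>R u))
      = (h - 0) * (f' (x + z *\<^sub>R u + h *\<^sub>R v) u - f' (x + z *\<^sub>R u) u)"
  proof (rule MVT2[where f = "\<lambda>s. f (x + s *\<^sub>R u + h *\<^sub>R v) - f (x + s *\<^sub>R u)"])
    fix s assume s: "0 \<le> s" "s \<le> h"
    have 1: "((\<lambda>s. f (x + s *\<^sub>R u + h *\<^sub>R v)) has_derivative (\<lambda>t. f' (x + s *\<^sub>R u + h *\<^sub>R v) (t *\<^sub>R u))) (at s)"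
      using in_ball[of s h] s h
      by (intro has_derivative_compose[OF _ f]) (auto intro!: derivative_eq_intros)
    have 2: "((\<lambda>s. f (x + s *\<^sub>R u)) has_derivative (\<lambda>t. f' (x + s *\<^sub>R u) (t *\<^sub>R u))) (at s)"
      using in_ball[of s 0] s h
      by (intro has_derivative_compose[OF _ f]) (auto intro!: derivative_eq_intros)
    have l: "linear (f' y)" if "y \<in> ball x d" for y
      using f[OF that] by (rule has_derivative_linear)
    show "((\<lambda>s. f (x + s *\<^sub>R u + h *\<^sub>R v) - f (x + s *\<^sub>R u)) has_real_derivative
        f' (x + s *\<^sub>R u + h *\<^sub>R v) u - f' (x + s *\<^sub>R u) u) (at s)"
      unfolding has_field_derivative_def
      by (rule has_derivative_eq_rhs[OF has_derivative_diff[OF 1 2]])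
        (use l[OF in_ball[of s h]] l[OF in_ball[of s 0]] s h in \<open>auto simp: fun_eq_iff linear_scale algebra_simps\<close>)
  qed (rule h)
  then obtain s where s: "0 < s" "s < h" and e1:
    "f (x + h *\<^sub>R u + h *\<^sub>R v) - f (x + h *\<^sub>R u) - f (x + h *\<^sub>R v) + f x
      = h * (f' (x + s *\<^sub>R u + h *\<^sub>R v) u - f' (x + s *\<^sub>R u) u)"
    by auto
  have "\<exists>z>0. z < h \<and> f' (x + s *\<^sub>R u + h *\<^sub>R v) u - f' (x + s *\<^sub>R u + 0 *\<^sub>R v) u
      = (h - 0) * f2 (x + s *\<^sub>R u + z *\<^sub>R v) v"
  proof (rule MVT2[where f = "\<lambda>t. f' (x + s *\<^sub>R u + t *\<^sub>R v) u"])
    fix t assume t: "0 \<le> t" "t \<le> h"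
    have 1: "((\<lambda>t. f' (x + s *\<^sub>R u + t *\<^sub>R v) u) has_derivative (\<lambda>r. f2 (x + s *\<^sub>R u + t *\<^sub>R v) (r *\<^sub>R v))) (at t)"
      using in_ball[of s t] s t
      by (intro has_derivative_compose[OF _ f']) (auto intro!: derivative_eq_intros)
    have "linear (f2 (x + s *\<^sub>R u + t *\<^sub>R v))"
      using f'[OF in_ball[of s t]] s t by (auto intro: has_derivative_linear)
    then show "((\<lambda>t. f' (x + s *\<^sub>R u + t *\<^sub>R v) u) has_real_derivative f2 (x + s *\<^sub>R u + t *\<^sub>R v) v) (at t)"
      unfolding has_field_derivative_def
      by (intro has_derivative_eq_rhs[OF 1]) (auto simp: fun_eq_iff linear_scale)
  qed (rule h)
  then obtain t where t: "0 < t" "t < h" and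
    "f' (x + s *\<^sub>R u + h *\<^sub>R v) u - f' (x + s *\<^sub>R u) u = h * f2 (x + s *\<^sub>R u + t *\<^sub>R v) v"
    by auto
  with e1 in_ball[of s t] s t show ?thesis
    by (intro bexI[of _ "x + s *\<^sub>R u + t *\<^sub>R v"]) auto
qed

text \<open>Evaluating the same second difference in both orders gives equal mixed derivatives at
  two points near \<open>x\<close>; continuity of the second derivatives moves both points to
  \<open>x\<close>.\<close>

lemma second_derivative_symmetric_real:
  fixes f :: "'a::real_normed_vector \<Rightarrow> real"
  assumes "open S" "x \<in> S" "Ck_on 2 S f"
  defines "D \<equiv> \<lambda>u v y. frechet_derivative (\<lambda>z. frechet_derivative f (at z) u) (at y) v"
  shows "D u v x = D v u x"
proof -
  have f: "(f has_derivative frechet_derivative f (at y)) (at y)" if "y \<in> S" for y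
    using assms(3) that by (auto simp: numeral_2_eq_2 intro: has_frechet_derivative)
  have f': "((\<lambda>z. frechet_derivative f (at z) w) has_derivative
      frechet_derivative (\<lambda>z. frechet_derivative f (at z) w) (at y)) (at y)" if "y \<in> S" for y w
    using assms(3) that by (auto simp: numeral_2_eq_2 intro: has_frechet_derivative)
  have cont: "isCont (D w z) x" for w z
    using assms(1-3) unfolding D_def by (auto simp: numeral_2_eq_2 continuous_on_eq_continuous_at)
  have "\<bar>D u v x - D v u x\<bar> < e" if "e > 0" for e
  proof -
    obtain d0 where "d0 > 0" and d0: "ball x d0 \<subseteq> S"
      using assms(1,2) open_contains_ball by blast
    obtain d1 where "d1 > 0" and d1: "\<And>y. dist y x < d1 \<Longrightarrow> dist (D u v y) (D u v x) < e/2"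
      using metric_LIM_D[OF cont[of u v, unfolded isCont_def], of "e/2"] \<open>e > 0\<close>
      by (metis dist_self half_gt_zero)
    obtain d2 where "d2 > 0" and d2: "\<And>y. dist y x < d2 \<Longrightarrow> dist (D v u y) (D v u x) < e/2"
      using metric_LIM_D[OF cont[of v u, unfolded isCont_def], of "e/2"] \<open>e > 0\<close>
      by (metis dist_self half_gt_zero)
    define d where "d = min d0 (min d1 d2)"
    have "d > 0" using \<open>d0 > 0\<close> \<open>d1 > 0\<close> \<open>d2 > 0\<close> by (simp add: d_def)
    \<comment> \<open>With this \<open>h\<close> the sides of the parallelogram have total length
      below \<open>d / 2\<close>, so it stays inside the ball; the summand 1 keeps the denominator
      positive.\<close>
    define h where "h = d / (2 * (norm u + norm v + 1))"
    have "h > 0" using \<open>d > 0\<close> by (simp add: h_def add_nonneg_pos)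
    have "h * (norm u + norm v + 1) = d / 2"
      unfolding h_def by (simp add: field_simps add_nonneg_eq_0_iff)
    then have h: "h * norm u + h * norm v < d"
      using \<open>h > 0\<close> \<open>d > 0\<close> by (simp add: algebra_simps)
    then have h': "h * norm v + h * norm u < d" by simp
    have sub: "ball x d \<subseteq> S" using d0 by (auto simp: d_def)
    obtain p where p: "p \<in> ball x d" "f (x + h *\<^sub>R u + h *\<^sub>R v) - f (x + h *\<^sub>R u) - f (x + h *\<^sub>R v) + f x = h * h * D u v p"
      using second_difference_eq[of x d f "\<lambda>y. frechet_derivative f (at y)" u
          "\<lambda>y. frechet_derivative (\<lambda>z. frechet_derivative f (at z) u) (at y)" h v] f f' sub h \<open>h > 0\<close>
      unfolding D_def by blast
    obtain q where q: "q \<in> ball x d" "f (x + h *\<^sub>R v + h *\<^sub>R u) - f (x + h *\<^sub>R v) - f (x + h *\<^sub>R u) + f x = h * h * D v u q"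
      using second_difference_eq[of x d f "\<lambda>y. frechet_derivative f (at y)" v
          "\<lambda>y. frechet_derivative (\<lambda>z. frechet_derivative f (at z) v) (at y)" h u] f f' sub h' \<open>h > 0\<close>
      unfolding D_def by blast
    have "f (x + h *\<^sub>R v + h *\<^sub>R u) = f (x + h *\<^sub>R u + h *\<^sub>R v)" by (simp add: ac_simps)
    with p(2) q(2) have "h * h * D u v p = h * h * D v u q" by linarith
    then have "D u v p = D v u q" using \<open>h > 0\<close> by simp
    moreover have "\<bar>D u v p - D u v x\<bar> < e/2" "\<bar>D v u q - D v u x\<bar> < e/2"
      using d1[of p] d2[of q] p(1) q(1) by (auto simp: d_def dist_real_def dist_commute)
    ultimately show ?thesis by linarith
  qed
  then show ?thesis
    by (metis abs_le_zero_iff eq_iff_diff_eq_0 less_irrefl linorder_le_less_linear)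
qed

lemma frechet_derivative_inner:
  assumes "f differentiable (at x)"
  shows "frechet_derivative (\<lambda>y. f y \<bullet> b) (at x) v = frechet_derivative f (at x) v \<bullet> b"
  using frechet_derivative_eqI[OF has_derivative_inner_left[OF has_frechet_derivative[OF assms]]] by metis

text \<open>The mean value theorem is an equality for real functions only, hence the passage through
  components.\<close>

lemma second_derivative_symmetric:
  fixes f :: "'a::real_normed_vector \<Rightarrow> 'b::euclidean_space"
  assumes "open S" "x \<in> S" "smooth_on S f"
  shows "frechet_derivative (\<lambda>y. frechet_derivative f (at y) u) (at x) v =
    frechet_derivative (\<lambda>y. frechet_derivative f (at y) v) (at x) u"
proof (rule euclidean_eqI)
  fix b :: 'b
  have 1: "frechet_derivative (\<lambda>z. frechet_derivative (\<lambda>y. f y \<bullet> b) (at z) p) (at x) q =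
      frechet_derivative (\<lambda>y. frechet_derivative f (at y) p) (at x) q \<bullet> b" for p q
  proof -
    have "frechet_derivative (\<lambda>z. frechet_derivative (\<lambda>y. f y \<bullet> b) (at z) p) (at x) =
        frechet_derivative (\<lambda>z. frechet_derivative f (at z) p \<bullet> b) (at x)"
      by (rule frechet_derivative_cong_open[OF assms(1,2)])
        (simp add: frechet_derivative_inner smooth_on_differentiable[OF assms(3)])
    then show ?thesis
      by (simp add: frechet_derivative_inner smooth_on_differentiable[OF smooth_on_frechet[OF assms(3)] assms(2)])
  qed
  have "Ck_on 2 S (\<lambda>y. f y \<bullet> b)"
    using smooth_on_inner[OF assms(1,3) smooth_on_const] by (rule smooth_onD)
  from second_derivative_symmetric_real[OF assms(1,2) this, of u v]
  show "frechet_derivative (\<lambda>y. frechet_derivative f (at y) u) (at x) v \<bullet> b =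
    frechet_derivative (\<lambda>y. frechet_derivative f (at y) v) (at x) u \<bullet> b"
    unfolding 1 .
qed

subsection \<open>Solutions of linear systems depending smoothly on a parameter\<close>

text \<open>Since \<open>g\<close> vanishes at \<open>x\<close>, the increment of \<open>a\<close>
  is multiplied by something of first order, so continuity of \<open>a\<close> suffices. This serves
  for the components of a solution not yet known to be differentiable.\<close>

lemma has_derivative_continuous_scaleR:
  fixes g :: "'a::real_normed_vector \<Rightarrow> 'b::real_normed_vector"
  assumes a: "isCont a x" and g: "(g has_derivative g') (at x)" "g x = 0"
  shows "((\<lambda>y. a y *\<^sub>R g y) has_derivative (\<lambda>v. a x *\<^sub>R g' v)) (at x)"
proof -
  have bl: "bounded_linear g'" using g(1) by (rule has_derivative_bounded_linear)
  have lim: "((\<lambda>y. norm (g y - g' (y - x)) / norm (y - x)) \<longlongrightarrow> 0) (at x)"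
    using g unfolding has_derivative_iff_norm by simp
  have a0: "((\<lambda>y. \<bar>a y - a x\<bar>) \<longlongrightarrow> 0) (at x)"
    using a by (intro tendsto_rabs_zero) (simp add: isCont_def LIM_zero)
  have "((\<lambda>y. (a y - a x) *\<^sub>R g y) has_derivative (\<lambda>v. 0)) (at x)"
    unfolding has_derivative_iff_norm
  proof (intro conjI)
    have 0: "((\<lambda>y. \<bar>a y - a x\<bar> * (norm (g y - g' (y - x)) / norm (y - x) + onorm g')) \<longlongrightarrow> 0 * (0 + onorm g')) (at x)"
      by (intro tendsto_intros a0 lim)
    show "((\<lambda>y. norm ((a y - a x) *\<^sub>R g y - (a x - a x) *\<^sub>R g x - 0) / norm (y - x)) \<longlongrightarrow> 0) (at x)"
    proof (rule tendsto_sandwich[OF _ _ tendsto_const])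
      show "\<forall>\<^sub>F y in at x. norm ((a y - a x) *\<^sub>R g y - (a x - a x) *\<^sub>R g x - 0) / norm (y - x)
          \<le> \<bar>a y - a x\<bar> * (norm (g y - g' (y - x)) / norm (y - x) + onorm g')"
        unfolding eventually_at_filter
      proof (intro always_eventually allI impI)
        fix y assume "y \<noteq> x"
        then have p: "norm (y - x) > 0" by simp
        have "norm (g y) \<le> norm (g y - g' (y - x)) + norm (g' (y - x))"
          by (metis diff_add_cancel norm_triangle_ineq)
        also have "\<dots> \<le> norm (g y - g' (y - x)) + onorm g' * norm (y - x)"
          using onorm[OF bl] by (simp add: add_left_mono)
        finally have "norm (g y) / norm (y - x) \<le> norm (g y - g' (y - x)) / norm (y - x) + onorm g'"
          using p by (simp add: field_simps)
        from mult_left_mono[OF this, of "\<bar>a y - a x\<bar>"]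
        show "norm ((a y - a x) *\<^sub>R g y - (a x - a x) *\<^sub>R g x - 0) / norm (y - x)
          \<le> \<bar>a y - a x\<bar> * (norm (g y - g' (y - x)) / norm (y - x) + onorm g')"
          by simp
      qed
    qed (use 0 in auto)
  qed simp
  from has_derivative_add[OF this has_derivative_scaleR_right[OF g(1), of "a x"]]
  show ?thesis by (simp add: algebra_simps)
qed

text \<open>Injectivity at \<open>x\<close> gives a lower bound
  \<open>c * norm w \<le> norm (G x w)\<close>. The sum \<open>m y\<close> over the columns
  dominates the operator norm of \<open>G y - G x\<close>; once it is below \<open>c / 2\<close>,
  the unknown difference \<open>s y - s x\<close> on the right can be absorbed on the left.\<close>

lemma linear_system_continuous:
  fixes G :: "'a::euclidean_space \<Rightarrow> 'b::euclidean_space \<Rightarrow> 'b"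
  assumes "open S" "x \<in> S" and lin: "\<And>x. x \<in> S \<Longrightarrow> linear (G x)"
    and inj: "\<And>w. G x w = 0 \<Longrightarrow> w = 0"
    and G: "\<And>b. isCont (\<lambda>x. G x b) x" and r: "isCont r x"
    and eq: "\<And>x. x \<in> S \<Longrightarrow> G x (s x) = r x"
  shows "isCont s x"
proof -
  have "inj (G x)"
    using inj lin[OF assms(2)] by (simp add: linear_injective_0)
  from linear_inj_bounded_below_pos[OF lin[OF assms(2)] this]
  obtain c where c: "c > 0" "\<And>w. c * norm w \<le> norm (G x w)" by blast
  define m where "m = (\<lambda>y. \<Sum>b\<in>Basis. norm (G y b - G x b))"
  have "((\<lambda>y. G y b - G x b) \<longlongrightarrow> 0) (at x)" for b
    using G[of b] by (simp add: isCont_def LIM_zero)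
  then have m0: "(m \<longlongrightarrow> 0) (at x)"
    unfolding m_def by (intro tendsto_null_sum tendsto_norm_zero)
  have Gm: "norm (G y w - G x w) \<le> m y * norm w" if "y \<in> S" for y w
  proof -
    have "G y w - G x w = (\<Sum>b\<in>Basis. (w \<bullet> b) *\<^sub>R (G y b - G x b))"
      using linear_sum_Basis[OF linear_compose_sub[OF lin[OF that] lin[OF assms(2)]]] .
    also have "norm \<dots> \<le> (\<Sum>b\<in>Basis. norm w * norm (G y b - G x b))"
      by (intro sum_norm_le) (auto intro!: mult_right_mono Basis_le_norm)
    finally show ?thesis by (simp add: m_def sum_distrib_left mult.commute)
  qed
  have "(\<lambda>y. s y - s x) \<midarrow>x\<rightarrow> 0"
  proof (rule Lim_null_comparison)
    show "((\<lambda>y. (2 / c) * (norm (r y - r x) + m y * norm (s x))) \<longlongrightarrow> 0) (at x)"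
    proof -
      have "((\<lambda>y. norm (r y - r x)) \<longlongrightarrow> 0) (at x)"
        using r by (intro tendsto_norm_zero) (simp add: isCont_def LIM_zero)
      then have "((\<lambda>y. (2 / c) * (norm (r y - r x) + m y * norm (s x))) \<longlongrightarrow> (2 / c) * (0 + 0 * norm (s x))) (at x)"
        by (intro tendsto_intros m0)
      then show ?thesis by simp
    qed
    have "\<forall>\<^sub>F y in at x. m y < c / 2" using c(1) by (intro order_tendstoD(2)[OF m0]) simp
    moreover have "\<forall>\<^sub>F y in at x. y \<in> S"
      using assms(1,2) by (simp add: eventually_at_in_open')
    ultimately show "\<forall>\<^sub>F y in at x. norm (s y - s x) \<le> (2 / c) * (norm (r y - r x) + m y * norm (s x))"
    proof eventually_elim
      case (elim y)
      have "G x (s y - s x) = (r y - r x) - (G y (s y) - G x (s y))"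
        using eq[OF elim(2)] eq[OF assms(2)] by (simp add: linear_diff[OF lin[OF assms(2)]])
      then have "c * norm (s y - s x) \<le> norm (r y - r x) + m y * norm (s y)"
        using c(2)[of "s y - s x"] Gm[OF elim(2), of "s y"]
        by (smt (verit) norm_triangle_ineq4)
      also have "m y * norm (s y) \<le> m y * (norm (s y - s x) + norm (s x))"
        using norm_triangle_ineq[of "s y - s x" "s x"] by (intro mult_left_mono) (auto simp: m_def sum_nonneg)
      also have "\<dots> \<le> c / 2 * norm (s y - s x) + m y * norm (s x)"
        using mult_right_mono[OF less_imp_le[OF elim(1)], of "norm (s y - s x)"] by (simp add: distrib_left)
      finally have "c / 2 * norm (s y - s x) \<le> norm (r y - r x) + m y * norm (s x)"
        by (simp add: algebra_simps)
      then show ?case using c(1) by (simp add: field_simps)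
    qed
  qed
  then show ?thesis by (simp add: isCont_def LIM_zero_iff)
qed

text \<open>With \<open>L\<close> inverse to \<open>G x\<close> there is the exact identity
  \<open>s y = s x + L (r y - r x - (G y - G x) (s y))\<close>. The last term is a continuous factor
  times one that is differentiable and vanishes at \<open>x\<close>, so \<open>s\<close> is
  differentiable without circularity.\<close>

lemma linear_system_has_derivative:
  fixes G :: "'a::euclidean_space \<Rightarrow> 'b::euclidean_space \<Rightarrow> 'b"
  assumes "open S" "x \<in> S" and lin: "\<And>x. x \<in> S \<Longrightarrow> linear (G x)"
    and inj: "\<And>w. G x w = 0 \<Longrightarrow> w = 0"
    and G: "\<And>b. (\<lambda>x. G x b) differentiable (at x)" and r: "(r has_derivative r') (at x)"
    and eq: "\<And>x. x \<in> S \<Longrightarrow> G x (s x) = r x"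
  shows "\<exists>s'. (s has_derivative s') (at x) \<and>
    (\<forall>v. G x (s' v) = r' v - frechet_derivative (\<lambda>y. G y (s x)) (at x) v)"
proof -
  have cont: "isCont s x"
    by (rule linear_system_continuous[OF assms(1-4) _ _ eq])
      (auto intro: differentiable_imp_continuous_within G has_derivative_continuous[OF r])
  have lx: "linear (G x)" using lin assms(2) .
  have "inj (G x)"
    using inj lx by (simp add: linear_injective_0)
  from linear_injective_isomorphism[OF lx this]
  obtain L where L: "linear L" "\<And>w. L (G x w) = w" "\<And>w. G x (L w) = w" by auto
  define q where "q = (\<lambda>v. \<Sum>b\<in>Basis. (s x \<bullet> b) *\<^sub>R frechet_derivative (\<lambda>y. G y b) (at x) v)"
  have "((\<lambda>y. (s y \<bullet> b) *\<^sub>R (G y b - G x b)) has_derivative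
      (\<lambda>v. (s x \<bullet> b) *\<^sub>R frechet_derivative (\<lambda>y. G y b) (at x) v)) (at x)" for b
    by (rule has_derivative_continuous_scaleR)
      (use has_derivative_diff[OF has_frechet_derivative[OF G] has_derivative_const] cont in
        \<open>auto intro!: continuous_intros\<close>)
  then have "((\<lambda>y. \<Sum>b\<in>Basis. (s y \<bullet> b) *\<^sub>R (G y b - G x b)) has_derivative q) (at x)"
    unfolding q_def by (intro has_derivative_sum)
  from has_derivative_diff[OF has_derivative_diff[OF r has_derivative_const] this]
  have "((\<lambda>y. r y - r x - (\<Sum>b\<in>Basis. (s y \<bullet> b) *\<^sub>R (G y b - G x b))) has_derivative
      (\<lambda>v. r' v - q v)) (at x)"
    by simp
  from has_derivative_add[OF has_derivative_const[of "s x"]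
      bounded_linear.has_derivative[OF linear_conv_bounded_linear[THEN iffD1, OF L(1)] this]]
  have "((\<lambda>y. s x + L (r y - r x - (\<Sum>b\<in>Basis. (s y \<bullet> b) *\<^sub>R (G y b - G x b)))) has_derivative
      (\<lambda>v. L (r' v - q v))) (at x)"
    by simp
  then have "(s has_derivative (\<lambda>v. L (r' v - q v))) (at x)"
  proof (rule has_derivative_transform_within_open[OF _ assms(1,2)])
    fix y assume y: "y \<in> S"
    have "(\<Sum>b\<in>Basis. (s y \<bullet> b) *\<^sub>R (G y b - G x b)) = G y (s y) - G x (s y)"
      using linear_sum_Basis[OF linear_compose_sub[OF lin[OF y] lx]] by metis
    then have "r y - r x - (\<Sum>b\<in>Basis. (s y \<bullet> b) *\<^sub>R (G y b - G x b)) = G x (s y - s x)"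
      using eq[OF y] eq[OF assms(2)] by (simp add: linear_diff[OF lx])
    then show "s x + L (r y - r x - (\<Sum>b\<in>Basis. (s y \<bullet> b) *\<^sub>R (G y b - G x b))) = s y"
      by (simp add: L)
  qed
  moreover have "q v = frechet_derivative (\<lambda>y. G y (s x)) (at x) v" for v
    unfolding q_def by (rule linear_family_frechet_derivative[OF assms(1-3) G, symmetric])
  ultimately show ?thesis
    using L(3) by auto
qed

text \<open>The derivative of \<open>s\<close> solves a system with the same \<open>G\<close> and a
  right-hand side made from \<open>r\<close>, \<open>G\<close> and \<open>s\<close>. Hence the
  induction on \<open>k\<close> keeps \<open>G\<close> fixed and generalises over \<open>r\<close>
  and \<open>s\<close>; inverse matrices never have to be differentiated.\<close>

lemma smooth_on_linear_system:
  fixes G :: "'a::euclidean_space \<Rightarrow> 'b::euclidean_space \<Rightarrow> 'b"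
  assumes "open S" and lin: "\<And>x. x \<in> S \<Longrightarrow> linear (G x)"
    and inj: "\<And>x w. x \<in> S \<Longrightarrow> G x w = 0 \<Longrightarrow> w = 0"
    and G: "\<And>b. smooth_on S (\<lambda>x. G x b)"
    and eq: "\<And>x. x \<in> S \<Longrightarrow> G x (s x) = r x" and r: "Ck_on k S r"
  shows "Ck_on k S s"
  using eq r
proof (induction k arbitrary: r s)
  case 0
  have "isCont s x" if "x \<in> S" for x
  proof (rule linear_system_continuous[OF \<open>open S\<close> that lin inj[OF that], where r = r])
    show "isCont (\<lambda>x. G x b) x" for b
      using smooth_on_continuous[OF G] \<open>open S\<close> that by (simp add: continuous_on_eq_continuous_at)
    show "isCont r x"
      using 0 \<open>open S\<close> that by (simp add: continuous_on_eq_continuous_at)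
  qed (use 0 in auto)
  then show ?case by (simp add: continuous_at_imp_continuous_on)
next
  case (Suc k)
  have "\<exists>s'. (s has_derivative s') (at x) \<and>
    (\<forall>v. G x (s' v) = frechet_derivative r (at x) v - frechet_derivative (\<lambda>y. G y (s x)) (at x) v)"
    if "x \<in> S" for x
  proof (rule linear_system_has_derivative[OF \<open>open S\<close> that])
    show "(r has_derivative frechet_derivative r (at x)) (at x)"
      using Suc.prems(2) that by (simp add: has_frechet_derivative)
    show "(\<lambda>x. G x b) differentiable (at x)" for b
      by (rule smooth_on_differentiable[OF G that])
  qed (use lin inj[OF that] Suc.prems(1) in auto)
  then obtain s' where s': "\<And>x. x \<in> S \<Longrightarrow> (s has_derivative s' x) (at x)"
    and Gs': "\<And>x v. x \<in> S \<Longrightarrow> G x (s' x v) = frechet_derivative r (at x) v - frechet_derivative (\<lambda>y. G y (s x)) (at x) v"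
    using bchoice[of S "\<lambda>x s'. (s has_derivative s') (at x) \<and>
    (\<forall>v. G x (s' v) = frechet_derivative r (at x) v - frechet_derivative (\<lambda>y. G y (s x)) (at x) v)"] by blast
  show ?case
  proof (rule Ck_on_SucI[OF \<open>open S\<close> s'])
    fix v
    show "Ck_on k S (\<lambda>x. s' x v)"
    proof (rule Suc.IH[OF Gs'])
      have "Ck_on k S s" by (rule Suc.IH[OF Suc.prems(1) Ck_on_SucD[OF Suc.prems(2)]])
      moreover have "linear (\<lambda>c. frechet_derivative (\<lambda>y. G y c) (at x) v)" if "x \<in> S" for x
        by (rule linear_frechet_derivative_family[OF \<open>open S\<close> that lin smooth_on_differentiable[OF G that]])
      ultimately have "Ck_on k S (\<lambda>x. frechet_derivative (\<lambda>y. G y (s x)) (at x) v)"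
        using Ck_on_apply[OF \<open>open S\<close>, of "\<lambda>x c. frechet_derivative (\<lambda>y. G y c) (at x) v" k s]
          smooth_onD[OF smooth_on_frechet[OF G]] by blast
      then show "Ck_on k S (\<lambda>x. frechet_derivative r (at x) v - frechet_derivative (\<lambda>y. G y (s x)) (at x) v)"
        using Suc.prems(2) by (intro Ck_on_diff[OF \<open>open S\<close>]) simp_all
    qed
  qed
qed

subsection \<open>The Levi-Civita connection\<close>

text \<open>\<open>G\<close> represents \<open>h\<close> through the Euclidean product.
  Nondegeneracy makes it injective, hence surjective in finite dimension.\<close>

lemma nondegenerate_riesz:
  fixes h :: "'e::euclidean_space \<Rightarrow> 'e \<Rightarrow> real"
  assumes h: "bilinear h" and nd: "\<And>u. (\<And>v. h u v = 0) \<Longrightarrow> u = 0" and K: "linear K"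
  obtains s where "\<And>w. h s w = K w"
proof -
  define G where "G = (\<lambda>s. \<Sum>b\<in>Basis. h s b *\<^sub>R b)"
  have lG: "linear G"
    unfolding G_def by (rule linearI)
      (simp_all add: bilinear_ladd[OF h] bilinear_lmul[OF h] scaleR_add_left sum.distrib scaleR_sum_right)
  have Gb: "G s \<bullet> b = h s b" if "b \<in> Basis" for s b
    using that by (simp add: G_def inner_sum_left inner_Basis if_distrib cong: if_cong)
  have lh: "linear (h s)" for s using h by (simp add: bilinear_def)
  have "inj G"
    unfolding linear_injective_0[OF lG]
  proof (intro allI impI)
    fix s assume "G s = 0"
    then have "h s b = 0" if "b \<in> Basis" for b using Gb[OF that, of s] by simp
    then show "s = 0"
      by (intro nd) (subst linear_sum_Basis[OF lh], simp)
  qed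
  then obtain s where s: "G s = (\<Sum>b\<in>Basis. K b *\<^sub>R b)"
    using linear_injective_imp_surjective[OF lG] by (metis surjD)
  have "h s w = K w" for w
  proof -
    have "h s b = K b" if "b \<in> Basis" for b
      using Gb[OF that, of s] that unfolding s by (simp add: inner_sum_left inner_Basis if_distrib cong: if_cong)
    then show ?thesis
      by (subst linear_sum_Basis[OF lh], subst linear_sum_Basis[OF K]) simp
  qed
  then show ?thesis by (rule that)
qed

lemma nondegenerate_eqI:
  assumes h: "bilinear h" and nd: "\<And>u. (\<And>v. h u v = 0) \<Longrightarrow> u = 0" and "\<And>w. h s w = h t w"
  shows "s = t"
proof -
  have "s - t = 0" by (rule nd) (simp add: bilinear_lsub[OF h] assms(3))
  then show ?thesis by simp
qed

text \<open>What \<open>pseudo_riemannian\<close> says about a single chart. The local geometry is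
  developed here, away from the atlas.\<close>

locale chart_metric =
  fixes S :: "'e::euclidean_space set" and g :: "'e \<Rightarrow> 'e \<Rightarrow> 'e \<Rightarrow> real"
  assumes open_S: "open S"
    and smooth_g: "\<And>u v. smooth_on S (\<lambda>x. g x u v)"
    and bilinear_g: "\<And>x. x \<in> S \<Longrightarrow> bilinear (g x)"
    and sym_g: "\<And>x u v. x \<in> S \<Longrightarrow> g x u v = g x v u"
    and nondeg_g: "\<And>x u. x \<in> S \<Longrightarrow> (\<And>v. g x u v = 0) \<Longrightarrow> u = 0"
begin

definition dg where "dg x u v w = frechet_derivative (\<lambda>y. g y v w) (at x) u"

abbreviation "\<Gamma> \<equiv> christoffel g"

lemma diff_g: "x \<in> S \<Longrightarrow> (\<lambda>y. g y v w) differentiable (at x)"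
  using smooth_on_differentiable[OF smooth_g] .

lemma lin_g1: "x \<in> S \<Longrightarrow> linear (\<lambda>u. g x u v)" and lin_g2: "x \<in> S \<Longrightarrow> linear (g x u)"
  using bilinear_g unfolding bilinear_def by blast+

lemma dg_lin1: "x \<in> S \<Longrightarrow> linear (\<lambda>u. dg x u v w)"
  unfolding dg_def by (rule linear_frechet_derivative[OF diff_g])

lemma dg_lin2: "x \<in> S \<Longrightarrow> linear (\<lambda>v. dg x u v w)"
  unfolding dg_def
  by (rule linear_frechet_derivative_family[OF open_S _ lin_g1 diff_g])

lemma dg_lin3: "x \<in> S \<Longrightarrow> linear (\<lambda>w. dg x u v w)"
  unfolding dg_def
  by (rule linear_frechet_derivative_family[OF open_S _ lin_g2 diff_g])

lemma dg_sym: "x \<in> S \<Longrightarrow> dg x u v w = dg x u w v"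
  unfolding dg_def using frechet_derivative_cong_open[OF open_S, of x "\<lambda>y. g y v w" "\<lambda>y. g y w v"] sym_g by metis

text \<open>The Koszul formula for constant fields: their brackets vanish, which leaves the three
  derivatives of the metric.\<close>

definition koszul where "koszul x u v w = (dg x u v w + dg x v u w - dg x w u v) / 2"

lemma koszul_lin1: "x \<in> S \<Longrightarrow> linear (\<lambda>u. koszul x u v w)"
  and koszul_lin2: "x \<in> S \<Longrightarrow> linear (\<lambda>v. koszul x u v w)"
  and koszul_lin3: "x \<in> S \<Longrightarrow> linear (\<lambda>w. koszul x u v w)"
  using dg_lin1[of x] dg_lin2[of x] dg_lin3[of x] unfolding koszul_def linear_iff by (auto simp: field_simps)

text \<open>Adding two cyclic instances of metric compatibility and subtracting the third leaves
  \<open>2 * g x (G u v) w\<close>, because symmetry of \<open>G\<close> cancels all other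
  terms.\<close>

lemma christoffel_unique:
  assumes "x \<in> S" "\<And>u v. G u v = G v u"
    "\<And>u v w. frechet_derivative (\<lambda>y. g y v w) (at x) u = g x (G u v) w + g x v (G u w)"
  shows "g x (G u v) w = koszul x u v w"
proof -
  have "g x v (G u w) = g x (G w u) v" "g x u (G v w) = g x u (G w v)" "G v u = G u v"
    using assms(2)[of u w] assms(2)[of v w] assms(2)[of u v] sym_g[OF assms(1), of v] by auto
  then show ?thesis
    using assms(3)[of v w u] assms(3)[of u w v] assms(3)[of u v w] unfolding koszul_def dg_def by simp
qed

text \<open>Needed before anything can be said about \<open>christoffel\<close>, which is a definite
  description. The witness represents the Koszul expression by nondegeneracy of the metric.\<close>

lemma christoffel_exists:
  assumes "x \<in> S"
  shows "\<exists>!G. bilinear G \<and> (\<forall>u v. G u v = G v u) \<and>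
     (\<forall>u v w. frechet_derivative (\<lambda>y. g y v w) (at x) u = g x (G u v) w + g x v (G u w))"
proof -
  have nd: "s = t" if "\<And>w. g x s w = g x t w" for s t
    using nondegenerate_eqI[OF bilinear_g[OF assms] nondeg_g[OF assms] that] by simp
  have "\<forall>u v. \<exists>s. \<forall>w. g x s w = koszul x u v w"
    using nondegenerate_riesz[OF bilinear_g[OF assms] nondeg_g[OF assms] koszul_lin3[OF assms]] by metis
  then obtain G where G: "\<And>u v w. g x (G u v) w = koszul x u v w" by metis
  have "bilinear G"
    unfolding bilinear_def
  proof (intro conjI allI linearI)
    fix u v w :: 'e and c :: real
    show "G u (v + w) = G u v + G u w" "G (v + w) u = G v u + G w u"
      "G u (c *\<^sub>R v) = c *\<^sub>R G u v" "G (c *\<^sub>R v) u = c *\<^sub>R G v u"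
      by (rule nd; simp add: G linear_add[OF lin_g1[OF assms]] linear_scale[OF lin_g1[OF assms]]
        linear_add[OF koszul_lin1[OF assms]] linear_add[OF koszul_lin2[OF assms]]
        linear_scale[OF koszul_lin1[OF assms]] linear_scale[OF koszul_lin2[OF assms]])+
  qed
  moreover have "G u v = G v u" for u v
  proof (rule nd)
    show "g x (G u v) w = g x (G v u) w" for w
      unfolding G koszul_def using dg_sym[OF assms, of w u v] by simp
  qed
  moreover have "frechet_derivative (\<lambda>y. g y v w) (at x) u = g x (G u v) w + g x v (G u w)" for u v w
    using dg_sym[OF assms] unfolding sym_g[OF assms, of v] G koszul_def dg_def[symmetric]
    by (simp add: field_simps)
  moreover have "H = G" if "\<forall>u v. H u v = H v u"
     "\<forall>u v w. frechet_derivative (\<lambda>y. g y v w) (at x) u = g x (H u v) w + g x v (H u w)" for H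
    by (intro ext nd) (unfold G, rule christoffel_unique[OF assms], (use that in blast)+)
  ultimately show ?thesis by - (rule ex1I[of _ G], (intro conjI allI; assumption?), blast+)
qed

lemma christoffel_bilinear: "x \<in> S \<Longrightarrow> bilinear (\<Gamma> x)"
  and christoffel_sym: "x \<in> S \<Longrightarrow> \<Gamma> x u v = \<Gamma> x v u"
  and christoffel_metric: "x \<in> S \<Longrightarrow>
    frechet_derivative (\<lambda>y. g y v w) (at x) u = g x (\<Gamma> x u v) w + g x v (\<Gamma> x u w)"
  using theI'[OF christoffel_exists] unfolding christoffel_def by blast+

lemma christoffel_koszul: "x \<in> S \<Longrightarrow> g x (\<Gamma> x u v) w = koszul x u v w"
  by (rule christoffel_unique[OF _ christoffel_sym christoffel_metric])

text \<open>Read against the basis vectors, the Koszul formula is a linear system for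
  \<open>\<Gamma> x u v\<close> with smooth coefficients that is injective at every point.\<close>

lemma smooth_christoffel: "smooth_on S (\<lambda>x. \<Gamma> x u v)"
  unfolding smooth_on_def
proof
  fix k
  show "Ck_on k S (\<lambda>x. \<Gamma> x u v)"
  proof (rule smooth_on_linear_system[OF open_S, where G = "\<lambda>x s. \<Sum>b\<in>Basis. g x s b *\<^sub>R b"
        and r = "\<lambda>x. \<Sum>b\<in>Basis. koszul x u v b *\<^sub>R b"])
    show "linear (\<lambda>s. \<Sum>b\<in>Basis. g x s b *\<^sub>R b)" if "x \<in> S" for x
      by (rule linearI) (simp_all add: linear_add[OF lin_g1[OF that]] linear_scale[OF lin_g1[OF that]]
        scaleR_add_left sum.distrib scaleR_sum_right)
    show "w = 0" if "x \<in> S" "(\<Sum>b\<in>Basis. g x w b *\<^sub>R b) = 0" for x w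
    proof (rule nondeg_g[OF that(1)])
      have "g x w b = 0" if "b \<in> Basis" for b
        using arg_cong[OF \<open>(\<Sum>b\<in>Basis. g x w b *\<^sub>R b) = 0\<close>, of "\<lambda>z. z \<bullet> b"] that
        by (simp add: inner_sum_left inner_Basis if_distrib cong: if_cong)
      then show "g x w v = 0" for v
        by (subst linear_sum_Basis[OF lin_g2[OF that(1)]]) simp
    qed
    show "smooth_on S (\<lambda>x. \<Sum>ba\<in>Basis. g x b ba *\<^sub>R ba)" for b
      by (intro smooth_on_sum smooth_on_scaleR smooth_on_const open_S smooth_g)
    show "(\<Sum>b\<in>Basis. g x (\<Gamma> x u v) b *\<^sub>R b) = (\<Sum>b\<in>Basis. koszul x u v b *\<^sub>R b)" if "x \<in> S" for x
      by (simp add: christoffel_koszul[OF that])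
    have "smooth_on S (\<lambda>x. koszul x u v b)" for b
      unfolding koszul_def dg_def divide_inverse
      by (subst mult.commute, intro smooth_on_bilinear[OF bounded_bilinear_mult] smooth_on_add smooth_on_diff
          open_S smooth_on_frechet smooth_g smooth_on_const)
    then show "Ck_on k S (\<lambda>x. \<Sum>b\<in>Basis. koszul x u v b *\<^sub>R b)"
      by (intro smooth_onD smooth_on_sum smooth_on_scaleR smooth_on_const open_S)
  qed
qed

lemma christoffel_linear1: "x \<in> S \<Longrightarrow> linear (\<lambda>u. \<Gamma> x u v)"
  and christoffel_linear2: "x \<in> S \<Longrightarrow> linear (\<Gamma> x u)"
  using christoffel_bilinear unfolding bilinear_def by blast+

text \<open>Constant fields commute, so the bracket term is a derivative along 0. What remains is
  the integrability condition of the equation of parallel fields.\<close>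

lemma curvature_const:
  assumes x: "x \<in> S"
  shows "curvature g (\<lambda>_. u) (\<lambda>_. v) (\<lambda>_. w) x =
    frechet_derivative (\<lambda>y. \<Gamma> y v w) (at x) u + \<Gamma> x u (\<Gamma> x v w)
    - frechet_derivative (\<lambda>y. \<Gamma> y u w) (at x) v - \<Gamma> x v (\<Gamma> x u w)"
proof -
  have "\<Gamma> x 0 w = 0" for w using linear_0[OF christoffel_linear1[OF x]] .
  then show ?thesis
    by (simp add: curvature_def cov_deriv_def[abs_def] lie_bracket_def frechet_derivative_eqI[OF has_derivative_const])
qed

lemma cov_deriv_endo_const:
  "cov_deriv_endo g \<tau> (\<lambda>_. u) (\<lambda>_. v) x =
    frechet_derivative (\<lambda>y. \<tau> y v) (at x) u + \<Gamma> x u (\<tau> x v) - \<tau> x (\<Gamma> x u v)"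
  by (simp add: cov_deriv_endo_def cov_deriv_def frechet_derivative_eqI[OF has_derivative_const])

end

subsection \<open>Radial primitives of one-forms\<close>

lemma radial_in_ball:
  fixes x z :: "'a::real_normed_vector"
  assumes "x \<in> ball z r" "t \<in> {0..1}"
  shows "z + t *\<^sub>R (x - z) \<in> ball z r"
proof -
  have "t * norm (x - z) \<le> norm (x - z)"
    using assms(2) by (intro mult_left_le_one_le) auto
  then show ?thesis
    using assms by (simp add: dist_norm norm_minus_commute)
qed

text \<open>Poincare's homotopy formula for the radial contraction onto the centre of the ball.\<close>

lemma radial_primitive:
  fixes \<beta> :: "'a::euclidean_space \<Rightarrow> 'a \<Rightarrow> 'w::euclidean_space"
  assumes lin: "\<And>x. x \<in> ball z r \<Longrightarrow> linear (\<beta> x)"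
    and C1: "\<And>v. Ck_on 1 (ball z r) (\<lambda>x. \<beta> x v)"
  defines "I \<equiv> \<lambda>x. integral {0..1} (\<lambda>t. \<beta> (z + t *\<^sub>R (x - z)) (x - z))"
    and "D \<equiv> \<lambda>x u v. frechet_derivative (\<lambda>y. \<beta> y u) (at x) v"
  shows "Ck_on 1 (ball z r) I"
    and "\<And>x. x \<in> ball z r \<Longrightarrow> (I has_derivative (\<lambda>v. \<beta> x v +
      integral {0..1} (\<lambda>t. t *\<^sub>R (D (z + t *\<^sub>R (x - z)) (x - z) v - D (z + t *\<^sub>R (x - z)) v (x - z))))) (at x)"
    and "\<And>x v. x \<in> ball z r \<Longrightarrow> continuous_on {0..1}
      (\<lambda>t. t *\<^sub>R (D (z + t *\<^sub>R (x - z)) (x - z) v - D (z + t *\<^sub>R (x - z)) v (x - z)))"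
proof -
  let ?B = "ball z r"
  let ?p = "\<lambda>x t. z + t *\<^sub>R (x - z)"
  have op: "open ?B" by simp
  have diff: "(\<lambda>y. \<beta> y u) differentiable (at x)" if "x \<in> ?B" for x u
    using C1[of u] that by simp
  have contD: "continuous_on ?B (\<lambda>x. D x u v)" for u v
    using C1[of u] unfolding D_def by simp
  have cont\<beta>: "continuous_on ?B (\<lambda>x. \<beta> x u)" for u
    by (rule Ck_on_continuous[OF C1])
  have D_expand: "D y c v = (\<Sum>b\<in>Basis. (c \<bullet> b) *\<^sub>R D y b v)" if "y \<in> ?B" for y c v
    unfolding D_def by (rule linear_family_frechet_derivative[OF op that lin diff[OF that]])
  have linD: "linear (D y c)" if "y \<in> ?B" for y c
    unfolding D_def by (rule linear_frechet_derivative[OF diff[OF that]])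
  have linD1: "linear (\<lambda>c. D y c v)" if "y \<in> ?B" for y v
    unfolding D_def by (rule linear_frechet_derivative_family[OF op that lin diff[OF that]])
  \<comment> \<open>The derivative in \<open>x\<close> of the integrand: the first term comes from
    moving the base point, which contributes the factor \<open>t\<close>, the second from the
    argument \<open>x - z\<close>.\<close>
  define F where "F = (\<lambda>x t v. t *\<^sub>R D (?p x t) (x - z) v + \<beta> (?p x t) v)"
  have pc: "continuous_on (?B \<times> {0..1}) (\<lambda>(x, t). ?p x t)"
    by (auto intro!: continuous_intros simp: case_prod_unfold)
  have pin: "(\<lambda>(x, t). ?p x t) ` (?B \<times> {0..1}) \<subseteq> ?B"
    using radial_in_ball by fastforce
  have contDp: "continuous_on (?B \<times> {0..1}) (\<lambda>(x, t). D (?p x t) b v)" for b v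
    using continuous_on_compose2[OF contD pc pin, of b v] by (simp add: case_prod_unfold)
  have cont\<beta>p: "continuous_on (?B \<times> {0..1}) (\<lambda>(x, t). \<beta> (?p x t) v)" for v
    using continuous_on_compose2[OF cont\<beta> pc pin, of v] by (simp add: case_prod_unfold)
  have contDp': "continuous_on (?B \<times> {0..1}) (\<lambda>(x, t). D (?p x t) (x - z) v)" for v
  proof (rule continuous_on_eq)
    show "continuous_on (?B \<times> {0..1}) (\<lambda>(x, t). \<Sum>b\<in>Basis. ((x - z) \<bullet> b) *\<^sub>R D (?p x t) b v)"
      using contDp unfolding case_prod_unfold by (intro continuous_intros)
    show "(case xt of (x, t) \<Rightarrow> \<Sum>b\<in>Basis. ((x - z) \<bullet> b) *\<^sub>R D (?p x t) b v) =
        (case xt of (x, t) \<Rightarrow> D (?p x t) (x - z) v)" if "xt \<in> ?B \<times> {0..1}" for xt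
      using D_expand[OF radial_in_ball[of "fst xt" z r "snd xt"], of "fst xt - z" v] that
      unfolding case_prod_unfold mem_Times_iff by metis
  qed
  have contF: "continuous_on (?B \<times> {0..1}) (\<lambda>(x, t). F x t v)" for v
    unfolding F_def case_prod_unfold using contDp'[of v] cont\<beta>p[of v] unfolding case_prod_unfold
    by (intro continuous_intros)
  have slice: "continuous_on {0..1} (\<lambda>t. h (x, t))"
    if "continuous_on (?B \<times> {0..1}) h" "x \<in> ?B" for h :: "'a \<times> real \<Rightarrow> 'w" and x
    by (rule continuous_on_compose2[OF that(1)]) (use that(2) in \<open>auto intro!: continuous_intros\<close>)
  have linF: "linear (F x t)" if "x \<in> ?B" "t \<in> {0..1}" for x t
    using linD[OF radial_in_ball[OF that]] lin[OF radial_in_ball[OF that]]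
    unfolding F_def by (intro linear_compose_add linear_compose_scale_right)
  have derF: "((\<lambda>x. \<beta> (?p x t) (x - z)) has_derivative F x t) (at x)" if x: "x \<in> ?B" and t: "t \<in> {0..1}" for x t
  proof -
    have p': "((\<lambda>x. ?p x t) has_derivative (\<lambda>v. t *\<^sub>R v)) (at x)"
      by (auto intro!: derivative_eq_intros)
    have 1: "((\<lambda>x. \<beta> (?p x t) c) has_derivative (\<lambda>v. D (?p x t) c (t *\<^sub>R v))) (at x)" for c
      unfolding D_def
      by (rule has_derivative_compose[OF p' has_frechet_derivative[OF diff[OF radial_in_ball[OF x t]]]])
    have "((\<lambda>x. \<beta> (?p x t) (x - z)) has_derivative (\<lambda>v. frechet_derivative (\<lambda>y. \<beta> (?p y t) (x - z)) (at x) v + \<beta> (?p x t) v)) (at x)"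
    proof (rule linear_family_has_derivative[OF op x])
      show "linear (\<beta> (?p y t))" if "y \<in> ?B" for y
        by (rule lin[OF radial_in_ball[OF that t]])
      show "(\<lambda>y. \<beta> (?p y t) b) differentiable (at x)" for b
        using 1 by (auto simp: differentiable_def)
    qed (auto intro!: derivative_eq_intros)
    moreover have "frechet_derivative (\<lambda>y. \<beta> (?p y t) (x - z)) (at x) v = t *\<^sub>R D (?p x t) (x - z) v" for v
      using frechet_derivative_eqI[OF 1] linear_scale[OF linD[OF radial_in_ball[OF x t]]] by metis
    ultimately show ?thesis unfolding F_def by simp
  qed
  have bl: "bounded_linear (F x t)" if "x \<in> ?B" "t \<in> {0..1}" for x t
    using linF[OF that] by (simp add: linear_conv_bounded_linear)
  \<comment> \<open>Differentiation under the integral asks for a derivative that is continuous as a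
    bounded linear map; in finite dimension this may be checked on fixed vectors.\<close>
  have contBl: "continuous_on (?B \<times> cbox 0 1) (\<lambda>(x, t). Blinfun (F x t))"
  proof (rule continuous_on_blinfun_componentwise)
    fix i :: 'a
    show "continuous_on (?B \<times> cbox 0 1) (\<lambda>xt. blinfun_apply (case xt of (x, t) \<Rightarrow> Blinfun (F x t)) i)"
      by (rule continuous_on_eq[OF contF[of i, folded box_real(2)]])
        (auto simp: bounded_linear_Blinfun_apply bl)
  qed
  have intF: "(\<lambda>t. F x t v) integrable_on {0..1}" if "x \<in> ?B" for x v
    using slice[OF contF that] by (simp add: integrable_continuous_interval)
  have derI: "(I has_derivative (\<lambda>v. integral {0..1} (\<lambda>t. F x t v))) (at x)" if x: "x \<in> ?B" for x
  proof -
    have "((\<lambda>x. integral (cbox 0 1) (\<lambda>t. \<beta> (?p x t) (x - z))) has_derivative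
        blinfun_apply (integral (cbox 0 1) (\<lambda>t. Blinfun (F x t)))) (at x within ?B)"
    proof (rule leibniz_rule[OF _ _ contBl x convex_ball])
      show "((\<lambda>x. \<beta> (?p x t) (x - z)) has_derivative blinfun_apply (Blinfun (F y t))) (at y within ?B)"
        if "y \<in> ?B" "t \<in> cbox 0 1" for y t
        using derF[OF that(1)] that bl[OF that(1)]
        by (simp add: bounded_linear_Blinfun_apply has_derivative_at_withinI)
      have "continuous_on (?B \<times> {0..1}) (\<lambda>(x, t). \<Sum>b\<in>Basis. ((x - z) \<bullet> b) *\<^sub>R \<beta> (?p x t) b)"
        using cont\<beta>p unfolding case_prod_unfold by (intro continuous_intros)
      then have "continuous_on (?B \<times> {0..1}) (\<lambda>(x, t). \<beta> (?p x t) (x - z))"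
        by (rule continuous_on_eq)
          (use linear_sum_Basis[OF lin[OF radial_in_ball]] in \<open>auto simp: case_prod_unfold\<close>)
      from slice[OF this] show "(\<lambda>t. \<beta> (?p y t) (y - z)) integrable_on cbox 0 1" if "y \<in> ?B" for y
        using that by (simp add: integrable_continuous_interval)
    qed
    moreover have "blinfun_apply (integral (cbox 0 1) (\<lambda>t. Blinfun (F x t))) = (\<lambda>v. integral {0..1} (\<lambda>t. F x t v))"
    proof (rule ext)
      fix v
      have "continuous_on (cbox 0 1) (\<lambda>t. Blinfun (F x t))"
        using x by (intro continuous_on_compose2[OF contBl, of "cbox 0 1" "\<lambda>t. (x, t)", simplified case_prod_conv])
          (auto intro!: continuous_intros)
      then have "blinfun_apply (integral (cbox 0 1) (\<lambda>t. Blinfun (F x t))) v =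
          integral (cbox 0 1) (\<lambda>t. blinfun_apply (Blinfun (F x t)) v)"
        by (intro blinfun_apply_integral integrable_continuous)
      also have "\<dots> = integral {0..1} (\<lambda>t. F x t v)"
        unfolding box_real by (rule integral_cong) (simp only: bounded_linear_Blinfun_apply[OF bl[OF x]])
      finally show "blinfun_apply (integral (cbox 0 1) (\<lambda>t. Blinfun (F x t))) v = integral {0..1} (\<lambda>t. F x t v)" .
    qed
    ultimately show ?thesis
      unfolding I_def by (simp add: at_within_open[OF x op])
  qed
  show "Ck_on 1 ?B I"
    unfolding One_nat_def
  proof (rule Ck_on_SucI[OF op derI])
    show "Ck_on 0 ?B (\<lambda>x. integral {0..1} (\<lambda>t. F x t v))" for v
      using integral_continuous_on_param[of ?B 0 1 "\<lambda>x t. F x t v"] contF[of v] by simp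
  qed
  show cc: "continuous_on {0..1} (\<lambda>t. t *\<^sub>R (D (?p x t) (x - z) v - D (?p x t) v (x - z)))" if x: "x \<in> ?B" for x v
  proof -
    have "continuous_on {0..1} (\<lambda>t. D (?p x t) b c)" for b c
      using slice[OF contDp x, of b c] by simp
    then show ?thesis by (intro continuous_intros)
  qed
  show "(I has_derivative (\<lambda>v. \<beta> x v + integral {0..1} (\<lambda>t. t *\<^sub>R (D (?p x t) (x - z) v - D (?p x t) v (x - z))))) (at x)"
    if x: "x \<in> ?B" for x
  proof (rule has_derivative_eq_rhs[OF derI[OF x]], rule ext)
    fix v
    \<comment> \<open>The derivative of \<open>t *\<^sub>R \<beta> (?p x t) v\<close> in
      \<open>t\<close> integrates to \<open>\<beta> x v\<close>. Splitting it off from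
      \<open>F x t v\<close> leaves exactly the antisymmetric part of \<open>D\<close>.\<close>
    have "((\<lambda>t. \<beta> (?p x t) v + t *\<^sub>R D (?p x t) v (x - z)) has_integral 1 *\<^sub>R \<beta> (?p x 1) v - 0 *\<^sub>R \<beta> (?p x 0) v) {0..1}"
    proof (rule fundamental_theorem_of_calculus)
      fix t :: real assume t: "t \<in> {0..1}"
      have p': "((\<lambda>t. ?p x t) has_derivative (\<lambda>s. s *\<^sub>R (x - z))) (at t)"
        by (auto intro!: derivative_eq_intros)
      have 1: "((\<lambda>t. \<beta> (?p x t) v) has_derivative (\<lambda>s. D (?p x t) v (s *\<^sub>R (x - z)))) (at t)"
        unfolding D_def
        by (rule has_derivative_compose[OF p' has_frechet_derivative[OF diff[OF radial_in_ball[OF x t]]]])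
      have "((\<lambda>t. t *\<^sub>R \<beta> (?p x t) v) has_derivative (\<lambda>s. t *\<^sub>R D (?p x t) v (s *\<^sub>R (x - z)) + s *\<^sub>R \<beta> (?p x t) v)) (at t)"
        by (rule has_derivative_scaleR[OF has_derivative_ident 1])
      then have "((\<lambda>t. t *\<^sub>R \<beta> (?p x t) v) has_vector_derivative \<beta> (?p x t) v + t *\<^sub>R D (?p x t) v (x - z)) (at t)"
        unfolding has_vector_derivative_def
        by (rule has_derivative_eq_rhs)
          (simp only: fun_eq_iff linear_scale[OF linD[OF radial_in_ball[OF x t]]], simp add: scaleR_add_right mult.commute)
      then show "((\<lambda>t. t *\<^sub>R \<beta> (?p x t) v) has_vector_derivative \<beta> (?p x t) v + t *\<^sub>R D (?p x t) v (x - z)) (at t within {0..1})"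
        by (rule has_vector_derivative_at_within)
    qed simp
    then have A: "((\<lambda>t. \<beta> (?p x t) v + t *\<^sub>R D (?p x t) v (x - z)) has_integral \<beta> x v) {0..1}" by simp
    have "((\<lambda>t. t *\<^sub>R (D (?p x t) (x - z) v - D (?p x t) v (x - z))) has_integral
        integral {0..1} (\<lambda>t. t *\<^sub>R (D (?p x t) (x - z) v - D (?p x t) v (x - z)))) {0..1}"
      using cc[OF x] by (simp add: integrable_integral integrable_continuous_interval)
    from has_integral_add[OF A this]
    have "((\<lambda>t. F x t v) has_integral \<beta> x v +
        integral {0..1} (\<lambda>t. t *\<^sub>R (D (?p x t) (x - z) v - D (?p x t) v (x - z)))) {0..1}"
      unfolding F_def by (simp add: algebra_simps)
    then show "integral {0..1} (\<lambda>t. F x t v) = \<beta> x v +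
        integral {0..1} (\<lambda>t. t *\<^sub>R (D (?p x t) (x - z) v - D (?p x t) v (x - z)))"
      by (rule integral_unique)
  qed
qed

subsection \<open>Total differential equations\<close>

text \<open>Bilinearity reduces the uniform bound to finitely many pairs of basis vectors, each
  bounded by compactness. The summand 1 in the constant makes it positive.\<close>

lemma bilinear_family_bound:
  fixes A :: "'a::euclidean_space \<Rightarrow> 'a \<Rightarrow> 'w::euclidean_space \<Rightarrow> 'w"
  assumes "compact K" "\<And>x. x \<in> K \<Longrightarrow> bilinear (A x)" "\<And>u w. continuous_on K (\<lambda>x. A x u w)"
  obtains C where "C > 0" "\<And>x u w. x \<in> K \<Longrightarrow> norm (A x u w) \<le> C * norm u * norm w"
proof -
  have "\<forall>b c. \<exists>k. \<forall>x\<in>K. norm (A x b c) \<le> k"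
    using compact_imp_bounded[OF compact_continuous_image[OF assms(3,1)]] unfolding bounded_iff by auto
  then obtain k where k: "\<And>b c x. x \<in> K \<Longrightarrow> norm (A x b c) \<le> k b c" by metis
  define C where "C = 1 + (\<Sum>b\<in>Basis. \<Sum>c\<in>Basis. \<bar>k b c\<bar>)"
  have "C > 0" unfolding C_def by (intro add_pos_nonneg sum_nonneg) auto
  moreover have "norm (A x u w) \<le> C * norm u * norm w" if x: "x \<in> K" for x u w
  proof -
    have l1: "linear (\<lambda>u. A x u w)" for w using assms(2)[OF x] unfolding bilinear_def by blast
    have l2: "linear (A x u)" for u using assms(2)[OF x] unfolding bilinear_def by blast
    have "A x u w = (\<Sum>b\<in>Basis. \<Sum>c\<in>Basis. ((u \<bullet> b) * (w \<bullet> c)) *\<^sub>R A x b c)"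
      by (subst linear_sum_Basis[OF l1], intro sum.cong refl, subst linear_sum_Basis[OF l2])
        (simp add: scaleR_sum_right)
    also have "norm \<dots> \<le> (\<Sum>b\<in>Basis. \<Sum>c\<in>Basis. (norm u * norm w) * \<bar>k b c\<bar>)"
    proof (intro sum_norm_le)
      fix b :: 'a and c :: 'w assume b: "b \<in> Basis" "c \<in> Basis"
      have "\<bar>u \<bullet> b\<bar> * \<bar>w \<bullet> c\<bar> * norm (A x b c) \<le> norm u * norm w * \<bar>k b c\<bar>"
        using b k[OF x, of b c] by (intro mult_mono Basis_le_norm) auto
      then show "norm (((u \<bullet> b) * (w \<bullet> c)) *\<^sub>R A x b c) \<le> norm u * norm w * \<bar>k b c\<bar>"
        by (simp add: abs_mult)
    qed
    also have "\<dots> = (C - 1) * norm u * norm w"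
      unfolding C_def by (simp add: sum_distrib_left sum_distrib_right ac_simps)
    also have "\<dots> \<le> C * norm u * norm w"
      by (intro mult_right_mono) auto
    finally show ?thesis .
  qed
  ultimately show ?thesis by (rule that)
qed

text \<open>
  Picard iteration along rays. The defect \<open>D\<^sub>n(v) = dE\<^sub>n(v) - A(v) E\<^sub>n\<close> of an iterate satisfies
  \<open>D\<^sub>n\<^sub>+\<^sub>1(v) = A(v) (E\<^sub>n - E\<^sub>n\<^sub>+\<^sub>1) + \<integral> t (A(x) D\<^sub>n(v) - A(v) D\<^sub>n(x)) dt\<close> by integrability, so the defects
  tend to 0 on a small ball and the limit solves the equation in all directions.
\<close>

lemma total_differential_equation:
  fixes A :: "'a::euclidean_space \<Rightarrow> 'a \<Rightarrow> 'w::euclidean_space \<Rightarrow> 'w"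
  assumes "open S" "z \<in> S"
    and bil: "\<And>x. x \<in> S \<Longrightarrow> bilinear (A x)"
    and smooth: "\<And>u w. smooth_on S (\<lambda>x. A x u w)"
    and integrable: "\<And>x u v w. x \<in> S \<Longrightarrow>
      frechet_derivative (\<lambda>y. A y v w) (at x) u + A x v (A x u w) =
      frechet_derivative (\<lambda>y. A y u w) (at x) v + A x u (A x v w)"
  obtains r where "r > 0" "ball z r \<subseteq> S"
    "\<And>w. \<exists>E. E z = w \<and> (\<forall>x\<in>ball z r. (E has_derivative (\<lambda>v. A x v (E x))) (at x))"
proof -
  obtain r0 where r0: "r0 > 0" "cball z r0 \<subseteq> S"
    using assms(1,2) open_contains_cball by blast
  have cont: "continuous_on S (\<lambda>x. A x u w)" for u w
    using smooth by (rule smooth_on_continuous)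
  obtain C where "C > 0" and C0: "\<And>x u w. x \<in> cball z r0 \<Longrightarrow> norm (A x u w) \<le> C * norm u * norm w"
    by (rule bilinear_family_bound[of "cball z r0" A])
      (use bil r0(2) continuous_on_subset[OF cont r0(2)] in auto)
  \<comment> \<open>The bound \<open>C * r \<le> 1/8\<close> makes the defects halve: the integral
    in the recursion contributes two terms of at most 1/8 each, the difference of consecutive
    iterates another 1/4.\<close>
  define r where "r = min r0 (1 / (8 * C))"
  have r: "r > 0" "C * r \<le> 1/8"
    using r0(1) \<open>C > 0\<close> by (auto simp: r_def min_def field_simps)
  have rS: "ball z r \<subseteq> S" using r0(2) by (auto simp: r_def)
  have C: "norm (A x u w) \<le> C * norm u * norm w" if "x \<in> ball z r" for x u w
    using that by (intro C0) (auto simp: r_def)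
  let ?B = "ball z r"
  let ?p = "\<lambda>x t. z + t *\<^sub>R (x - z)"
  have op: "open ?B" by simp
  have lin1: "linear (\<lambda>u. A x u w)" and lin2: "linear (A x u)" if "x \<in> ?B" for x u w
    using bil[of x] rS that unfolding bilinear_def by blast+
  \<comment> \<open>The radius is fixed before the initial value, as the equation is linear; so all
    vectors of a frame can be continued over one ball.\<close>
  have "\<exists>E. E z = w0 \<and> (\<forall>x\<in>?B. (E has_derivative (\<lambda>v. A x v (E x))) (at x))" for w0
  proof -
    define N where "N = norm w0"
    define E where "E = rec_nat (\<lambda>_. w0) (\<lambda>n F x. w0 + integral {0..1} (\<lambda>t. A (?p x t) (x - z) (F (?p x t))))"
    have E0: "E 0 = (\<lambda>_. w0)" by (simp add: E_def)
    have ES: "E (Suc n) = (\<lambda>x. w0 + integral {0..1} (\<lambda>t. A (?p x t) (x - z) (E n (?p x t))))" for n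
      by (simp add: E_def)
    have C1: "Ck_on 1 ?B (E n)" and C1A: "Ck_on 1 ?B (\<lambda>x. A x v (E n x))" for n v
    proof -
      have A1: "Ck_on 1 ?B (\<lambda>x. A x v (F x))" if "Ck_on 1 ?B F" for F v
        by (rule Ck_on_apply[OF op lin2 _ that]) (auto intro: smooth_onD smooth_on_subset[OF smooth rS] simp del: One_nat_def)
      show "Ck_on 1 ?B (E n)"
      proof (induction n)
        case 0
        show ?case unfolding E0 by (rule Ck_on_const)
      next
        case (Suc n)
        show ?case unfolding ES
          by (intro Ck_on_add[OF op] Ck_on_const radial_primitive(1)[OF _ A1[OF Suc]] lin1)
      qed
      then show "Ck_on 1 ?B (\<lambda>x. A x v (E n x))" by (rule A1)
    qed
    define dE where "dE = (\<lambda>n x v. frechet_derivative (E n) (at x) v)"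
    define D where "D = (\<lambda>n x v. dE n x v - A x v (E n x))"
    have derE: "(E n has_derivative dE n x) (at x)" if "x \<in> ?B" for n x
      using C1[of n] that unfolding dE_def by (auto intro: has_frechet_derivative)
    have contE: "continuous_on ?B (E n)" for n by (rule Ck_on_continuous[OF C1])
    have cont_rad: "continuous_on {0..1} (\<lambda>t. A (?p x t) (x - z) (F (?p x t)))"
      if "x \<in> ?B" "continuous_on ?B F" for x F
    proof (rule continuous_on_compose2[of ?B "\<lambda>y. A y (x - z) (F y)" "{0..1}" "?p x"])
      have "Ck_on 0 ?B (\<lambda>y. A y (x - z) (F y))"
        by (rule Ck_on_apply[OF op lin2]) (use that(2) smooth_onD[OF smooth_on_subset[OF smooth rS], of 0] in auto)
      then show "continuous_on ?B (\<lambda>y. A y (x - z) (F y))" by simp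
    qed (use radial_in_ball[OF that(1)] in \<open>auto intro!: continuous_intros\<close>)
    have Cr: "C * norm (x - z) \<le> 1/8" if "x \<in> ?B" for x
    proof -
      have "C * norm (x - z) \<le> C * r"
        using that \<open>C > 0\<close> by (intro mult_left_mono) (auto simp: dist_norm norm_minus_commute)
      then show ?thesis using r(2) by linarith
    qed
    have step: "norm (E (Suc n) x - E n x) \<le> N * (1/4) ^ Suc n" if "x \<in> ?B" for n x
      using that
    proof (induction n arbitrary: x)
      case 0
      have "norm (integral {0..1} (\<lambda>t. A (?p x t) (x - z) w0)) \<le> (N * (1/4)) * (1 - 0)"
      proof (rule integral_bound)
        show "continuous_on {0..1} (\<lambda>t. A (?p x t) (x - z) w0)"
          by (rule cont_rad[OF 0 continuous_on_const])
        show "norm (A (?p x t) (x - z) w0) \<le> N * (1/4)" if "t \<in> {0..1}" for t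
        proof -
          have "norm (A (?p x t) (x - z) w0) \<le> C * norm (x - z) * N"
            unfolding N_def by (rule C[OF radial_in_ball[OF 0 that]])
          also have "\<dots> \<le> (1/4) * N"
            using Cr[OF 0] by (intro mult_right_mono) (auto simp: N_def)
          finally show ?thesis by simp
        qed
      qed simp
      then show ?case by (simp add: ES E0)
    next
      case (Suc n)
      let ?e = "\<lambda>y. E (Suc n) y - E n y"
      have ce: "continuous_on ?B ?e" by (intro continuous_on_diff contE)
      have "E (Suc (Suc n)) x - E (Suc n) x = integral {0..1} (\<lambda>t. A (?p x t) (x - z) (?e (?p x t)))"
      proof -
        have "integral {0..1} (\<lambda>t. A (?p x t) (x - z) (E (Suc n) (?p x t))) - integral {0..1} (\<lambda>t. A (?p x t) (x - z) (E n (?p x t)))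
          = integral {0..1} (\<lambda>t. A (?p x t) (x - z) (E (Suc n) (?p x t)) - A (?p x t) (x - z) (E n (?p x t)))"
          by (intro integral_diff[symmetric] integrable_continuous_interval cont_rad Suc.prems contE)
        also have "\<dots> = integral {0..1} (\<lambda>t. A (?p x t) (x - z) (?e (?p x t)))"
          by (intro integral_cong) (simp add: linear_diff[OF lin2[OF radial_in_ball[OF Suc.prems]]])
        finally show ?thesis
          using fun_cong[OF ES[of "Suc n"], of x] fun_cong[OF ES[of n], of x] by simp
      qed
      also have "norm \<dots> \<le> (N * (1/4) ^ Suc (Suc n)) * (1 - 0)"
      proof (rule integral_bound)
        show "continuous_on {0..1} (\<lambda>t. A (?p x t) (x - z) (?e (?p x t)))"
          by (rule cont_rad[OF Suc.prems ce])
        show "norm (A (?p x t) (x - z) (?e (?p x t))) \<le> N * (1/4) ^ Suc (Suc n)" if t: "t \<in> {0..1}" for t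
        proof -
          have "norm (A (?p x t) (x - z) (?e (?p x t))) \<le> C * norm (x - z) * norm (?e (?p x t))"
            by (rule C[OF radial_in_ball[OF Suc.prems t]])
          also have "\<dots> \<le> (1/4) * (N * (1/4) ^ Suc n)"
            using Cr[OF Suc.prems] Suc.IH[OF radial_in_ball[OF Suc.prems t]]
            by (intro mult_mono) (auto simp: N_def)
          finally show ?thesis by simp
        qed
      qed simp
      finally show ?case by simp
    qed
    have defect: "D (Suc n) x v = A x v (E n x - E (Suc n) x) + integral {0..1}
        (\<lambda>t. t *\<^sub>R (A (?p x t) (x - z) (D n (?p x t) v) - A (?p x t) v (D n (?p x t) (x - z))))"
      and cont_defect: "continuous_on {0..1}
        (\<lambda>t. t *\<^sub>R (A (?p x t) (x - z) (D n (?p x t) v) - A (?p x t) v (D n (?p x t) (x - z))))"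
      if x: "x \<in> ?B" for n x v
    proof -
      let ?\<beta> = "\<lambda>x v. A x v (E n x)"
      let ?d = "\<lambda>y u v. frechet_derivative (\<lambda>y. ?\<beta> y u) (at y) v"
      have d: "?d y u v = frechet_derivative (\<lambda>x. A x u (E n y)) (at y) v + A y u (dE n y v)" if y: "y \<in> ?B" for y u v
      proof -
        have "((\<lambda>y. A y u (E n y)) has_derivative
          (\<lambda>v. frechet_derivative (\<lambda>x. A x u (E n y)) (at y) v + A y u (dE n y v))) (at y)"
          by (rule linear_family_has_derivative[OF op y lin2 _ derE[OF y]])
            (use smooth_on_differentiable[OF smooth] y rS in auto)
        from frechet_derivative_eqI[OF this] show ?thesis by simp
      qed
      \<comment> \<open>Integrability exchanges the derivatives of \<open>A\<close> for products of
        two \<open>A\<close>s, and these combine with \<open>dE\<close> to the defect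
        \<open>D n\<close>.\<close>
      have curl: "?d y c v - ?d y v c = A y c (D n y v) - A y v (D n y c)" if y: "y \<in> ?B" for y c v
        using integrable[OF subsetD[OF rS y], where u = c and v = v and w = "E n y"]
        unfolding d[OF y] D_def by (simp add: linear_diff[OF lin2[OF y]] algebra_simps)
      have eq: "t *\<^sub>R (?d (?p x t) (x - z) v - ?d (?p x t) v (x - z)) =
          t *\<^sub>R (A (?p x t) (x - z) (D n (?p x t) v) - A (?p x t) v (D n (?p x t) (x - z)))" if "t \<in> {0..1}" for t
        by (simp only: curl[OF radial_in_ball[OF x that]])
      note rp = radial_primitive[of z r ?\<beta>, OF lin1 C1A]
      have "(E (Suc n) has_derivative (\<lambda>v. ?\<beta> x v + integral {0..1}
        (\<lambda>t. t *\<^sub>R (?d (?p x t) (x - z) v - ?d (?p x t) v (x - z))))) (at x)"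
        unfolding ES using has_derivative_add[OF has_derivative_const rp(2)[OF _ x]] by simp
      from frechet_derivative_eqI[OF this]
      have "dE (Suc n) x v = ?\<beta> x v + integral {0..1}
        (\<lambda>t. t *\<^sub>R (?d (?p x t) (x - z) v - ?d (?p x t) v (x - z)))"
        unfolding dE_def by simp
      also have "integral {0..1} (\<lambda>t. t *\<^sub>R (?d (?p x t) (x - z) v - ?d (?p x t) v (x - z))) = integral {0..1}
        (\<lambda>t. t *\<^sub>R (A (?p x t) (x - z) (D n (?p x t) v) - A (?p x t) v (D n (?p x t) (x - z))))"
        by (rule integral_cong[OF eq])
      finally show "D (Suc n) x v = A x v (E n x - E (Suc n) x) + integral {0..1}
        (\<lambda>t. t *\<^sub>R (A (?p x t) (x - z) (D n (?p x t) v) - A (?p x t) v (D n (?p x t) (x - z))))"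
        unfolding D_def[of] by (simp add: linear_diff[OF lin2[OF x]])
      show "continuous_on {0..1}
        (\<lambda>t. t *\<^sub>R (A (?p x t) (x - z) (D n (?p x t) v) - A (?p x t) v (D n (?p x t) (x - z))))"
        by (rule continuous_on_eq[OF rp(3)[OF _ x, of v] eq])
    qed
    have Dbound: "norm (D n x v) \<le> C * N * (1/2) ^ n * norm v" if "x \<in> ?B" for n x v
      using that
    proof (induction n arbitrary: x v)
      case 0
      have "D 0 x v = - A x v w0"
        unfolding D_def dE_def E0 by (simp add: frechet_derivative_eqI[OF has_derivative_const])
      then show ?case using C[OF 0, of v w0] by (simp add: N_def ac_simps)
    next
      case (Suc n)
      note x = Suc.prems
      let ?K = "C * N * (1/2) ^ n"
      have "?K \<ge> 0" using \<open>C > 0\<close> by (simp add: N_def)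
      have "norm (integral {0..1} (\<lambda>t. t *\<^sub>R (A (?p x t) (x - z) (D n (?p x t) v) - A (?p x t) v (D n (?p x t) (x - z)))))
        \<le> (1/4 * ?K * norm v) * (1 - 0)"
      proof (rule integral_bound[OF _ cont_defect[OF x]])
        fix t :: real assume t: "t \<in> {0..1}"
        note p = radial_in_ball[OF x t]
        have "norm (A (?p x t) (x - z) (D n (?p x t) v)) \<le> C * norm (x - z) * norm (D n (?p x t) v)"
          by (rule C[OF p])
        also have "\<dots> \<le> 1/8 * (?K * norm v)"
          by (intro mult_mono Cr[OF x] Suc.IH[OF p]) auto
        finally have 1: "norm (A (?p x t) (x - z) (D n (?p x t) v)) \<le> 1/8 * (?K * norm v)" .
        have "norm (A (?p x t) v (D n (?p x t) (x - z))) \<le> C * norm v * norm (D n (?p x t) (x - z))"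
          by (rule C[OF p])
        also have "\<dots> \<le> C * norm v * (?K * norm (x - z))"
          using \<open>C > 0\<close> by (intro mult_left_mono Suc.IH[OF p]) auto
        also have "\<dots> = (C * norm (x - z)) * (?K * norm v)" by simp
        also have "\<dots> \<le> 1/8 * (?K * norm v)"
          using \<open>?K \<ge> 0\<close> by (intro mult_right_mono Cr[OF x]) auto
        finally have 2: "norm (A (?p x t) v (D n (?p x t) (x - z))) \<le> 1/8 * (?K * norm v)" .
        let ?q = "A (?p x t) (x - z) (D n (?p x t) v) - A (?p x t) v (D n (?p x t) (x - z))"
        have "norm (t *\<^sub>R ?q) \<le> 1 * norm ?q"
          unfolding norm_scaleR using t by (intro mult_right_mono) auto
        also have "\<dots> \<le> 1/4 * ?K * norm v"
          using norm_triangle_ineq4[of "A (?p x t) (x - z) (D n (?p x t) v)" "A (?p x t) v (D n (?p x t) (x - z))"] 1 2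
          by linarith
        finally show "norm (t *\<^sub>R ?q) \<le> 1/4 * ?K * norm v" .
      qed simp
      moreover have "norm (A x v (E n x - E (Suc n) x)) \<le> 1/4 * ?K * norm v"
      proof -
        have "norm (A x v (E n x - E (Suc n) x)) \<le> C * norm v * norm (E n x - E (Suc n) x)"
          by (rule C[OF x])
        also have "\<dots> \<le> C * norm v * (N * (1/4) ^ Suc n)"
          using step[OF x, of n] \<open>C > 0\<close> by (intro mult_left_mono) (auto simp: norm_minus_commute)
        also have "\<dots> \<le> C * norm v * (N * (1/4 * (1/2) ^ n))"
          using \<open>C > 0\<close> power_mono[of "1/4 :: real" "1/2" n] by (intro mult_left_mono) (auto simp: N_def)
        finally show ?thesis by (simp add: ac_simps)
      qed
      ultimately have "norm (D (Suc n) x v) \<le> 1/4 * ?K * norm v + 1/4 * ?K * norm v"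
        unfolding defect[OF x] diff_0_right mult_1_right
        by (intro order_trans[OF norm_triangle_ineq] add_mono)
      then show ?case by (simp add: ac_simps)
    qed
    \<comment> \<open>Stated as a difference so that the induction closes: one step costs a quarter
      of \<open>N * (1/4) ^ m\<close>, while the right-hand side grows by three quarters of
      it.\<close>
    have cauchy: "norm (E (n + k) x - E n x) \<le> N * (1/4) ^ n - N * (1/4) ^ (n + k)" if x: "x \<in> ?B" for n k x
    proof (induction k)
      case (Suc k)
      have "norm (E (n + Suc k) x - E n x) \<le> norm (E (Suc (n + k)) x - E (n + k) x) + norm (E (n + k) x - E n x)"
        using norm_triangle_ineq[of "E (Suc (n + k)) x - E (n + k) x" "E (n + k) x - E n x"] by simp
      also have "\<dots> \<le> N * (1/4) ^ Suc (n + k) + (N * (1/4) ^ n - N * (1/4) ^ (n + k))"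
        by (intro add_mono step[OF x] Suc.IH)
      also have "\<dots> \<le> N * (1/4) ^ n - N * (1/4) ^ (n + Suc k)"
        by (simp add: N_def)
      finally show ?case .
    qed simp
    have tail: "norm (E m x - E n x) \<le> N * (1/4) ^ n" if "x \<in> ?B" "n \<le> m" for m n x
    proof -
      have "N * (1/4) ^ m \<ge> 0" by (simp add: N_def)
      then show ?thesis using cauchy[OF that(1), of n "m - n"] that(2) by simp
    qed
    have to0: "(\<lambda>n. c * (1/4) ^ n) \<longlonglongrightarrow> 0" "(\<lambda>n. c * (1/2) ^ n) \<longlonglongrightarrow> 0" for c :: real
      by (auto intro!: tendsto_mult_right_zero LIMSEQ_power_zero)
    have "Cauchy (\<lambda>n. E n x)" if x: "x \<in> ?B" for x
    proof (rule metric_CauchyI)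
      fix e :: real assume "e > 0"
      then have "\<forall>\<^sub>F n in sequentially. N * (1/4) ^ n < e/2"
        by (intro order_tendstoD(2)[OF to0(1)]) simp
      then obtain M where M: "N * (1/4) ^ M < e/2" by (auto simp: eventually_sequentially)
      have "dist (E m x) (E n x) < e" if "m \<ge> M" "n \<ge> M" for m n
        using tail[OF x that(1)] tail[OF x that(2)] M dist_triangle2[of "E m x" "E n x" "E M x"]
        by (simp add: dist_norm)
      then show "\<exists>M. \<forall>m\<ge>M. \<forall>n\<ge>M. dist (E m x) (E n x) < e" by blast
    qed
    then have "\<forall>x. \<exists>l. x \<in> ?B \<longrightarrow> (\<lambda>n. E n x) \<longlonglongrightarrow> l"
      using convergent_eq_Cauchy by blast
    then obtain F where F: "\<And>x. x \<in> ?B \<Longrightarrow> (\<lambda>n. E n x) \<longlonglongrightarrow> F x" by metis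
    have FE: "norm (F x - E n x) \<le> N * (1/4) ^ n" if x: "x \<in> ?B" for n x
    proof (rule tendsto_upperbound)
      show "(\<lambda>m. norm (E m x - E n x)) \<longlonglongrightarrow> norm (F x - E n x)"
        by (intro tendsto_intros F x)
      show "\<forall>\<^sub>F m in sequentially. norm (E m x - E n x) \<le> N * (1/4) ^ n"
        using tail[OF x] by (auto simp: eventually_sequentially)
    qed simp
    \<comment> \<open>The derivatives converge uniformly to \<open>A x v (F x)\<close>, with the
      pointwise limit \<open>F\<close> inserted. The differentiable limit obtained here is
      identified with \<open>F\<close> afterwards by uniqueness of limits, which closes the
      equation.\<close>
    have "\<exists>g. \<forall>x\<in>?B. (\<lambda>n. E n x) \<longlonglongrightarrow> g x \<and> (g has_derivative (\<lambda>v. A x v (F x))) (at x within ?B)"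
    proof (rule has_derivative_sequence[OF convex_ball])
      show "(E n has_derivative dE n x) (at x within ?B)" if "x \<in> ?B" for n x
        using derE[OF that] by (rule has_derivative_at_withinI)
      show "\<forall>\<^sub>F n in sequentially. \<forall>x\<in>?B. \<forall>h. norm (dE n x h - A x h (F x)) \<le> e * norm h" if "e > 0" for e
      proof -
        have "\<forall>\<^sub>F n in sequentially. (2 * C * N) * (1/2) ^ n < e"
          using that by (intro order_tendstoD(2)[OF to0(2)])
        then show ?thesis
        proof eventually_elim
          case (elim n)
          show ?case
          proof (intro ballI allI)
            fix x h assume x: "x \<in> ?B"
            have "dE n x h - A x h (F x) = D n x h - A x h (F x - E n x)"
              unfolding D_def by (simp add: linear_diff[OF lin2[OF x]])
            also have "norm \<dots> \<le> norm (D n x h) + norm (A x h (F x - E n x))"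
              by (rule norm_triangle_ineq4)
            also have "norm (A x h (F x - E n x)) \<le> C * norm h * norm (F x - E n x)"
              by (rule C[OF x])
            also have "\<dots> \<le> C * norm h * (N * (1/4) ^ n)"
              using \<open>C > 0\<close> by (intro mult_left_mono FE[OF x]) auto
            also have "\<dots> \<le> C * norm h * (N * (1/2) ^ n)"
              using \<open>C > 0\<close> by (intro mult_left_mono power_mono) (auto simp: N_def)
            also have "norm (D n x h) \<le> C * N * (1/2) ^ n * norm h" by (rule Dbound[OF x])
            finally have "norm (dE n x h - A x h (F x)) \<le> ((2 * C * N) * (1/2) ^ n) * norm h"
              by (simp add: algebra_simps)
            also have "\<dots> \<le> e * norm h" using elim by (intro mult_right_mono) auto
            finally show "norm (dE n x h - A x h (F x)) \<le> e * norm h" .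
          qed
        qed
      qed
      show "z \<in> ?B" using r by simp
      show "(\<lambda>n. E n z) \<longlonglongrightarrow> F z" using F r by simp
    qed
    then obtain G where G: "\<And>x. x \<in> ?B \<Longrightarrow> (\<lambda>n. E n x) \<longlonglongrightarrow> G x"
      "\<And>x. x \<in> ?B \<Longrightarrow> (G has_derivative (\<lambda>v. A x v (F x))) (at x within ?B)" by blast
    have GF: "G x = F x" if "x \<in> ?B" for x
      using LIMSEQ_unique[OF G(1) F] that by blast
    have "E n z = w0" for n
    proof (cases n)
      case (Suc m)
      have "A (?p z t) 0 (E m (?p z t)) = 0" for t
        using linear_0[OF lin1[of z]] r by simp
      then show ?thesis by (simp add: Suc ES)
    qed (simp add: E0)
    then have "G z = w0"
      using G(1)[of z] r by (simp add: LIMSEQ_const_iff)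
    moreover have "(G has_derivative (\<lambda>v. A x v (G x))) (at x)" if "x \<in> ?B" for x
      using G(2)[OF that] GF[OF that] by (simp add: at_within_open[OF that op])
    ultimately show ?thesis by blast
  qed
  with r(1) rS show ?thesis by (rule that)
qed

text \<open>Bootstrapping: if \<open>E\<close> is of class \<open>k\<close>, then so is the
  right-hand side of its equation, and \<open>E\<close> gains one class.\<close>

lemma total_differential_equation_smooth:
  fixes A :: "'a::euclidean_space \<Rightarrow> 'a \<Rightarrow> 'w::euclidean_space \<Rightarrow> 'w"
  assumes "open S" and lin: "\<And>x u. x \<in> S \<Longrightarrow> linear (A x u)"
    and smooth: "\<And>u w. smooth_on S (\<lambda>x. A x u w)"
    and E: "\<And>x. x \<in> S \<Longrightarrow> (E has_derivative (\<lambda>v. A x v (E x))) (at x)"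
  shows "smooth_on S E"
  unfolding smooth_on_def
proof
  fix k
  show "Ck_on k S E"
  proof (induction k)
    case 0
    show ?case
      using E by (auto intro!: continuous_at_imp_continuous_on has_derivative_continuous)
  next
    case (Suc k)
    show ?case
      by (rule Ck_on_SucI[OF \<open>open S\<close> E], assumption, rule Ck_on_apply[OF \<open>open S\<close> lin smooth_onD[OF smooth] Suc])
  qed
qed

subsection \<open>The model space\<close>

lemma tau_can_simps [simp]:
  "tau_can (u + v) = tau_can u + tau_can v" "tau_can (u - v) = tau_can u - tau_can v"
  "tau_can (- u) = - tau_can u" "tau_can (c *\<^sub>R u) = c *\<^sub>R tau_can u"
  "tau_can 0 = 0" "tau_can (tau_can u) = u"
  by (simp_all add: tau_can_def prod_eq_iff)

lemma g_can_simps [simp]: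
  "g_can (u + v) w = g_can u w + g_can v w" "g_can w (u + v) = g_can w u + g_can w v"
  "g_can (u - v) w = g_can u w - g_can v w" "g_can w (u - v) = g_can w u - g_can w v"
  "g_can (- u) w = - g_can u w" "g_can w (- u) = - g_can w u"
  "g_can (c *\<^sub>R u) w = c * g_can u w" "g_can w (c *\<^sub>R u) = c * g_can w u"
  "g_can 0 w = 0" "g_can w 0 = 0"
  by (simp_all add: g_can_def algebra_simps)

lemma bilinear_g_can: "bilinear g_can"
  by (simp add: bilinear_def linear_iff)

lemma g_can_commute: "g_can u v = g_can v u"
  by (simp add: g_can_def inner_commute)

lemma g_can_nondegenerate: "(\<And>v. g_can u v = 0) \<Longrightarrow> u = 0"
proof -
  assume "\<And>v. g_can u v = 0"
  then have "g_can u (fst u, 0) = 0" "g_can u (0, snd u) = 0" by blast+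
  then show "u = 0" by (simp add: g_can_def prod_eq_iff)
qed

lemma g_can_eqI: "(\<And>w. g_can u w = g_can v w) \<Longrightarrow> u = v"
  by (rule nondegenerate_eqI[OF bilinear_g_can g_can_nondegenerate])

lemma g_can_tau_can: "g_can (tau_can u) (tau_can v) = - g_can u v"
  by (simp add: g_can_def tau_can_def)

text \<open>Para-complex conjugation. It relates \<open>g_can\<close> to the Euclidean product and,
  being an involution that anticommutes with \<open>tau_can\<close>, it exchanges the two
  eigenspaces of \<open>tau_can\<close>.\<close>

definition para_conj :: "'n::finite para_space \<Rightarrow> 'n para_space" where
  "para_conj v = (fst v, - snd v)"

lemma para_conj_simps [simp]:
  "para_conj (u + v) = para_conj u + para_conj v" "para_conj (u - v) = para_conj u - para_conj v"
  "para_conj (c *\<^sub>R u) = c *\<^sub>R para_conj u" "para_conj 0 = 0" "para_conj (- u) = - para_conj u"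
  "para_conj (para_conj u) = u"
  by (simp_all add: para_conj_def prod_eq_iff)

lemma para_conj_tau_can: "para_conj (tau_can v) = - tau_can (para_conj v)"
  by (simp add: para_conj_def tau_can_def)

lemma g_can_inner: "g_can u v = u \<bullet> para_conj v"
  by (simp add: g_can_def para_conj_def inner_prod_def)

text \<open>An involution anticommuting with \<open>T\<close> carries one eigenspace isomorphically
  onto the other, so neither dimension has to be computed.\<close>

lemma dim_eigenspaces_eqI:
  fixes T K :: "'e::euclidean_space \<Rightarrow> 'e"
  assumes T: "linear T" and K: "linear K" "\<And>v. K (K v) = v" "\<And>v. K (T v) = - T (K v)"
  shows "dim {v. T v = v} = dim {v. T v = - v}"
proof -
  have "inj K" by (metis K(2) injI)
  have "K ` {v. T v = v} = {v. T v = - v}"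
  proof (intro subset_antisym subsetI)
    fix v assume "v \<in> {v. T v = - v}"
    then have "T (K v) = K v"
      using K(3)[of v] by (simp add: linear_neg[OF K(1)])
    then show "v \<in> K ` {v. T v = v}" using K(2)[of v] by (intro image_eqI[of _ _ "K v"]) auto
  next
    fix v assume "v \<in> K ` {v. T v = v}"
    then obtain w where "T w = w" "v = K w" by blast
    then show "v \<in> {v. T v = - v}" using K(3)[of w] by (simp, metis minus_minus)
  qed
  then show ?thesis
    using dim_image_eq[OF K(1), of "{v. T v = v}"] inj_on_subset[OF \<open>inj K\<close> subset_UNIV] by simp
qed

section \<open>The flat connection of the model metric\<close>

lemma chart_metric_g_can: "open U \<Longrightarrow> chart_metric U (\<lambda>_. g_can)"
  by unfold_locales (auto simp: smooth_on_const bilinear_g_can g_can_commute g_can_nondegenerate)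

lemma christoffel_g_can: "christoffel (\<lambda>_. g_can) x u v = 0"
proof -
  interpret chart_metric UNIV "\<lambda>_. g_can" by (rule chart_metric_g_can) simp
  show ?thesis
    by (rule g_can_nondegenerate)
      (subst christoffel_koszul, simp_all add: koszul_def dg_def frechet_derivative_eqI[OF has_derivative_const])
qed

lemma cov_deriv_g_can: "cov_deriv (\<lambda>_. g_can) X Y x = frechet_derivative Y (at x) (X x)"
  by (simp add: cov_deriv_def christoffel_g_can)

text \<open>The two terms containing the derivative of \<open>Y\<close> cancel, which is the
  tensoriality of the covariant derivative of an endomorphism field.\<close>

lemma cov_deriv_endo_g_can:
  assumes "open U" "x \<in> U" "\<And>x. x \<in> U \<Longrightarrow> linear (\<tau> x)" "\<And>v. smooth_on U (\<lambda>x. \<tau> x v)" "smooth_on U Y"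
  shows "cov_deriv_endo (\<lambda>_. g_can) \<tau> X Y x = frechet_derivative (\<lambda>y. \<tau> y (Y x)) (at x) (X x)"
  unfolding cov_deriv_endo_def cov_deriv_g_can
  by (subst frechet_derivative_eqI[OF linear_family_has_derivative[OF assms(1-3)
    smooth_on_differentiable[OF assms(4,2)] smooth_on_has_derivative[OF assms(5,2)]]]) (assumption, rule add_diff_cancel_right')

text \<open>The second derivatives of \<open>Z\<close> cancel by symmetry, and the first-order terms
  are those of the bracket.\<close>

lemma curvature_g_can:
  assumes "open U" "x \<in> U" "smooth_on U X" "smooth_on U Y" "smooth_on U Z"
  shows "curvature (\<lambda>_. g_can) X Y Z x = 0"
proof -
  have "cov_deriv (\<lambda>_. g_can) V (cov_deriv (\<lambda>_. g_can) W Z) x =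
      frechet_derivative (\<lambda>y. frechet_derivative Z (at y) (W x)) (at x) (V x)
        + frechet_derivative Z (at x) (frechet_derivative W (at x) (V x))" if "smooth_on U W" for V W
    unfolding cov_deriv_g_can[abs_def]
    by (subst frechet_derivative_eqI[OF linear_family_has_derivative[OF assms(1,2) _
      smooth_on_differentiable[OF smooth_on_frechet[OF assms(5)] assms(2)] smooth_on_has_derivative[OF that assms(2)]]])
      (auto intro: linear_frechet_derivative smooth_on_differentiable[OF assms(5)])
  then show ?thesis
    unfolding curvature_def cov_deriv_g_can[of "lie_bracket X Y"] lie_bracket_def
    using second_derivative_symmetric[OF assms(1,2,5), of "X x" "Y x"] assms
    by (simp add: linear_diff[OF linear_frechet_derivative[OF smooth_on_differentiable[OF assms(5,2)]]])
qed

lemma second_countable_euclidean_subset: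
  "second_countable (top_of_set (U :: 'e::euclidean_space set))"
proof -
  obtain \<B> :: "'e set set" where \<B>: "countable \<B>" "\<And>C. C \<in> \<B> \<Longrightarrow> open C"
    "\<And>S. open S \<Longrightarrow> \<exists>\<U>. \<U> \<subseteq> \<B> \<and> S = \<Union>\<U>"
    using univ_second_countable by metis
  have "second_countable (euclidean :: 'e topology)"
    unfolding second_countable_def
  proof (intro exI conjI ballI allI impI)
    fix S :: "'e set" and x assume "openin euclidean S \<and> x \<in> S"
    then obtain \<U> where "\<U> \<subseteq> \<B>" "S = \<Union>\<U>" "x \<in> \<Union>\<U>" using \<B>(3)[of S] by auto
    then show "\<exists>T\<in>\<B>. x \<in> T \<and> T \<subseteq> S" by blast
  qed (use \<B> in auto)
  then show ?thesis by (rule second_countable_subtopology)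
qed

section \<open>The manifold with one chart on an open set of the model space\<close>

lemma can_manifold_fields:
  "cimg (can_manifold U \<tau>) i = U" "metric (can_manifold U \<tau>) i = (\<lambda>_. g_can)" "endo (can_manifold U \<tau>) i = \<tau>"
  by (simp_all add: can_manifold_def cimg_def)

lemma coord_dom_can: "coord_dom (can_manifold U \<tau>) (can_manifold U \<tau>) id i j = U"
  by (simp add: coord_dom_def can_manifold_def)

lemma inv_into_identity: "x \<in> U \<Longrightarrow> inv_into U (\<lambda>x. x) x = x"
  using inv_into_f_f[of "\<lambda>x. x" U x] by (simp add: inj_on_def)

lemma coord_rep_can: "x \<in> U \<Longrightarrow> coord_rep (can_manifold U \<tau>) (can_manifold U \<tau>) id i j x = x"
  by (simp add: coord_rep_def can_manifold_def inv_into_identity)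

text \<open>The representation is the identity on \<open>U\<close> only; elsewhere
  \<open>inv_into\<close> is unspecified. Openness of \<open>U\<close> makes the derivative
  insensitive to this.\<close>

lemma frechet_derivative_coord_rep_can:
  assumes "open U" "x \<in> U"
  shows "frechet_derivative (coord_rep (can_manifold U \<tau>) (can_manifold U \<tau>) id i j) (at x) = (\<lambda>v. v)"
  using frechet_derivative_cong_open[OF assms, of "coord_rep (can_manifold U \<tau>) (can_manifold U \<tau>) id i j" "\<lambda>x. x"]
    frechet_derivative_eqI[OF has_derivative_ident] coord_rep_can by metis

lemma smooth_manifold_can:
  assumes "open U"
  shows "smooth_manifold (can_manifold U \<tau>)"
proof -
  have "smooth_map (can_manifold U \<tau>) (can_manifold U \<tau>) id"
    unfolding smooth_map_def coord_dom_can
    using smooth_on_cong[OF assms coord_rep_can[symmetric] smooth_on_ident[OF assms]] by simp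
  moreover have "homeomorphic_map (subtopology (top_of_set U) U) (top_of_set U) (\<lambda>x. x)"
    by (simp add: subtopology_subtopology homeomorphic_map_id[unfolded id_def])
  ultimately show ?thesis
    unfolding smooth_manifold_def
    by (simp add: can_manifold_def cimg_def assms second_countable_euclidean_subset Hausdorff_space_subtopology)
qed

lemma flat_can:
  assumes "open U"
  shows "flat (can_manifold U \<tau>)"
proof -
  have "preserves_metric (can_manifold U \<tau>) (can_manifold U \<tau>) id"
    unfolding preserves_metric_def coord_dom_can Let_def
  proof (intro allI ballI)
    fix i j x u v assume x: "x \<in> U"
    show "metric (can_manifold U \<tau>) j (coord_rep (can_manifold U \<tau>) (can_manifold U \<tau>) id i j x)
        (frechet_derivative (coord_rep (can_manifold U \<tau>) (can_manifold U \<tau>) id i j) (at x) u)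
        (frechet_derivative (coord_rep (can_manifold U \<tau>) (can_manifold U \<tau>) id i j) (at x) v) =
        metric (can_manifold U \<tau>) i x u v"
      unfolding frechet_derivative_coord_rep_can[OF assms x] by (simp add: can_manifold_def)
  qed
  then show ?thesis
    using smooth_manifold_can[OF assms] curvature_g_can[OF assms]
    by (auto simp: flat_def pseudo_riemannian_def can_manifold_def cimg_def smooth_on_const bilinear_g_can
      intro: g_can_commute g_can_nondegenerate)
qed

text \<open>With vanishing Christoffel symbols the nearly para-Kaehler condition becomes skewness of
  the ordinary derivative, tested on constant vectors.\<close>

lemma flat_nearly_para_kaehler_can:
  assumes U: "open U" and lin: "\<And>x. x \<in> U \<Longrightarrow> linear (\<tau> x)" and smooth: "\<And>v. smooth_on U (\<lambda>x. \<tau> x v)"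
    and inv: "\<And>x v. x \<in> U \<Longrightarrow> \<tau> x (\<tau> x v) = v"
    and dims: "\<And>x. x \<in> U \<Longrightarrow> dim {v. \<tau> x v = v} = dim {v. \<tau> x v = - v}"
    and herm: "\<And>x u v. x \<in> U \<Longrightarrow> g_can (\<tau> x u) (\<tau> x v) = - g_can u v"
    and skew: "\<And>x u v. x \<in> U \<Longrightarrow>
      frechet_derivative (\<lambda>y. \<tau> y v) (at x) u = - frechet_derivative (\<lambda>y. \<tau> y u) (at x) v"
  shows "flat_nearly_para_kaehler (can_manifold U \<tau>)"
proof -
  have endo: "intertwines_endo (can_manifold U \<tau>) (can_manifold U \<tau>) id"
    unfolding intertwines_endo_def coord_dom_can Let_def
  proof (intro allI ballI)
    fix i j x v assume x: "x \<in> U"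
    show "frechet_derivative (coord_rep (can_manifold U \<tau>) (can_manifold U \<tau>) id i j) (at x)
        (endo (can_manifold U \<tau>) i x v) = endo (can_manifold U \<tau>) j (coord_rep (can_manifold U \<tau>) (can_manifold U \<tau>) id i j x)
        (frechet_derivative (coord_rep (can_manifold U \<tau>) (can_manifold U \<tau>) id i j) (at x) v)"
      unfolding frechet_derivative_coord_rep_can[OF U x] coord_rep_can[OF x] by (simp add: can_manifold_def)
  qed
  have apc: "almost_para_complex (can_manifold U \<tau>)"
    unfolding almost_para_complex_def using endo smooth_manifold_can[OF U] assms
    by (simp add: can_manifold_def cimg_def)
  moreover have fl: "flat (can_manifold U \<tau>)" by (rule flat_can[OF U])
  ultimately have aph: "almost_para_hermitian (can_manifold U \<tau>)"
    unfolding almost_para_hermitian_def flat_def using herm by (simp add: can_manifold_def cimg_def)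
  have "cov_deriv_endo (\<lambda>_. g_can) \<tau> X Y x = frechet_derivative (\<lambda>y. \<tau> y (Y x)) (at x) (X x)"
    if "smooth_on U Y" "x \<in> U" for X Y x
    by (rule cov_deriv_endo_g_can[OF U that(2) _ smooth that(1)]) (rule lin)
  note D = this
  have "cov_deriv_endo (\<lambda>_. g_can) \<tau> X Y x = - cov_deriv_endo (\<lambda>_. g_can) \<tau> Y X x"
    if "smooth_on U X" "smooth_on U Y" "x \<in> U" for X Y x
    unfolding D[OF that(2,3)] D[OF that(1,3)] by (rule skew[OF that(3)])
  note skew' = this
  have "nearly_para_kaehler (can_manifold U \<tau>)"
    unfolding nearly_para_kaehler_def can_manifold_fields by (intro conjI aph allI impI ballI) (rule skew')
  with fl show ?thesis
    unfolding flat_nearly_para_kaehler_def by (rule conjI[rotated])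
qed

subsection \<open>The structure determined by a three-form\<close>

text \<open>Justifies the definite description behind \<open>eta_op\<close>: nondegeneracy of
  \<open>g_can\<close> gives both existence and uniqueness.\<close>

lemma g_can_eta_op:
  assumes "three_form \<eta>"
  shows "g_can (eta_op \<eta> X Y) Z = \<eta> X Y Z"
proof -
  have lin: "linear (\<eta> X Y)" for Y
    using assms unfolding three_form_def by blast
  have "\<forall>Y. \<exists>s. \<forall>Z. g_can s Z = \<eta> X Y Z"
    using nondegenerate_riesz[OF bilinear_g_can g_can_nondegenerate lin] by metis
  then obtain A where A: "\<forall>Y Z. g_can (A Y) Z = \<eta> X Y Z" by metis
  have "\<exists>!A. \<forall>Y Z. g_can (A Y) Z = \<eta> X Y Z"
    by (rule ex1I[of _ A]) (use A in \<open>auto intro!: g_can_eqI\<close>)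
  from theI'[OF this] show ?thesis unfolding eta_op_def by blast
qed

lemma eta_op_eqI: "three_form \<eta> \<Longrightarrow> (\<And>Z. g_can v Z = \<eta> X Y Z) \<Longrightarrow> eta_op \<eta> X Y = v"
  by (rule g_can_eqI) (simp add: g_can_eta_op)

lemma three_formD:
  assumes "three_form \<eta>"
  shows "linear (\<lambda>u. \<eta> u v w)" "linear (\<lambda>v. \<eta> u v w)" "\<eta> v u w = - \<eta> u v w" "\<eta> u w v = - \<eta> u v w"
  using assms unfolding three_form_def by blast+

lemma eta_op_skew: "three_form \<eta> \<Longrightarrow> eta_op \<eta> X Y = - eta_op \<eta> Y X"
  by (rule g_can_eqI) (simp add: g_can_eta_op three_formD(3)[of \<eta> X Y])

lemma g_can_eta_op_skew: "three_form \<eta> \<Longrightarrow> g_can (eta_op \<eta> X Y) Z = - g_can Y (eta_op \<eta> X Z)"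
  by (subst g_can_commute[of Y]) (simp add: g_can_eta_op three_formD(4)[of \<eta> X Y Z])

lemma linear_eta_op1: "three_form \<eta> \<Longrightarrow> linear (\<lambda>X. eta_op \<eta> X Y)"
  and linear_eta_op2: "three_form \<eta> \<Longrightarrow> linear (eta_op \<eta> X)"
  by (rule linearI; rule g_can_eqI; simp add: g_can_eta_op linear_add[OF three_formD(1)] linear_add[OF three_formD(2)]
    linear_scale[OF three_formD(1)] linear_scale[OF three_formD(2)])+

lemma tau_eta_eq:
  fixes \<eta> :: "'n::finite para_space \<Rightarrow> 'n para_space \<Rightarrow> 'n para_space \<Rightarrow> real"
  assumes "three_form \<eta>" and sq: "\<And>X Y v. eta_op \<eta> X (eta_op \<eta> Y v) = 0"
  shows "tau_eta \<eta> x v = tau_can v + 2 *\<^sub>R eta_op \<eta> x (tau_can v)"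
proof -
  define A where "A = (\<lambda>v. 2 *\<^sub>R eta_op \<eta> x v)"
  \<comment> \<open>Linearity of \<open>eta_op\<close> in its index contracts the coordinate sum to
    \<open>eta_op \<eta> x\<close>.\<close>
  have A: "(\<lambda>v. 2 *\<^sub>R (\<Sum>b\<in>Basis. (x \<bullet> b) *\<^sub>R eta_op \<eta> b v)) = A"
    unfolding A_def by (rule ext, subst linear_sum_Basis[OF linear_eta_op1[OF assms(1)], of x]) (rule refl)
  have "A (A v) = 0" for v
    unfolding A_def by (simp add: linear_scale[OF linear_eta_op2[OF assms(1)]] sq)
  moreover have "A 0 = 0" unfolding A_def by (simp add: linear_0[OF linear_eta_op2[OF assms(1)]])
  ultimately have 0: "(A ^^ (k + 2)) v = 0" for k v
    by (induction k) (simp_all add: numeral_2_eq_2)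
  have "endo_exp A w = w + A w" for w
  proof -
    have "endo_exp A w = (\<Sum>k\<in>{0,1}. (1 / fact k) *\<^sub>R (A ^^ k) w)"
      unfolding endo_exp_def
    proof (rule suminf_finite)
      fix k :: nat assume "k \<notin> {0, 1}"
      then obtain j where "k = j + 2" by (cases k; cases "k - 1") auto
      then show "(1 / fact k) *\<^sub>R (A ^^ k) w = 0" using 0 by simp
    qed simp
    then show ?thesis by simp
  qed
  then show ?thesis
    unfolding tau_eta_def A by (simp add: A_def)
qed

context
  fixes U :: "'n::finite para_space set" and \<eta>
  assumes adm: "admissible U \<eta>"
begin

private lemma form: "three_form \<eta>" and op: "open U" and conn: "connected U" and zero: "0 \<in> U"
  using adm by (auto simp: admissible_def)

private abbreviation "N \<equiv> eta_op \<eta>"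

private lemma NN: "N X (N Y v) = 0"
  using adm unfolding admissible_def fun_eq_iff comp_def by blast

private lemma N_tau: "N X (tau_can v) = - tau_can (N X v)"
  using adm unfolding admissible_def fun_eq_iff anticommutator_def eq_neg_iff_add_eq_0 by blast

private lemmas tau_eta_N = tau_eta_eq[OF form NN]

private lemma N_simps [simp]:
  "N X (u + v) = N X u + N X v" "N X (u - v) = N X u - N X v" "N X (c *\<^sub>R u) = c *\<^sub>R N X u" "N X 0 = 0"
  "N X (- u) = - N X u" "N 0 v = 0"
  by (simp_all add: linear_add[OF linear_eta_op2] linear_diff[OF linear_eta_op2] linear_scale[OF linear_eta_op2]
    linear_0[OF linear_eta_op2] linear_0[OF linear_eta_op1] linear_neg[OF linear_eta_op2] form)

private lemma linear_tau_eta: "linear (tau_eta \<eta> x)"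
  by (rule linearI) (simp_all add: tau_eta_N algebra_simps)

private lemma bounded_linear_N: "bounded_linear (\<lambda>x. 2 *\<^sub>R N x v)"
  using linear_compose_scale_right[OF linear_eta_op1[OF form]] by (simp add: linear_conv_bounded_linear)

private lemma tau_eta_has_derivative: "((\<lambda>x. tau_eta \<eta> x v) has_derivative (\<lambda>u. 2 *\<^sub>R N u (tau_can v))) (at x)"
  unfolding tau_eta_N
  using has_derivative_add[OF has_derivative_const bounded_linear_imp_has_derivative[OF bounded_linear_N]] by simp

private lemma smooth_tau_eta: "smooth_on U (\<lambda>x. tau_eta \<eta> x v)"
  unfolding tau_eta_N by (intro smooth_on_add smooth_on_const smooth_on_bounded_linear bounded_linear_N op)

text \<open>Moving \<open>tau_can\<close> past \<open>1 + 2 N x\<close> reverses the sign of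
  \<open>N x\<close>, and \<open>(1 + 2 N x) (1 - 2 N x) = 1\<close>.\<close>

private lemma tau_eta_involution: "tau_eta \<eta> x (tau_eta \<eta> x v) = v"
  by (simp add: tau_eta_N N_tau NN)

text \<open>\<open>N x\<close> is skew for \<open>g_can\<close> and has square zero, so
  \<open>1 + 2 N x\<close> is an isometry; the sign comes from \<open>tau_can\<close>.\<close>

private lemma g_can_tau_eta: "g_can (tau_eta \<eta> x u) (tau_eta \<eta> x v) = - g_can u v"
  using g_can_eta_op_skew[OF form, of x "tau_can u" "tau_can v"] g_can_eta_op_skew[OF form, of x "tau_can u" "N x (tau_can v)"]
  by (simp add: tau_eta_N NN g_can_tau_can)

text \<open>\<open>tau_eta \<eta> x\<close> is the conjugate of \<open>tau_can\<close> by \<open>1 + \<eta>\<^sub>x\<close>, whose inverse is \<open>1 - \<eta>\<^sub>x\<close>.\<close>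

private lemma dim_eigenspaces_tau_eta: "dim {v. tau_eta \<eta> x v = v} = dim {v. tau_eta \<eta> x v = - v}"
proof (rule dim_eigenspaces_eqI[OF linear_tau_eta])
  \<comment> \<open>Conjugation by the same map \<open>1 + N x\<close> applied to
    \<open>para_conj\<close>, which anticommutes with \<open>tau_can\<close>.\<close>
  let ?K = "\<lambda>v. para_conj (v - N x v) + N x (para_conj (v - N x v))"
  show "linear ?K" by (rule linearI) (simp_all add: algebra_simps)
  show "?K (?K v) = v" for v by (simp add: NN)
  show "?K (tau_eta \<eta> x v) = - tau_eta \<eta> x (?K v)" for v
    by (simp add: tau_eta_N N_tau NN para_conj_tau_can scaleR_2)
qed

lemma flat_nearly_para_kaehler_M_eta: "flat_nearly_para_kaehler (can_manifold U (tau_eta \<eta>))"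
proof (rule flat_nearly_para_kaehler_can[OF op])
  \<comment> \<open>The derivative is \<open>2 N u (tau_can v) = - 2 tau_can (N u v)\<close>, so
    skewness in \<open>u\<close> and \<open>v\<close> is inherited from \<eta>.\<close>
  show "frechet_derivative (\<lambda>y. tau_eta \<eta> y v) (at x) u = - frechet_derivative (\<lambda>y. tau_eta \<eta> y u) (at x) v" for x u v
    by (subst (1 2) frechet_derivative_eqI[OF tau_eta_has_derivative]) (simp add: N_tau eta_op_skew[OF form, of u v])
qed (simp_all add: linear_tau_eta smooth_tau_eta tau_eta_involution dim_eigenspaces_tau_eta g_can_tau_eta)

lemma has_three_form_tau_eta: "has_three_form U (tau_eta \<eta>) \<eta>"
  unfolding has_three_form_def
proof (intro allI impI ballI)
  fix X Y :: "'n para_space \<Rightarrow> 'n para_space" and x assume "smooth_on U X" "smooth_on U Y" "x \<in> U"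
  have "cov_deriv_endo (\<lambda>_. g_can) (tau_eta \<eta>) X Y x = frechet_derivative (\<lambda>y. tau_eta \<eta> y (Y x)) (at x) (X x)"
    by (rule cov_deriv_endo_g_can[OF op \<open>x \<in> U\<close> linear_tau_eta smooth_tau_eta \<open>smooth_on U Y\<close>])
  \<comment> \<open>The derivative contains \<open>tau_can\<close> where the claim has
    \<open>tau_eta \<eta> x\<close>; they differ by a value of \<open>N x\<close>, which
    \<open>N (X x)\<close> annihilates.\<close>
  also have "\<dots> = 2 *\<^sub>R N (X x) (tau_eta \<eta> x (Y x))"
    by (subst frechet_derivative_eqI[OF tau_eta_has_derivative]) (simp add: tau_eta_N NN)
  finally show "cov_deriv_endo (\<lambda>_. g_can) (tau_eta \<eta>) X Y x = 2 *\<^sub>R N (X x) (tau_eta \<eta> x (Y x))" .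
qed

lemma tau_eta_0: "tau_eta \<eta> 0 = tau_can"
  by (rule ext) (simp add: tau_eta_N)

lemma tau_eta_unique:
  assumes apc: "almost_para_complex (can_manifold U \<tau>)" and \<tau>0: "\<tau> 0 = tau_can"
    and form': "has_three_form U \<tau> \<eta>" and x: "x \<in> U"
  shows "\<tau> x = tau_eta \<eta> x"
proof
  fix v
  have lin: "linear (\<tau> x)" if "x \<in> U" for x
    using apc that unfolding almost_para_complex_def can_manifold_fields by blast
  have smooth: "smooth_on U (\<lambda>x. \<tau> x v)" for v
    using apc unfolding almost_para_complex_def can_manifold_fields by blast
  have d: "((\<lambda>x. \<tau> x v) has_derivative (\<lambda>u. 2 *\<^sub>R N u (\<tau> x v))) (at x)" if "x \<in> U" for x
  proof (rule has_derivative_eq_rhs[OF smooth_on_has_derivative[OF smooth that]], rule ext)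
    fix u
    have "cov_deriv_endo (\<lambda>_. g_can) \<tau> (\<lambda>_. u) (\<lambda>_. v) x = frechet_derivative (\<lambda>y. \<tau> y v) (at x) u"
      by (rule cov_deriv_endo_g_can[OF op that _ smooth smooth_on_const]) (rule lin)
    moreover have "cov_deriv_endo (\<lambda>_. g_can) \<tau> (\<lambda>_. u) (\<lambda>_. v) x = 2 *\<^sub>R N u (\<tau> x v)"
      using form' that unfolding has_three_form_def by (blast intro: smooth_on_const)
    ultimately show "frechet_derivative (\<lambda>y. \<tau> y v) (at x) u = 2 *\<^sub>R N u (\<tau> x v)" by simp
  qed
  have N\<tau>: "N u (\<tau> x v) = N u (tau_can v)" if "x \<in> U" for u x
  proof -
    have bl: "bounded_linear (N u)"
      using linear_eta_op2[OF form] by (simp add: linear_conv_bounded_linear)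
    have "((\<lambda>x. N u (\<tau> x v)) has_derivative (\<lambda>_. 0)) (at y)" if "y \<in> U" for y
      using bounded_linear.has_derivative[OF bl d[OF that]] by (simp add: NN)
    from has_derivative_zero_unique_connected[OF op conn this that zero]
    show ?thesis by (simp add: \<tau>0)
  qed
  have "((\<lambda>x. \<tau> x v - tau_eta \<eta> x v) has_derivative (\<lambda>_. 0)) (at y)" if "y \<in> U" for y
    using has_derivative_diff[OF d[OF that] tau_eta_has_derivative[of v]] by (simp add: N\<tau>[OF that])
  from has_derivative_zero_unique_connected[OF op conn this x zero]
  show "\<tau> x v = tau_eta \<eta> x v" by (simp add: \<tau>0 tau_eta_0)
qed

end

subsection \<open>Flat structures on connected domains\<close>

lemma endo_field_affine:
  fixes \<tau> :: "'e::euclidean_space \<Rightarrow> 'e \<Rightarrow> 'e"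
  assumes "open U" "connected U" "0 \<in> U" and lin: "\<And>x. x \<in> U \<Longrightarrow> linear (\<tau> x)"
    and smooth: "\<And>v. smooth_on U (\<lambda>x. \<tau> x v)"
    and skew: "\<And>x u v. x \<in> U \<Longrightarrow>
      frechet_derivative (\<lambda>y. \<tau> y v) (at x) u = - frechet_derivative (\<lambda>y. \<tau> y u) (at x) v"
  obtains A where "\<And>x v. x \<in> U \<Longrightarrow> \<tau> x v = \<tau> 0 v + A x v" "bilinear A" "\<And>u v. A u v = - A v u"
proof -
  define d where "d = (\<lambda>x u v. frechet_derivative (\<lambda>y. \<tau> y v) (at x) u)"
  have sm: "smooth_on U (\<lambda>x. d x u v)" for u v
    unfolding d_def by (rule smooth_on_frechet[OF smooth])
  define S where "S = (\<lambda>x w u v. frechet_derivative (\<lambda>y. d y u v) (at x) w)"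
  have S1: "S x w u v = S x u w v" if "x \<in> U" for x w u v
    unfolding S_def d_def by (rule second_derivative_symmetric[OF assms(1) that smooth])
  have S2: "S x w u v = - S x w v u" if "x \<in> U" for x w u v
  proof -
    have "frechet_derivative (\<lambda>y. d y u v) (at x) = frechet_derivative (\<lambda>y. - d y v u) (at x)"
      by (rule frechet_derivative_cong_open[OF assms(1) that]) (unfold d_def, rule skew)
    also have "\<dots> = (\<lambda>w. - frechet_derivative (\<lambda>y. d y v u) (at x) w)"
      by (rule frechet_derivative_eqI) (intro has_derivative_minus smooth_on_has_derivative[OF sm that])
    finally show ?thesis unfolding S_def by metis
  qed
  text \<open>\<open>S\<close> is symmetric in its first and skew in its last pair of arguments, hence vanishes.\<close>
  have S0: "S x w u v = 0" if "x \<in> U" for x w u v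
  proof -
    have "S x w u v = - S x w u v"
      using S1[OF that] S2[OF that] by (metis minus_minus)
    then have "2 *\<^sub>R S x w u v = 0" by (metis add.right_inverse scaleR_2)
    then show ?thesis by simp
  qed
  define A where "A = d 0"
  have dA: "d x u v = A u v" if "x \<in> U" for x u v
  proof -
    have "((\<lambda>y. d y u v) has_derivative (\<lambda>_. 0)) (at y)" if "y \<in> U" for y
      by (rule has_derivative_eq_rhs[OF smooth_on_has_derivative[OF sm that]], rule ext)
        (rule S0[OF that, unfolded S_def])
    from has_derivative_zero_unique_connected[OF assms(1,2) this that assms(3)]
    show ?thesis by (simp add: A_def)
  qed
  have "linear (\<lambda>u. A u v)" "linear (A u)" for u v
    unfolding A_def d_def
    using linear_frechet_derivative[OF smooth_on_differentiable[OF smooth assms(3)]]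
      linear_frechet_derivative_family[OF assms(1,3) lin smooth_on_differentiable[OF smooth assms(3)]]
    by simp_all
  then have bil: "bilinear A" by (simp add: bilinear_def)
  have "((\<lambda>x. A x v) has_derivative (\<lambda>u. A u v)) (at x)" for x v
    using \<open>\<And>v. linear (\<lambda>u. A u v)\<close> by (simp add: linear_conv_bounded_linear bounded_linear_imp_has_derivative)
  then have dA': "((\<lambda>x. \<tau> x v - A x v) has_derivative (\<lambda>u. d x u v - A u v)) (at x)" if "x \<in> U" for x v
    unfolding d_def by (intro has_derivative_diff smooth_on_has_derivative[OF smooth that])
  have "((\<lambda>x. \<tau> x v - A x v) has_derivative (\<lambda>_. 0)) (at x)" if "x \<in> U" for x v
    using dA'[OF that, of v] unfolding dA[OF that] by simp
  from has_derivative_zero_unique_connected[OF assms(1,2) this _ assms(3)]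
  have "\<tau> x v = \<tau> 0 v + A x v" if "x \<in> U" for x v
    using that by (simp add: bilinear_lzero[OF bil] algebra_simps)
  moreover have "A u v = - A v u" for u v unfolding A_def d_def by (rule skew[OF assms(3)])
  ultimately show ?thesis using bil that by blast
qed

lemma flat_structure_eq_tau_eta:
  fixes \<tau> :: "'n::finite para_space \<Rightarrow> 'n para_space \<Rightarrow> 'n para_space"
  assumes U: "open U" "connected U" "0 \<in> U" and lin: "\<And>x. x \<in> U \<Longrightarrow> linear (\<tau> x)"
    and smooth: "\<And>v. smooth_on U (\<lambda>x. \<tau> x v)"
    and inv: "\<And>x v. x \<in> U \<Longrightarrow> \<tau> x (\<tau> x v) = v"
    and herm: "\<And>x u v. x \<in> U \<Longrightarrow> g_can (\<tau> x u) (\<tau> x v) = - g_can u v"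
    and skew: "\<And>x u v. x \<in> U \<Longrightarrow>
      frechet_derivative (\<lambda>y. \<tau> y v) (at x) u = - frechet_derivative (\<lambda>y. \<tau> y u) (at x) v"
    and \<tau>0: "\<tau> 0 = tau_can"
  obtains \<eta> where "admissible U \<eta>" "\<And>x. x \<in> U \<Longrightarrow> \<tau> x = tau_eta \<eta> x"
proof -
  obtain A where A: "\<And>x v. x \<in> U \<Longrightarrow> \<tau> x v = tau_can v + A x v" and bil: "bilinear A"
    and As: "\<And>u v. A u v = - A v u"
    using endo_field_affine[OF U lin smooth skew] unfolding \<tau>0 by metis
  note A_simps = bilinear_ladd[OF bil] bilinear_radd[OF bil] bilinear_lmul[OF bil] bilinear_rmul[OF bil]
    bilinear_lneg[OF bil] bilinear_rneg[OF bil] bilinear_lzero[OF bil] bilinear_rzero[OF bil]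
  \<comment> \<open>The algebraic identities are wanted for every \<open>x\<close>, not only for
    points of \<open>U\<close>. Two multiples are provided because the linear and the quadratic part
    of the involution identity are separated by comparing \<open>s\<close> with
    \<open>2 * s\<close>.\<close>
  have small: "\<exists>s>0. s *\<^sub>R x \<in> U \<and> (2 * s) *\<^sub>R x \<in> U" for x
  proof -
    obtain e where e: "e > 0" "ball 0 e \<subseteq> U" using U(1,3) open_contains_ball by blast
    define s where "s = e / (4 * (norm x + 1))"
    have "s > 0" using e by (simp add: s_def add_nonneg_pos)
    moreover have "s * (norm x + 1) = e / 4" by (simp add: s_def field_simps add_nonneg_eq_0_iff)
    ultimately have "2 * s * norm x < e" "s * norm x < e" using e(1) by (simp_all add: algebra_simps)
    then have "s *\<^sub>R x \<in> ball 0 e" "(2 * s) *\<^sub>R x \<in> ball 0 e" using \<open>s > 0\<close> by simp_all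
    with e \<open>s > 0\<close> show ?thesis by blast
  qed
  have *: "tau_can (A x v) + A x (tau_can v) = 0 \<and> A x (A x v) = 0" for x v
  proof -
    obtain s where s: "s > 0" "s *\<^sub>R x \<in> U" "(2 * s) *\<^sub>R x \<in> U" using small by blast
    define a b where "a = tau_can (A x v) + A x (tau_can v)" and "b = A x (A x v)"
    have q: "a + r *\<^sub>R b = 0" if "r *\<^sub>R x \<in> U" "r > 0" for r
    proof -
      have "v = v + r *\<^sub>R a + (r * r) *\<^sub>R b"
        using inv[OF that(1), of v] unfolding A[OF that(1)] by (simp add: A_simps a_def b_def algebra_simps)
      then have "r *\<^sub>R (a + r *\<^sub>R b) = 0" by (simp add: algebra_simps)
      then show ?thesis using that(2) by simp
    qed
    have "a + s *\<^sub>R b = 0" "a + (2 * s) *\<^sub>R b = 0" using q s by simp_all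
    then have "s *\<^sub>R b = 0" by (metis add_left_cancel add_cancel_right_right mult_2 scaleR_left_distrib)
    then have "b = 0" using s(1) by simp
    with \<open>a + s *\<^sub>R b = 0\<close> show ?thesis by (simp add: a_def b_def)
  qed
  have A_tau: "A x (tau_can v) = - tau_can (A x v)" and AA: "A x (A x v) = 0" for x v
    using *[of x v] by (simp_all add: eq_neg_iff_add_eq_0 add.commute)
  have A_skew: "g_can (A x u) v = - g_can u (A x v)" for x u v
  proof -
    obtain s where s: "s > 0" "s *\<^sub>R x \<in> U" using small by blast
    \<comment> \<open>The Hermitian condition together with the involution makes \<tau>
      skew-adjoint; \<open>tau_can\<close> is skew-adjoint as well, and the difference passes this
      on to \<open>A\<close>.\<close>
    have "g_can (\<tau> (s *\<^sub>R x) u) v = - g_can u (\<tau> (s *\<^sub>R x) v)"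
      using herm[OF s(2), of u "\<tau> (s *\<^sub>R x) v"] inv[OF s(2), of v] by simp
    moreover have "g_can (tau_can u) v = - g_can u (tau_can v)"
      using g_can_tau_can[of u "tau_can v"] by simp
    ultimately have "s * g_can (A x u) v = - (s * g_can u (A x v))"
      unfolding A[OF s(2)] by (simp add: A_simps)
    then have "s * (g_can (A x u) v + g_can u (A x v)) = 0" by (simp add: distrib_left)
    then show ?thesis using s(1) by simp
  qed
  have A_tau1: "A (tau_can x) v = - tau_can (A x v)" for x v
    using As[of "tau_can x" v] A_tau[of v x] As[of v x] by simp
  text \<open>\<open>A x (A y z)\<close> is totally skew, and \<open>tau_can\<close> acts on its first and last argument with opposite signs.\<close>
  have AA0: "A x (A y z) = 0" for x y z
  proof -
    \<comment> \<open>Polarisation of \<open>A x (A x z) = 0\<close>.\<close>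
    have s12: "A x (A y z) = - A y (A x z)" for x y z
      using AA[of "x + y" z] by (simp add: A_simps AA eq_neg_iff_add_eq_0 add.commute)
    have s23: "A x (A y z) = - A x (A z y)" for x y z
      by (subst As[of y z]) (simp add: A_simps)
    have cyc: "A x (A y z) = A z (A x y)" for x y z
      using s12[of x z y] s23[of x y z] by simp
    have "tau_can (A x (A y z)) = A x (A y (tau_can z))" by (simp add: A_tau A_simps)
    also have "\<dots> = A (tau_can z) (A x y)" by (rule cyc)
    also have "\<dots> = - tau_can (A x (A y z))" by (simp add: A_tau1 cyc[of x y z])
    finally have "2 *\<^sub>R tau_can (A x (A y z)) = 0" by (metis add.right_inverse scaleR_2)
    then have "tau_can (tau_can (A x (A y z))) = tau_can 0" by simp
    then show ?thesis by simp
  qed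
  define \<eta> where "\<eta> = (\<lambda>X Y Z. g_can ((1/2) *\<^sub>R A X (tau_can Y)) Z)"
  have form: "three_form \<eta>"
    unfolding three_form_def
  proof (intro conjI allI)
    fix u v w
    show "linear (\<lambda>u. \<eta> u v w)" "linear (\<lambda>v. \<eta> u v w)" "linear (\<eta> u v)"
      unfolding \<eta>_def by (rule linearI; simp add: A_simps algebra_simps)+
    show "\<eta> v u w = - \<eta> u v w" unfolding \<eta>_def A_tau using As[of v u] by simp
    show "\<eta> u w v = - \<eta> u v w"
      unfolding \<eta>_def using A_skew[of u "tau_can w" v] g_can_tau_can[of "tau_can w" "A u v"] A_tau[of u v] g_can_commute[of w]
      by simp
  qed
  have op: "eta_op \<eta> X = (\<lambda>Y. (1/2) *\<^sub>R A X (tau_can Y))" for X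
    by (rule ext) (rule eta_op_eqI[OF form], simp add: \<eta>_def)
  have NN: "eta_op \<eta> X (eta_op \<eta> Y v) = 0" for X Y v
    unfolding op by (simp add: A_simps A_tau AA0)
  have "admissible U \<eta>"
    unfolding admissible_def fun_eq_iff
    by (intro conjI allI U form) (simp_all only: comp_apply NN, simp add: anticommutator_def op A_tau)
  moreover have "\<tau> x = tau_eta \<eta> x" if "x \<in> U" for x
    by (rule ext) (simp only: tau_eta_eq[OF form NN] A[OF that] op, simp)
  ultimately show ?thesis by (rule that)
qed

text \<open>Both eigenspaces of \<open>T\<close> are isotropic, since \<open>T\<close> reverses the
  sign of \<open>h\<close>, so \<open>h\<close> is a pairing between them. Coordinates
  \<open>L\<close> on the first and the coordinates \<open>b\<close> induced by this pairing on the
  second are null coordinates; their sum and difference give the two halves of the model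
  space.\<close>

lemma para_hermitian_normal_form:
  fixes h :: "'n::finite para_space \<Rightarrow> 'n para_space \<Rightarrow> real"
  assumes h: "bilinear h" "\<And>u v. h u v = h v u" and nd: "\<And>u. (\<And>v. h u v = 0) \<Longrightarrow> u = 0"
    and T: "linear T" "\<And>v. T (T v) = v" "dim {v. T v = v} = dim {v. T v = - v}"
    and herm: "\<And>u v. h (T u) (T v) = - h u v"
  obtains R :: "'n para_space \<Rightarrow> 'n para_space" where "linear R" "bij R" "\<And>u v. g_can (R u) (R v) = h u v" "\<And>v. R (T v) = tau_can (R v)"
proof -
  note T_simps = linear_add[OF T(1)] linear_diff[OF T(1)] linear_scale[OF T(1)] T(2)
  note h_simps = bilinear_ladd[OF h(1)] bilinear_radd[OF h(1)] bilinear_lmul[OF h(1)] bilinear_rmul[OF h(1)]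
    bilinear_lneg[OF h(1)] bilinear_rneg[OF h(1)]
  let ?P = "{v. T v = v}" and ?Q = "{v. T v = - v}"
  have sub: "subspace ?P" "subspace ?Q"
    by (auto simp: subspace_def T_simps linear_0[OF T(1)])
  have "dim {x + y |x y. x \<in> ?P \<and> y \<in> ?Q} + dim (?P \<inter> ?Q) = dim ?P + dim ?Q"
    by (rule dim_sums_Int[OF sub])
  moreover have "{x + y |x y. x \<in> ?P \<and> y \<in> ?Q} = UNIV"
  proof -
    have "v = (1/2) *\<^sub>R (v + T v) + (1/2) *\<^sub>R (v - T v)" for v
      by (simp add: algebra_simps flip: scaleR_add_left)
    moreover have "(1/2) *\<^sub>R (v + T v) \<in> ?P" "(1/2) *\<^sub>R (v - T v) \<in> ?Q" for v
      by (simp_all add: T_simps algebra_simps)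
    ultimately show ?thesis by blast
  qed
  moreover have "?P \<inter> ?Q = {0}"
  proof -
    have "v = 0" if "v = - v" for v :: "'n para_space"
      using that by (metis add.right_inverse scaleR_2 scaleR_eq_0_iff zero_neq_numeral)
    then show ?thesis by (auto simp: linear_0[OF T(1)])
  qed
  \<comment> \<open>The eigenspaces are complementary and of equal dimension in a space of twice the
    dimension of \<open>(real, 'n) vec\<close>.\<close>
  ultimately have "dim (UNIV :: (real, 'n) vec set) = dim ?P"
    using T(3) by (simp add: dim_UNIV DIM_prod)
  from subspace_isomorphism[OF subspace_UNIV sub(1) this]
  obtain S :: "(real, 'n) vec \<Rightarrow> 'n para_space" where S: "linear S" "S ` UNIV = ?P" "inj S" by blast
  obtain L where L: "linear L" "\<And>x. L (S x) = x"
    using linear_injective_left_inverse[OF S(1,3)] by (auto simp: fun_eq_iff)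
  have SL: "S (L p) = p" if "T p = p" for p
    using S(2) L(2) that by (metis (mono_tags, lifting) imageE mem_Collect_eq)
  define p q where "p = (\<lambda>v. (1/2) *\<^sub>R (v + T v))" and "q = (\<lambda>v. (1/2) *\<^sub>R (v - T v))"
  \<comment> \<open>The vector representing \<open>h (S _) w / 2\<close>. The factor one half
    compensates the 2 that arises when \<open>g_can\<close> is evaluated on sums and
    differences.\<close>
  define b where "b = (\<lambda>w. (1/2) *\<^sub>R (\<Sum>e\<in>Basis. h (S e) w *\<^sub>R e))"
  define R where "R = (\<lambda>v. (L (p v) + b (q v), L (p v) - b (q v)))"
  have lp: "linear p" "linear q" "linear b"
    unfolding p_def q_def b_def
    by (rule linearI; simp add: T_simps h_simps algebra_simps sum.distrib scaleR_sum_right)+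
  have lR: "linear R"
    unfolding R_def by (rule linearI)
      (simp_all add: linear_add[OF lp(1)] linear_add[OF lp(2)] linear_add[OF lp(3)] linear_add[OF L(1)]
        linear_scale[OF lp(1)] linear_scale[OF lp(2)] linear_scale[OF lp(3)] linear_scale[OF L(1)] algebra_simps)
  have Tp: "T (p v) = p v" "T (q v) = - q v" "p v + q v = v" "p (T v) = p v" "q (T v) = - q v" for v
    unfolding p_def q_def by (simp_all add: T_simps algebra_simps flip: scaleR_add_left)
  have hp: "h (p u) (p v) = 0" "h (q u) (q v) = 0" for u v
    using herm[of "p u" "p v"] herm[of "q u" "q v"] unfolding Tp by (simp_all add: h_simps)
  have hb: "a \<bullet> b w = h (S a) w / 2" for a w
  proof -
    have lh: "linear (\<lambda>a. h (S a) w)"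
      by (rule linearI) (simp_all add: linear_add[OF S(1)] linear_scale[OF S(1)] h_simps)
    show ?thesis
      by (subst linear_sum_Basis[OF lh]) (simp add: b_def inner_sum_right mult.commute)
  qed
  have gR: "g_can (R u) (R v) = h u v" for u v
  proof -
    have "g_can (R u) (R v) = 2 * (L (p u) \<bullet> b (q v)) + 2 * (L (p v) \<bullet> b (q u))"
      unfolding g_can_def R_def by (simp add: algebra_simps inner_commute)
    also have "\<dots> = h (p u) (q v) + h (p v) (q u)"
      unfolding hb SL[OF Tp(1)] by simp
    also have "\<dots> = h (p u + q u) (p v + q v)" by (simp add: h_simps hp h(2)[of "q u"])
    finally show ?thesis unfolding Tp .
  qed
  have "inj R"
    unfolding linear_injective_0[OF lR]
  proof (intro allI impI nd)
    fix u v assume "R u = 0"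
    then show "h u v = 0" using gR[of u v] by simp
  qed
  then have "bij R" using linear_injective_imp_surjective[OF lR] by (simp add: bij_def)
  moreover have "R (T v) = tau_can (R v)" for v
    unfolding R_def Tp tau_can_def by (simp add: linear_neg[OF lp(3)])
  ultimately show ?thesis by (intro that[of R] lR gR)
qed

subsection \<open>Flat coordinates\<close>

context chart_metric
begin

text \<open>Metric compatibility as a Leibniz rule: the expressions
  \<open>\<Gamma> x v (P x) + P' v\<close> are covariant derivatives, so for parallel fields the
  right-hand side vanishes.\<close>

lemma metric_has_derivative:
  assumes x: "x \<in> S" and P: "(P has_derivative P') (at x)" and Q: "(Q has_derivative Q') (at x)"
  shows "((\<lambda>y. g y (P y) (Q y)) has_derivative
    (\<lambda>v. g x (\<Gamma> x v (P x) + P' v) (Q x) + g x (P x) (\<Gamma> x v (Q x) + Q' v))) (at x)"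
proof -
  have 1: "((\<lambda>y. g y b (Q y)) has_derivative
      (\<lambda>v. frechet_derivative (\<lambda>y. g y b (Q x)) (at x) v + g x b (Q' v))) (at x)" for b
    by (rule linear_family_has_derivative[OF open_S x lin_g2 diff_g[OF x] Q])
  have "((\<lambda>y. g y (P y) (Q y)) has_derivative
      (\<lambda>v. frechet_derivative (\<lambda>y. g y (P x) (Q y)) (at x) v + g x (P' v) (Q x))) (at x)"
    by (rule linear_family_has_derivative[OF open_S x _ _ P])
      (use lin_g1 1 in \<open>auto simp: differentiable_def\<close>)
  then show ?thesis
    by (rule has_derivative_eq_rhs)
      (simp add: fun_eq_iff frechet_derivative_eqI[OF 1] christoffel_metric[OF x] linear_add[OF lin_g1[OF x]]
        linear_add[OF lin_g2[OF x]])
qed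

text \<open>For constant fields, zero curvature is literally the integrability hypothesis of
  \<open>total_differential_equation\<close> with \<open>- \<Gamma>\<close> as coefficient. Metric
  compatibility then makes the inner products of the solutions constant on the ball.\<close>

lemma parallel_frame:
  assumes z: "z \<in> S" and flat: "\<And>x u v w. x \<in> S \<Longrightarrow> curvature g (\<lambda>_. u) (\<lambda>_. v) (\<lambda>_. w) x = 0"
  obtains r F where "r > 0" "ball z r \<subseteq> S" "\<And>x. linear (F x)" "\<And>c. F z c = c"
    "\<And>c. smooth_on (ball z r) (\<lambda>x. F x c)"
    "\<And>x c. x \<in> ball z r \<Longrightarrow> ((\<lambda>x. F x c) has_derivative (\<lambda>v. - \<Gamma> x v (F x c))) (at x)"
    "\<And>x b c. x \<in> ball z r \<Longrightarrow> g x (F x b) (F x c) = g z b c"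
proof -
  let ?A = "\<lambda>x v w. - \<Gamma> x v w"
  have bil: "bilinear (?A x)" if "x \<in> S" for x
    using christoffel_bilinear[OF that] unfolding bilinear_def by (auto intro: linear_compose_neg)
  have smooth: "smooth_on S (\<lambda>x. ?A x u w)" for u w
    by (intro smooth_on_minus open_S smooth_christoffel)
  have dA: "frechet_derivative (\<lambda>y. ?A y v w) (at x) u = - frechet_derivative (\<lambda>y. \<Gamma> y v w) (at x) u"
    if "x \<in> S" for x u v w
    using frechet_derivative_eqI[OF has_derivative_minus[OF smooth_on_has_derivative[OF smooth_christoffel that]]]
    by metis
  have int: "frechet_derivative (\<lambda>y. ?A y v w) (at x) u + ?A x v (?A x u w) =
      frechet_derivative (\<lambda>y. ?A y u w) (at x) v + ?A x u (?A x v w)" if "x \<in> S" for x u v w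
    using flat[OF that, of u v w] unfolding curvature_const[OF that] dA[OF that]
    by (simp add: linear_neg[OF christoffel_linear2[OF that]] algebra_simps)
  have "\<exists>r>0. ball z r \<subseteq> S \<and> (\<forall>w. \<exists>E. E z = w \<and> (\<forall>x\<in>ball z r. (E has_derivative (\<lambda>v. ?A x v (E x))) (at x)))"
    by (rule total_differential_equation[OF open_S z bil smooth int]) (assumption+, blast)
  then obtain r where r: "r > 0" "ball z r \<subseteq> S" and
    ex: "\<And>w. \<exists>E. E z = w \<and> (\<forall>x\<in>ball z r. (E has_derivative (\<lambda>v. ?A x v (E x))) (at x))" by blast
  obtain E where E: "\<And>w. E w z = w" "\<And>w x. x \<in> ball z r \<Longrightarrow> (E w has_derivative (\<lambda>v. ?A x v (E w x))) (at x)"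
    using ex by metis
  \<comment> \<open>Combining the solutions that start at basis vectors makes the frame linear in
    \<open>c\<close> by construction, without appeal to uniqueness of solutions.\<close>
  define F where "F = (\<lambda>x c. \<Sum>b\<in>Basis. (c \<bullet> b) *\<^sub>R E b x)"
  have lin: "linear (F x)" for x
    unfolding F_def by (rule linearI) (simp_all add: inner_add_left scaleR_add_left sum.distrib scaleR_sum_right)
  have Fz: "F z c = c" for c by (simp add: F_def E(1) euclidean_representation)
  have dF: "((\<lambda>x. F x c) has_derivative (\<lambda>v. - \<Gamma> x v (F x c))) (at x)" if "x \<in> ball z r" for x c
  proof -
    have "((\<lambda>x. F x c) has_derivative (\<lambda>v. \<Sum>b\<in>Basis. (c \<bullet> b) *\<^sub>R ?A x v (E b x))) (at x)"
      unfolding F_def by (intro has_derivative_sum has_derivative_scaleR_right E(2) that)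
    moreover have "(\<Sum>b\<in>Basis. (c \<bullet> b) *\<^sub>R ?A x v (E b x)) = - \<Gamma> x v (F x c)" for v
    proof -
      have l: "linear (\<Gamma> x v)" using christoffel_linear2 that r(2) by blast
      show ?thesis by (simp add: F_def linear_sum[OF l] linear_scale[OF l] sum_negf)
    qed
    ultimately show ?thesis by simp
  qed
  have "smooth_on (ball z r) (\<lambda>x. F x c)" for c
  proof (rule total_differential_equation_smooth[where A = ?A])
    show "linear (?A x u)" if "x \<in> ball z r" for x u
      using bil[of x] that r(2) unfolding bilinear_def by blast
    show "smooth_on (ball z r) (\<lambda>x. ?A x u w)" for u w by (rule smooth_on_subset[OF smooth r(2)])
  qed (use dF in auto)
  moreover have "g x (F x b) (F x c) = g z b c" if "x \<in> ball z r" for x b c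
  proof -
    have "((\<lambda>y. g y (F y b) (F y c)) has_derivative (\<lambda>_. 0)) (at x)" if "x \<in> ball z r" for x
    proof -
      have x: "x \<in> S" using that r(2) by blast
      have "((\<lambda>y. g y (F y b) (F y c)) has_derivative
          (\<lambda>v. g x (\<Gamma> x v (F x b) + - \<Gamma> x v (F x b)) (F x c) + g x (F x b) (\<Gamma> x v (F x c) + - \<Gamma> x v (F x c)))) (at x)"
        by (rule metric_has_derivative[OF x dF[OF that] dF[OF that]])
      then show ?thesis
        by (simp add: linear_0[OF lin_g1[OF x]] linear_0[OF lin_g2[OF x]])
    qed
    from has_derivative_zero_unique_connected[OF open_ball connected_ball this \<open>x \<in> ball z r\<close>, of z]
    show ?thesis using r(1) by (simp add: Fz)
  qed
  ultimately show ?thesis using r lin Fz dF by (intro that[of r F])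
qed

end

text \<open>Closedness of the coframe \<theta> is the torsion-freeness of the connection: its
  derivative is built from \<open>christoffel g x u v\<close>, symmetric in \<open>u\<close> and
  \<open>v\<close>. The inverse function theorem makes the primitive a chart, in which the frame
  \<open>F\<close> becomes constant.\<close>

lemma flat_coordinates:
  fixes S :: "'n::finite para_space set" and F :: "'n para_space \<Rightarrow> 'n para_space \<Rightarrow> 'n para_space"
  assumes "chart_metric S g" and r: "r > 0" "ball z r \<subseteq> S" and lin: "\<And>x. linear (F x)"
    and smooth: "\<And>c. smooth_on (ball z r) (\<lambda>x. F x c)"
    and dF: "\<And>x c. x \<in> ball z r \<Longrightarrow> ((\<lambda>x. F x c) has_derivative (\<lambda>v. - christoffel g x v (F x c))) (at x)"
    and gF: "\<And>x b c. x \<in> ball z r \<Longrightarrow> g x (F x b) (F x c) = g_can b c"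
  obtains V e \<phi> \<psi> \<theta> where "open V" "z \<in> V" "V \<subseteq> ball z r" "e > 0" "homeomorphism V (ball 0 e) \<phi> \<psi>" "\<phi> z = 0"
    "smooth_on V \<phi>" "smooth_on (ball 0 e) \<psi>" "\<And>v. smooth_on V (\<lambda>x. \<theta> x v)"
    "\<And>x. x \<in> V \<Longrightarrow> (\<phi> has_derivative \<theta> x) (at x)"
    "\<And>y. y \<in> ball 0 e \<Longrightarrow> (\<psi> has_derivative F (\<psi> y)) (at y)"
    "\<And>x. x \<in> V \<Longrightarrow> linear (\<theta> x)"
    "\<And>x c. x \<in> V \<Longrightarrow> \<theta> x (F x c) = c" "\<And>x v. x \<in> V \<Longrightarrow> F x (\<theta> x v) = v"
    "\<And>x v c. x \<in> V \<Longrightarrow> g_can (\<theta> x v) c = g x v (F x c)"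
proof -
  interpret chart_metric S g by fact
  let ?B = "ball z r"
  have op: "open ?B" by simp
  have SB: "x \<in> S" if "x \<in> ?B" for x using that r(2) by blast
  \<comment> \<open>The vectors \<open>para_conj b\<close> form the \<open>g_can\<close>-dual of the
    basis, so \<theta> is the metric adjoint of \<open>F\<close>, and as \<open>F\<close> is
    isometric also its inverse.\<close>
  define \<theta> where "\<theta> = (\<lambda>x v. \<Sum>b\<in>Basis. g x v (F x b) *\<^sub>R para_conj b)"
  have g\<theta>: "g_can (\<theta> x v) c = g x v (F x c)" if "x \<in> ?B" for x v c
  proof -
    have l: "linear (\<lambda>c. g x v (F x c))"
      using linear_compose[OF lin lin_g2[OF SB[OF that]]] by (simp add: comp_def)
    have "para_conj b \<bullet> para_conj c = c \<bullet> b" for b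
      by (simp add: para_conj_def inner_prod_def inner_commute)
    then show ?thesis
      by (subst linear_sum_Basis[OF l]) (simp add: g_can_inner \<theta>_def inner_sum_left mult.commute)
  qed
  have lin\<theta>: "linear (\<theta> x)" if "x \<in> ?B" for x
    unfolding \<theta>_def by (rule linearI) (simp_all add: linear_add[OF lin_g1[OF SB[OF that]]]
      linear_scale[OF lin_g1[OF SB[OF that]]] scaleR_add_left sum.distrib scaleR_sum_right)
  have \<theta>F: "\<theta> x (F x c) = c" if "x \<in> ?B" for x c
    by (rule g_can_eqI) (simp add: g\<theta>[OF that] gF[OF that])
  have F\<theta>: "F x (\<theta> x v) = v" if "x \<in> ?B" for x v
  proof -
    have "inj (F x)"
    proof (rule injI)
      fix b c assume "F x b = F x c"
      then show "b = c" by (metis \<theta>F[OF that])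
    qed
    then have "surj (F x)" using linear_injective_imp_surjective[OF lin] by blast
    then obtain c where "v = F x c" by (rule surjE)
    then show ?thesis by (simp add: \<theta>F[OF that])
  qed
  have sm\<theta>: "smooth_on ?B (\<lambda>x. \<theta> x v)" for v
  proof -
    have "smooth_on ?B (\<lambda>x. g x v (F x b))" for b
      by (rule smooth_on_apply[OF op _ smooth_on_subset[OF smooth_g r(2)] smooth]) (rule lin_g2[OF SB])
    then show ?thesis
      unfolding \<theta>_def by (intro smooth_on_sum smooth_on_scaleR smooth_on_const op)
  qed
  have d\<theta>: "frechet_derivative (\<lambda>y. \<theta> y v) (at x) u = (\<Sum>b\<in>Basis. g x (christoffel g x u v) (F x b) *\<^sub>R para_conj b)"
    if "x \<in> ?B" for x u v
  proof -
    \<comment> \<open>Only the constant field \<open>v\<close> contributes a Christoffel term, as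
      \<open>F\<close> is parallel.\<close>
    have "((\<lambda>y. g y v (F y b)) has_derivative (\<lambda>u. g x (christoffel g x u v) (F x b))) (at x)" for b
      using metric_has_derivative[OF SB[OF that] has_derivative_const[of v] dF[OF that, of b]]
      by (simp add: linear_0[OF lin_g2[OF SB[OF that]]])
    then have "((\<lambda>y. \<theta> y v) has_derivative (\<lambda>u. \<Sum>b\<in>Basis. g x (christoffel g x u v) (F x b) *\<^sub>R para_conj b)) (at x)"
      unfolding \<theta>_def by (intro has_derivative_sum has_derivative_scaleR_left)
    from frechet_derivative_eqI[OF this] show ?thesis by simp
  qed
  have closed: "frechet_derivative (\<lambda>y. \<theta> y v) (at x) u = frechet_derivative (\<lambda>y. \<theta> y u) (at x) v" if "x \<in> ?B" for x u v
    unfolding d\<theta>[OF that] christoffel_sym[OF SB[OF that], of u v] ..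
  define \<phi> where "\<phi> = (\<lambda>x. integral {0..1} (\<lambda>t. \<theta> (z + t *\<^sub>R (x - z)) (x - z)))"
  have d\<phi>: "(\<phi> has_derivative \<theta> x) (at x)" if "x \<in> ?B" for x
  proof (rule has_derivative_eq_rhs)
    show "(\<phi> has_derivative (\<lambda>v. \<theta> x v + integral {0..1} (\<lambda>t. t *\<^sub>R
      (frechet_derivative (\<lambda>y. \<theta> y (x - z)) (at (z + t *\<^sub>R (x - z))) v -
       frechet_derivative (\<lambda>y. \<theta> y v) (at (z + t *\<^sub>R (x - z))) (x - z))))) (at x)"
      unfolding \<phi>_def by (rule radial_primitive(2)[OF lin\<theta> smooth_onD[OF sm\<theta>] that])
    have "integral {0..1} (\<lambda>t. t *\<^sub>R
      (frechet_derivative (\<lambda>y. \<theta> y (x - z)) (at (z + t *\<^sub>R (x - z))) v -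
       frechet_derivative (\<lambda>y. \<theta> y v) (at (z + t *\<^sub>R (x - z))) (x - z))) = integral {0..1} (\<lambda>t::real. 0)" for v
      by (rule integral_cong) (simp add: closed[OF radial_in_ball[OF that], of _ v "x - z"])
    then show "(\<lambda>v. \<theta> x v + integral {0..1} (\<lambda>t. t *\<^sub>R
      (frechet_derivative (\<lambda>y. \<theta> y (x - z)) (at (z + t *\<^sub>R (x - z))) v -
       frechet_derivative (\<lambda>y. \<theta> y v) (at (z + t *\<^sub>R (x - z))) (x - z)))) = \<theta> x"
      by simp
  qed
  have sm\<phi>: "smooth_on ?B \<phi>"
    unfolding smooth_on_def
  proof
    fix k show "Ck_on k ?B \<phi>"
      by (rule Ck_on_SucD, rule Ck_on_SucI[OF op d\<phi> smooth_onD[OF sm\<theta>]])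
  qed
  have zB: "z \<in> ?B" using r(1) by simp
  have bl: "bounded_linear (\<theta> x)" if "x \<in> ?B" for x using lin\<theta>[OF that] by (simp add: linear_conv_bounded_linear)
  have blF: "bounded_linear (F x)" for x using lin by (simp add: linear_conv_bounded_linear)
  have "continuous_on ?B (\<lambda>x. Blinfun (\<theta> x))"
  proof (rule continuous_on_blinfun_componentwise)
    fix i :: "'n para_space"
    show "continuous_on ?B (\<lambda>x. blinfun_apply (Blinfun (\<theta> x)) i)"
      by (rule continuous_on_eq[OF smooth_on_continuous[OF sm\<theta>, of i]])
        (simp add: bounded_linear_Blinfun_apply bl)
  qed
  moreover have "(\<phi> has_derivative blinfun_apply (Blinfun (\<theta> x))) (at x)" if "x \<in> ?B" for x
    using d\<phi>[OF that] by (simp add: bounded_linear_Blinfun_apply bl[OF that])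
  moreover have "Blinfun (F z) o\<^sub>L Blinfun (\<theta> z) = id_blinfun"
    by (rule blinfun_eqI) (simp add: bounded_linear_Blinfun_apply bl[OF zB] blF F\<theta>[OF zB])
  ultimately obtain V0 W \<psi> \<psi>' where V0: "open V0" "V0 \<subseteq> ?B" "z \<in> V0" "open W" "\<phi> z \<in> W"
    and hom: "homeomorphism V0 W \<phi> \<psi>" and d\<psi>0: "\<And>y. y \<in> W \<Longrightarrow> (\<psi> has_derivative \<psi>' y) (at y)"
    and \<psi>': "\<And>y. y \<in> W \<Longrightarrow> \<psi>' y = inv (blinfun_apply (Blinfun (\<theta> (\<psi> y))))"
    using inverse_function_theorem[OF op _ _ zB, of \<phi> "\<lambda>x. Blinfun (\<theta> x)" "Blinfun (F z)"] by metis
  have \<psi>V: "\<psi> y \<in> V0" if "y \<in> W" for y using hom that unfolding homeomorphism_def by blast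
  have d\<psi>: "(\<psi> has_derivative F (\<psi> y)) (at y)" if "y \<in> W" for y
  proof -
    have \<psi>B: "\<psi> y \<in> ?B" using \<psi>V[OF that] V0(2) by blast
    \<comment> \<open>The inverse of the coframe is the frame. The resulting equation for \<psi> has
      a smooth right-hand side, which is what the induction for its smoothness feeds on.\<close>
    have "\<psi>' y = F (\<psi> y)"
      unfolding \<psi>'[OF that] bounded_linear_Blinfun_apply[OF bl[OF \<psi>B]]
      by (rule inv_equality) (rule F\<theta>[OF \<psi>B] \<theta>F[OF \<psi>B])+
    with d\<psi>0[OF that] show ?thesis by simp
  qed
  have sm\<psi>: "smooth_on W \<psi>"
    unfolding smooth_on_def
  proof
    fix k show "Ck_on k W \<psi>"
    proof (induction k)
      case 0
      then show ?case using hom by (simp add: homeomorphism_def)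
    next
      case (Suc k)
      show ?case
        by (rule Ck_on_SucI[OF V0(4) d\<psi>], assumption,
          rule Ck_on_compose[OF V0(4) smooth_onD[OF smooth] Suc]) (use \<psi>V V0(2) in blast)
    qed
  qed
  have \<phi>z: "\<phi> z = 0" by (simp add: \<phi>_def linear_0[OF lin\<theta>[OF zB]])
  \<comment> \<open>The image is cut down to a ball about 0, which is connected and contains the
    origin, as a domain of the model must.\<close>
  then obtain e where e: "e > 0" "ball 0 e \<subseteq> W" using V0(4,5) open_contains_ball by metis
  define V where "V = \<psi> ` ball 0 e"
  have "\<phi> (\<psi> y) = y" if "y \<in> ball 0 e" for y
    using homeomorphism_apply2[OF hom] that e(2) by blast
  then have \<phi>V: "\<phi> ` V = ball 0 e" unfolding V_def image_image by simp
  moreover have VV0: "V \<subseteq> V0" using \<psi>V e(2) unfolding V_def by blast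
  ultimately have "homeomorphism V (ball 0 e) \<phi> \<psi>"
    by (intro homeomorphism_of_subsets[OF hom _ e(2)])
  moreover have "V = V0 \<inter> \<phi> -` ball 0 e"
  proof (intro equalityI subsetI)
    fix x assume "x \<in> V0 \<inter> \<phi> -` ball 0 e"
    then show "x \<in> V"
      unfolding V_def using homeomorphism_apply1[OF hom, of x] by (intro image_eqI[of _ _ "\<phi> x"]) simp_all
  qed (use VV0 \<phi>V in blast)
  moreover have "open (V0 \<inter> \<phi> -` ball 0 e)"
    by (rule continuous_open_preimage[OF _ V0(1)]) (use hom in \<open>auto simp: homeomorphism_def\<close>)
  ultimately have hV: "homeomorphism V (ball 0 e) \<phi> \<psi>" and "open V" "V \<subseteq> V0" "z \<in> V"
    using V0(3) e(1) \<phi>z by auto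
  then have VB: "V \<subseteq> ?B" using V0(2) by blast
  show ?thesis
  proof (rule that[of V e \<phi> \<psi> \<theta>, OF \<open>open V\<close> \<open>z \<in> V\<close> VB e(1) hV \<phi>z smooth_on_subset[OF sm\<phi> VB] smooth_on_subset[OF sm\<psi> e(2)]
      smooth_on_subset[OF sm\<theta> VB]])
  qed (use VB e(2) d\<phi> d\<psi> lin\<theta> \<theta>F F\<theta> g\<theta> in blast)+
qed

text \<open>The endomorphism field is rewritten in a parallel frame and carried to flat coordinates.
  There ordinary derivatives are covariant ones, so the classification on the model space
  applies.\<close>

lemma flat_chart_normal_form:
  fixes S :: "'n::finite para_space set" and T :: "'n para_space \<Rightarrow> 'n para_space \<Rightarrow> 'n para_space"
  assumes "chart_metric S g" and z: "z \<in> S"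
    and flat: "\<And>x u v w. x \<in> S \<Longrightarrow> curvature g (\<lambda>_. u) (\<lambda>_. v) (\<lambda>_. w) x = 0"
    and T: "\<And>x. x \<in> S \<Longrightarrow> linear (T x)" "\<And>v. smooth_on S (\<lambda>x. T x v)" "\<And>x v. x \<in> S \<Longrightarrow> T x (T x v) = v"
      "\<And>x. x \<in> S \<Longrightarrow> dim {v. T x v = v} = dim {v. T x v = - v}"
    and herm: "\<And>x u v. x \<in> S \<Longrightarrow> g x (T x u) (T x v) = - g x u v"
    and nearly: "\<And>x u v. x \<in> S \<Longrightarrow> cov_deriv_endo g T (\<lambda>_. u) (\<lambda>_. v) x = - cov_deriv_endo g T (\<lambda>_. v) (\<lambda>_. u) x"
  obtains V U and \<phi> \<psi> :: "'n para_space \<Rightarrow> 'n para_space" and \<eta> where "open V" "z \<in> V" "V \<subseteq> S" "admissible U \<eta>" "homeomorphism V U \<phi> \<psi>"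
    "smooth_on V \<phi>" "smooth_on U \<psi>"
    "\<And>x u v. x \<in> V \<Longrightarrow> g_can (frechet_derivative \<phi> (at x) u) (frechet_derivative \<phi> (at x) v) = g x u v"
    "\<And>x v. x \<in> V \<Longrightarrow> frechet_derivative \<phi> (at x) (T x v) = tau_eta \<eta> (\<phi> x) (frechet_derivative \<phi> (at x) v)"
proof -
  interpret chart_metric S g by fact
  show ?thesis
  proof (rule para_hermitian_normal_form[of "g z" "T z", OF bilinear_g[OF z] sym_g[OF z] nondeg_g[OF z] T(1)[OF z]
          T(3)[OF z] T(4)[OF z] herm[OF z]])
    fix R :: "'n para_space \<Rightarrow> 'n para_space"
    assume R: "linear R" "bij R" "\<And>u v. g_can (R u) (R v) = g z u v" "\<And>v. R (T z v) = tau_can (R v)"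
    \<comment> \<open>Precomposing the frame with the inverse of the normal form \<open>R\<close>
      makes it adapted to \<open>g_can\<close> and \<open>tau_can\<close> at
      \<open>z\<close>.\<close>
    define Q where "Q = inv R"
    have RQ: "R (Q v) = v" "Q (R v) = v" for v
      using R(2) by (simp_all add: Q_def bij_is_surj surj_f_inv_f bij_is_inj)
    have linQ: "linear Q"
      by (rule linearI; rule injD[OF bij_is_inj[OF R(2)]]; simp add: RQ linear_add[OF R(1)] linear_scale[OF R(1)])
    show ?thesis
    proof (rule parallel_frame[OF z flat], assumption)
      fix r F0
      assume r: "r > 0" "ball z r \<subseteq> S" and F0: "\<And>x. linear (F0 x)" "\<And>c. F0 z c = c"
        "\<And>c. smooth_on (ball z r) (\<lambda>x. F0 x c)"
        "\<And>x c. x \<in> ball z r \<Longrightarrow> ((\<lambda>x. F0 x c) has_derivative (\<lambda>v. - christoffel g x v (F0 x c))) (at x)"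
        "\<And>x b c. x \<in> ball z r \<Longrightarrow> g x (F0 x b) (F0 x c) = g z b c"
      define F where "F = (\<lambda>x c. F0 x (Q c))"
      have F: "linear (F x)" "smooth_on (ball z r) (\<lambda>x. F x c)" for x c
        using linear_compose[OF linQ F0(1)] F0(3) by (simp_all add: F_def comp_def)
      have dF: "((\<lambda>x. F x c) has_derivative (\<lambda>v. - christoffel g x v (F x c))) (at x)" if "x \<in> ball z r" for x c
        unfolding F_def by (rule F0(4)[OF that])
      have gF: "g x (F x b) (F x c) = g_can b c" if "x \<in> ball z r" for x b c
        unfolding F_def F0(5)[OF that] R(3)[symmetric] RQ ..
      show ?thesis
      proof (rule flat_coordinates[OF \<open>chart_metric S g\<close> r F dF gF], assumption, assumption)
        fix V :: "'n para_space set" and e :: real and \<phi> \<psi> :: "'n para_space \<Rightarrow> 'n para_space"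
          and \<theta> :: "'n para_space \<Rightarrow> 'n para_space \<Rightarrow> 'n para_space"
        assume V: "open V" "z \<in> V" "V \<subseteq> ball z r" "e > 0" and hom: "homeomorphism V (ball 0 e) \<phi> \<psi>"
          and \<phi>z: "\<phi> z = 0" and sm: "smooth_on V \<phi>" "smooth_on (ball 0 e) \<psi>" "\<And>v. smooth_on V (\<lambda>x. \<theta> x v)"
          and d\<phi>: "\<And>x. x \<in> V \<Longrightarrow> (\<phi> has_derivative \<theta> x) (at x)"
          and d\<psi>: "\<And>y. y \<in> ball 0 e \<Longrightarrow> (\<psi> has_derivative F (\<psi> y)) (at y)"
          and lin\<theta>: "\<And>x. x \<in> V \<Longrightarrow> linear (\<theta> x)"
          and \<theta>F: "\<And>x c. x \<in> V \<Longrightarrow> \<theta> x (F x c) = c" and F\<theta>: "\<And>x v. x \<in> V \<Longrightarrow> F x (\<theta> x v) = v"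
          and g\<theta>: "\<And>x v c. x \<in> V \<Longrightarrow> g_can (\<theta> x v) c = g x v (F x c)"
        let ?U = "ball (0 :: 'n para_space) e"
        have \<psi>V: "\<psi> y \<in> V" if "y \<in> ?U" for y using hom that unfolding homeomorphism_def by blast
        have \<phi>U: "\<phi> x \<in> ?U" if "x \<in> V" for x using hom that unfolding homeomorphism_def by blast
        have VS: "x \<in> S" if "x \<in> V" for x using V(3) r(2) that by blast
        have \<psi>\<phi>: "\<psi> (\<phi> x) = x" if "x \<in> V" for x by (rule homeomorphism_apply1[OF hom that])
        \<comment> \<open>The components of \<open>T\<close> with respect to the parallel frame;
          \<tau> is the same field in flat coordinates.\<close>
        define H where "H = (\<lambda>x w. \<theta> x (T x (F x w)))"
        define \<tau> where "\<tau> = (\<lambda>y. H (\<psi> y))"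
        have smTF: "smooth_on V (\<lambda>x. T x (F x w))" for w
          by (rule smooth_on_apply[OF V(1) T(1)[OF VS] smooth_on_subset[OF T(2)] smooth_on_subset[OF F(2) V(3)]])
            (use VS in auto)
        have smH: "smooth_on V (\<lambda>x. H x w)" for w
          unfolding H_def by (rule smooth_on_apply[OF V(1) lin\<theta> sm(3) smTF])
        have linH: "linear (H x)" if "x \<in> V" for x
          unfolding H_def
          using linear_compose[OF linear_compose[OF F(1) T(1)[OF VS[OF that]]] lin\<theta>[OF that]] by (simp add: comp_def)
        have g\<theta>\<theta>: "g_can (\<theta> x u) (\<theta> x v) = g x u v" if "x \<in> V" for x u v
          by (simp add: g\<theta>[OF that] F\<theta>[OF that])
        \<comment> \<open>Since the frame is parallel, differentiating components amounts to taking
          the covariant derivative of \<open>T\<close>. The check is made by pairing with a constant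
          vector \<open>c\<close>, that is, with the parallel field \<open>F x c\<close>.\<close>
        have dH: "frechet_derivative (\<lambda>y. H y w) (at x) v = \<theta> x (cov_deriv_endo g T (\<lambda>_. v) (\<lambda>_. F x w) x)"
          if x: "x \<in> V" for x v w
        proof (rule g_can_eqI)
          fix c
          note xS = VS[OF x] and xB = subsetD[OF V(3) x]
          have "((\<lambda>y. g_can (H y w) c) has_derivative (\<lambda>v. g_can (frechet_derivative (\<lambda>y. H y w) (at x) v) c)) (at x)"
            unfolding g_can_inner by (intro has_derivative_inner_left smooth_on_has_derivative[OF smH x])
          moreover have "((\<lambda>y. g_can (H y w) c) has_derivative
              (\<lambda>v. g x (cov_deriv_endo g T (\<lambda>_. v) (\<lambda>_. F x w) x) (F x c))) (at x)"
          proof (rule has_derivative_transform_within_open[OF _ V(1) x])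
            show "g y (T y (F y w)) (F y c) = g_can (H y w) c" if "y \<in> V" for y
              by (simp add: H_def g\<theta>[OF that])
            have dT: "((\<lambda>y. T y (F y w)) has_derivative
                (\<lambda>v. frechet_derivative (\<lambda>y. T y (F x w)) (at x) v + T x (- christoffel g x v (F x w)))) (at x)"
              by (rule linear_family_has_derivative[OF open_S xS T(1) smooth_on_differentiable[OF T(2) xS] dF[OF xB]])
            show "((\<lambda>y. g y (T y (F y w)) (F y c)) has_derivative
                (\<lambda>v. g x (cov_deriv_endo g T (\<lambda>_. v) (\<lambda>_. F x w) x) (F x c))) (at x)"
              by (rule has_derivative_eq_rhs[OF metric_has_derivative[OF xS dT dF[OF xB]]])
                (simp add: cov_deriv_endo_const linear_0[OF lin_g2[OF xS]] linear_neg[OF T(1)[OF xS]] algebra_simps)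
          qed
          ultimately have "(\<lambda>v. g_can (frechet_derivative (\<lambda>y. H y w) (at x) v) c) =
              (\<lambda>v. g x (cov_deriv_endo g T (\<lambda>_. v) (\<lambda>_. F x w) x) (F x c))"
            by (rule has_derivative_unique)
          then show "g_can (frechet_derivative (\<lambda>y. H y w) (at x) v) c =
              g_can (\<theta> x (cov_deriv_endo g T (\<lambda>_. v) (\<lambda>_. F x w) x)) c"
            unfolding g\<theta>[OF x] by metis
        qed
        have d\<tau>: "frechet_derivative (\<lambda>y. \<tau> y w) (at y) u =
            \<theta> (\<psi> y) (cov_deriv_endo g T (\<lambda>_. F (\<psi> y) u) (\<lambda>_. F (\<psi> y) w) (\<psi> y))" if y: "y \<in> ?U" for y u w
        proof -
          have "((\<lambda>y. \<tau> y w) has_derivative (\<lambda>u. frechet_derivative (\<lambda>x. H x w) (at (\<psi> y)) (F (\<psi> y) u))) (at y)"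
            unfolding \<tau>_def by (rule has_derivative_compose[OF d\<psi>[OF y] smooth_on_has_derivative[OF smH \<psi>V[OF y]]])
          from frechet_derivative_eqI[OF this] show ?thesis by (simp add: dH[OF \<psi>V[OF y]])
        qed
        show ?thesis
        proof (rule flat_structure_eq_tau_eta[of ?U \<tau>])
            show "0 \<in> ?U" using V(4) by simp
            show "linear (\<tau> y)" if "y \<in> ?U" for y unfolding \<tau>_def by (rule linH[OF \<psi>V[OF that]])
            show "smooth_on ?U (\<lambda>y. \<tau> y v)" for v
              unfolding \<tau>_def by (rule smooth_on_compose[OF open_ball smH sm(2)]) (use \<psi>V in blast)
            show "\<tau> y (\<tau> y v) = v" if "y \<in> ?U" for y v
              unfolding \<tau>_def H_def
              by (simp add: F\<theta>[OF \<psi>V[OF that]] \<theta>F[OF \<psi>V[OF that]] T(3)[OF VS[OF \<psi>V[OF that]]])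
            show "g_can (\<tau> y u) (\<tau> y v) = - g_can u v" if "y \<in> ?U" for y u v
              unfolding \<tau>_def H_def g\<theta>\<theta>[OF \<psi>V[OF that]] herm[OF VS[OF \<psi>V[OF that]]]
              by (simp add: gF[OF subsetD[OF V(3) \<psi>V[OF that]]])
            show "frechet_derivative (\<lambda>y. \<tau> y v) (at y) u = - frechet_derivative (\<lambda>y. \<tau> y u) (at y) v" if "y \<in> ?U" for y u v
              unfolding d\<tau>[OF that] nearly[OF VS[OF \<psi>V[OF that]], of "F (\<psi> y) u"]
              by (rule linear_neg[OF lin\<theta>[OF \<psi>V[OF that]]])
            show "\<tau> 0 = tau_can"
            proof
              fix w
              have Fz: "F z c = Q c" for c by (simp add: F_def F0(2))
              \<comment> \<open>At the centre the frame is \<open>Q\<close> and the coframe is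
                \<open>R\<close>, so \<tau> at the origin is the conjugate
                \<open>R (T z (Q w))\<close>.\<close>
              have "\<theta> z v = R v" for v using F\<theta>[OF V(2), of v] unfolding Fz by (metis RQ(1))
              then show "\<tau> 0 w = tau_can w"
                using \<psi>\<phi>[OF V(2)] by (simp add: \<tau>_def H_def \<phi>z Fz R(4) RQ)
            qed
            fix \<eta> assume \<eta>: "admissible ?U \<eta>" "\<And>y. y \<in> ?U \<Longrightarrow> \<tau> y = tau_eta \<eta> y"
          have fd: "frechet_derivative \<phi> (at x) = \<theta> x" if "x \<in> V" for x
            by (rule frechet_derivative_eqI[OF d\<phi>[OF that]])
          show ?thesis
          proof (rule that[OF V(1,2) _ \<eta>(1) hom sm(1,2)])
            show "V \<subseteq> S" using VS by blast
            show "g_can (frechet_derivative \<phi> (at x) u) (frechet_derivative \<phi> (at x) v) = g x u v" if "x \<in> V" for x u v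
              unfolding fd[OF that] by (rule g\<theta>\<theta>[OF that])
            show "frechet_derivative \<phi> (at x) (T x v) = tau_eta \<eta> (\<phi> x) (frechet_derivative \<phi> (at x) v)" if "x \<in> V" for x v
              unfolding fd[OF that] \<eta>(2)[OF \<phi>U[OF that], symmetric] \<tau>_def H_def \<psi>\<phi>[OF that] F\<theta>[OF that] ..
          qed
        qed (use V(4) in auto)
      qed
    qed
  qed
qed

subsection \<open>Charts of a smooth manifold\<close>

lemma coord_rep_id: "inj_on (cmap M i) (cdom M i) \<Longrightarrow> q \<in> cdom M i \<Longrightarrow> coord_rep M N id i j (cmap M i q) = cmap N j q"
  by (simp add: coord_rep_def)

context
  fixes M :: "('i, 'm, 'e::euclidean_space) tensor_manifold"
  assumes M: "smooth_manifold M"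
begin

lemma chart_homeomorphic:
  "homeomorphic_map (subtopology (mtop M) (cdom M i)) (top_of_set (cimg M i)) (cmap M i)"
  and open_cimg: "open (cimg M i)" and openin_cdom: "openin (mtop M) (cdom M i)"
  using M by (auto simp: smooth_manifold_def)

lemma topspace_chart: "topspace (subtopology (mtop M) (cdom M i)) = cdom M i"
  using openin_subset[OF openin_cdom] by (simp add: inf.absorb2)

lemma chart_inj: "inj_on (cmap M i) (cdom M i)"
  using chart_homeomorphic[of i] by (simp add: homeomorphic_eq_everything_map topspace_chart del: topspace_subtopology)

lemma open_chart_image:
  assumes "openin (mtop M) V" "V \<subseteq> cdom M i"
  shows "open (cmap M i ` V)"
proof -
  have "openin (subtopology (mtop M) (cdom M i)) V"
    using assms openin_cdom by (simp add: openin_open_subtopology)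
  then have "openin (top_of_set (cimg M i)) (cmap M i ` V)"
    using homeomorphic_imp_open_map[OF chart_homeomorphic] by (simp add: open_map_def)
  then show ?thesis using open_cimg by (simp add: openin_open_eq)
qed

lemma openin_chart_preimage:
  assumes "open W"
  shows "openin (mtop M) {q \<in> cdom M i. cmap M i q \<in> W}"
proof -
  have "continuous_map (subtopology (mtop M) (cdom M i)) (top_of_set (cimg M i)) (cmap M i)"
    by (rule homeomorphic_imp_continuous_map[OF chart_homeomorphic])
  then have "continuous_map (subtopology (mtop M) (cdom M i)) euclidean (cmap M i)"
    by (simp add: continuous_map_in_subtopology)
  from openin_continuous_map_preimage[OF this, of W] assms
  have "openin (subtopology (mtop M) (cdom M i)) {q \<in> cdom M i. cmap M i q \<in> W}"
    unfolding topspace_chart by simp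
  then show ?thesis by (rule openin_trans_full[OF _ openin_cdom])
qed

lemma smooth_transition: "smooth_on (cmap M i ` (cdom M i \<inter> cdom M j)) (coord_rep M M id i j)"
  using M by (simp add: smooth_manifold_def smooth_map_def coord_dom_def)

end

subsection \<open>The local model of a flat nearly para-Kaehler manifold\<close>

text \<open>In the chart \<open>i\<close> the isomorphism onto \<open>M_eta U \<eta>\<close> is \<open>\<phi>\<close>; in any other chart it is \<open>\<phi>\<close> after a transition map.\<close>

lemma isomorphic_M_eta_from_chart:
  fixes M :: "('i, 'm, 'n::finite para_space) tensor_manifold" and \<phi> \<psi> :: "'n para_space \<Rightarrow> 'n para_space"
  assumes M: "smooth_manifold M" "preserves_metric M M id" "intertwines_endo M M id"
    and W: "open W" "W \<subseteq> cimg M i" and U: "open U" and hom: "homeomorphism W U \<phi> \<psi>"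
    and smooth: "smooth_on W \<phi>" "smooth_on U \<psi>"
    and met: "\<And>x u v. x \<in> W \<Longrightarrow>
      g_can (frechet_derivative \<phi> (at x) u) (frechet_derivative \<phi> (at x) v) = metric M i x u v"
    and endom: "\<And>x v. x \<in> W \<Longrightarrow>
      frechet_derivative \<phi> (at x) (endo M i x v) = tau_eta \<eta> (\<phi> x) (frechet_derivative \<phi> (at x) v)"
  shows "isomorphic (open_submanifold M {q \<in> cdom M i. cmap M i q \<in> W}) (M_eta U \<eta>)"
proof -
  define V where "V = {q \<in> cdom M i. cmap M i q \<in> W}"
  define f where "f = (\<lambda>q. \<phi> (cmap M i q))"
  define MV where "MV = open_submanifold M V"
  define N where "N = M_eta U \<eta>"
  let ?tr = "\<lambda>j k. coord_rep M M id j k"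
  have N [simp]: "mtop N = top_of_set U" "cdom N k = U" "cmap N k = (\<lambda>x. x)" "metric N k = (\<lambda>_. g_can)"
    "endo N k = tau_eta \<eta>" for k
    by (simp_all add: N_def M_eta_def can_manifold_def)
  have MV [simp]: "mtop MV = subtopology (mtop M) V" "cdom MV k = cdom M k \<inter> V" "cmap MV k = cmap M k"
    "metric MV k = metric M k" "endo MV k = endo M k" for k
    by (simp_all add: MV_def open_submanifold_def)
  note inj = chart_inj[OF M(1)]
  have V: "openin (mtop M) V" unfolding V_def by (rule openin_chart_preimage[OF M(1) W(1)])
  have VD: "V \<subseteq> cdom M i" by (auto simp: V_def)
  have topV: "topspace (subtopology (mtop M) V) = V"
    using openin_subset[OF V] by (simp add: inf.absorb2)
  have \<psi>\<phi>: "\<psi> (\<phi> x) = x" "\<phi> x \<in> U" if "x \<in> W" for x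
    using hom that by (auto simp: homeomorphism_def)
  have \<phi>\<psi>: "\<phi> (\<psi> y) = y" "\<psi> y \<in> W" if "y \<in> U" for y
    using hom that by (auto simp: homeomorphism_def)
  have cV: "cmap M i q \<in> W" if "q \<in> V" for q using that by (simp add: V_def)
  have hom_f: "homeomorphic_map (mtop MV) (mtop N) f"
  proof -
    have "homeomorphic_map (subtopology (subtopology (mtop M) (cdom M i)) V)
        (subtopology (top_of_set (cimg M i)) W) (cmap M i)"
    proof (rule homeomorphic_map_subtopologies[OF chart_homeomorphic[OF M(1)]])
      show "cmap M i ` (topspace (subtopology (mtop M) (cdom M i)) \<inter> V) = topspace (top_of_set (cimg M i)) \<inter> W"
        unfolding topspace_chart[OF M(1)] using W(2) by (auto simp: V_def cimg_def)
    qed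
    then have "homeomorphic_map (subtopology (mtop M) V) (top_of_set W) (cmap M i)"
      using VD W(2) by (simp add: subtopology_subtopology inf.absorb2)
    moreover have "homeomorphic_map (top_of_set W) (top_of_set U) \<phi>"
      unfolding homeomorphic_map_maps homeomorphic_maps_def using hom \<psi>\<phi> \<phi>\<psi>
      by (intro exI[of _ \<psi>]) (auto simp: homeomorphism_def)
    ultimately have "homeomorphic_map (subtopology (mtop M) V) (top_of_set U) (\<phi> \<circ> cmap M i)"
      by (rule homeomorphic_map_compose)
    then show ?thesis by (simp add: f_def comp_def)
  qed
  define h where "h = inv_into V f"
  have f_inj: "inj_on f V" and f_im: "f ` V = U"
    using hom_f unfolding homeomorphic_eq_everything_map by (simp_all add: topV del: topspace_subtopology)
  have fh: "f (h y) = y" "h y \<in> V" if "y \<in> U" for y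
    using that f_im by (auto simp: h_def f_inv_into_f inv_into_into)
  have hf: "h (f q) = q" if "q \<in> V" for q
    unfolding h_def by (rule inv_into_f_f[OF f_inj that])
  have ch: "cmap M i (h y) = \<psi> y" if "y \<in> U" for y
    using \<psi>\<phi>(1)[OF cV[OF fh(2)[OF that]]] fh(1)[OF that] by (simp add: f_def)
  \<comment> \<open>The topological inverse supplied by the homeomorphism is some map
    \<open>k\<close>; it agrees on \<open>U\<close> with the specific inverse
    \<open>inv_into V f\<close> that \<open>para_kaehler_iso\<close> refers to.\<close>
  have h_cont: "continuous_map (top_of_set U) (subtopology (mtop M) V) h"
  proof -
    obtain k where k: "homeomorphic_maps (mtop MV) (mtop N) f k"
      using hom_f unfolding homeomorphic_map_maps by blast
    have "k y = h y" if "y \<in> U" for y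
    proof -
      have "k (f (h y)) = h y"
        using k fh(2)[OF that] by (simp add: homeomorphic_maps_def topV del: topspace_subtopology)
      then show ?thesis by (simp add: fh(1)[OF that])
    qed
    moreover have "continuous_map (top_of_set U) (subtopology (mtop M) V) k"
      using k by (simp add: homeomorphic_maps_def)
    ultimately show ?thesis by (intro continuous_map_eq[of _ _ k h]) simp_all
  qed
  let ?D = "\<lambda>j. cmap M j ` (cdom M j \<inter> V)"
  have dom: "coord_dom MV N f j k = ?D j" for j and k :: unit
  proof -
    have "cdom MV j \<inter> f -` cdom N k = cdom M j \<inter> V" using f_im by auto
    then show ?thesis by (simp add: coord_dom_def)
  qed
  have openD: "open (?D j)" for j
    by (rule open_chart_image[OF M(1)]) (auto intro: openin_Int openin_cdom[OF M(1)] V)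
  have D_dom: "?D j \<subseteq> coord_dom M M id j i" for j
    using VD by (auto simp: coord_dom_def)
  have tr_W: "?tr j i x \<in> W" if "x \<in> ?D j" for j x
    using that cV by (auto simp: coord_rep_id[OF inj])
  have rep: "coord_rep MV N f j k x = \<phi> (?tr j i x)" if "x \<in> ?D j" for j x and k :: unit
  proof -
    obtain q where q: "q \<in> cdom M j \<inter> V" "x = cmap M j q" using \<open>x \<in> ?D j\<close> by blast
    have "inv_into (cdom M j \<inter> V) (cmap M j) x = q"
      unfolding q(2) by (rule inv_into_f_f[OF inj_on_subset[OF inj] q(1)]) blast
    then show ?thesis
      using q by (simp add: coord_rep_def[of MV] f_def coord_rep_id[OF inj])
  qed
  have smooth_tr: "smooth_on (?D j) (?tr j i)" for j
    by (rule smooth_on_subset[OF smooth_transition[OF M(1), of j i]]) (use VD in auto)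
  have d_rep: "frechet_derivative (coord_rep MV N f j k) (at x) v =
      frechet_derivative \<phi> (at (?tr j i x)) (frechet_derivative (?tr j i) (at x) v)" if x: "x \<in> ?D j" for j x v and k :: unit
  proof -
    have "((\<lambda>x. \<phi> (?tr j i x)) has_derivative
        (\<lambda>v. frechet_derivative \<phi> (at (?tr j i x)) (frechet_derivative (?tr j i) (at x) v))) (at x)"
      by (rule has_derivative_compose[OF smooth_on_has_derivative[OF smooth_tr x]
        smooth_on_has_derivative[OF smooth(1) tr_W[OF x]]])
    from frechet_derivative_eqI[OF this] frechet_derivative_cong_open[OF openD x rep[where k = k]]
    show ?thesis by simp
  qed
  have "smooth_map MV N f"
    unfolding smooth_map_def dom
  proof (intro conjI allI)
    show "continuous_map (mtop MV) (mtop N) f" by (rule homeomorphic_imp_continuous_map[OF hom_f])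
    show "smooth_on (?D j) (coord_rep MV N f j k)" for j k
      by (rule smooth_on_cong[OF openD rep[symmetric] smooth_on_compose[OF openD smooth(1) smooth_tr]])
        (use tr_W in blast)+
  qed
  moreover have "preserves_metric MV N f"
    unfolding preserves_metric_def dom Let_def
  proof (intro allI ballI)
    fix j u v x and k :: unit assume x: "x \<in> ?D j"
    have "metric M i (?tr j i x) (frechet_derivative (?tr j i) (at x) u) (frechet_derivative (?tr j i) (at x) v) = metric M j x u v"
      using M(2) D_dom x unfolding preserves_metric_def Let_def by blast
    then show "metric N k (coord_rep MV N f j k x) (frechet_derivative (coord_rep MV N f j k) (at x) u)
        (frechet_derivative (coord_rep MV N f j k) (at x) v) = metric MV j x u v"
      by (simp only: N MV d_rep[OF x] met[OF tr_W[OF x]])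
  qed
  moreover have "intertwines_endo MV N f"
    unfolding intertwines_endo_def dom Let_def
  proof (intro allI ballI)
    fix j v x and k :: unit assume x: "x \<in> ?D j"
    have "frechet_derivative (?tr j i) (at x) (endo M j x v) = endo M i (?tr j i x) (frechet_derivative (?tr j i) (at x) v)"
      using M(3) D_dom x unfolding intertwines_endo_def Let_def by blast
    then show "frechet_derivative (coord_rep MV N f j k) (at x) (endo MV j x v) =
        endo N k (coord_rep MV N f j k x) (frechet_derivative (coord_rep MV N f j k) (at x) v)"
      by (simp only: N MV d_rep[OF x] rep[OF x] endom[OF tr_W[OF x]])
  qed
  moreover have "smooth_map N MV h"
    unfolding smooth_map_def
  proof (intro conjI allI)
    show "continuous_map (mtop N) (mtop MV) h" using h_cont by simp
    fix k :: unit and j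
    let ?E = "{y \<in> U. h y \<in> cdom M j \<inter> V}"
    have "openin (top_of_set U) {y \<in> topspace (top_of_set U). h y \<in> cdom M j \<inter> V}"
      by (rule openin_continuous_map_preimage[OF h_cont])
        (simp add: openin_open_subtopology[OF V] openin_Int openin_cdom[OF M(1)] V)
    then have E: "open ?E" using U by (simp add: openin_open_eq)
    have \<psi>E: "\<psi> y \<in> cmap M i ` (cdom M i \<inter> cdom M j)" if "y \<in> ?E" for y
      using that VD ch[of y] by (intro image_eqI[of _ _ "h y"]) auto
    \<comment> \<open>In chart \<open>i\<close> the inverse map is \<psi>, so in chart
      \<open>j\<close> it is \<psi> followed by the transition map from \<open>i\<close> to
      \<open>j\<close>.\<close>
    have "coord_rep N MV h k j y = ?tr i j (\<psi> y)" if "y \<in> ?E" for y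
    proof -
      have "?tr i j (\<psi> y) = cmap M j (h y)"
        using that VD coord_rep_id[OF inj, of "h y" i M j] ch[of y] by auto
      then show ?thesis using that by (simp add: coord_rep_def[of N] inv_into_identity)
    qed
    moreover have "smooth_on ?E (\<lambda>y. ?tr i j (\<psi> y))"
      by (rule smooth_on_compose[OF E smooth_transition[OF M(1)] smooth_on_subset[OF smooth(2)]])
        (use \<psi>E in auto)
    ultimately have "smooth_on ?E (coord_rep N MV h k j)"
      by (intro smooth_on_cong[OF E, of "\<lambda>y. ?tr i j (\<psi> y)" "coord_rep N MV h k j"]) simp_all
    moreover have "coord_dom N MV h k j = ?E" by (auto simp: coord_dom_def)
    ultimately show "smooth_on (coord_dom N MV h k j) (coord_rep N MV h k j)" by simp
  qed
  ultimately have "para_kaehler_iso MV N f"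
    unfolding para_kaehler_iso_def using hom_f topV by (simp add: h_def del: topspace_subtopology)
  then show ?thesis
    unfolding isomorphic_def MV_def N_def V_def by blast
qed

lemma locally_isomorphic_M_eta:
  fixes M :: "('i, 'm, 'n::finite para_space) tensor_manifold"
  assumes M: "flat_nearly_para_kaehler M" and p: "p \<in> topspace (mtop M)"
  shows "\<exists>V U \<eta>. openin (mtop M) V \<and> p \<in> V \<and> admissible (U :: 'n para_space set) \<eta> \<and>
    isomorphic (open_submanifold M V) (M_eta U \<eta>)"
proof -
  have pr: "pseudo_riemannian M" and apc: "almost_para_complex M" and aph: "almost_para_hermitian M"
    and sm: "smooth_manifold M" and fl: "flat M" and npk: "nearly_para_kaehler M"
    using M unfolding flat_nearly_para_kaehler_def nearly_para_kaehler_def almost_para_hermitian_def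
      pseudo_riemannian_def by blast+
  obtain i where i: "p \<in> cdom M i" using sm p unfolding smooth_manifold_def by blast
  have "chart_metric (cimg M i) (metric M i)"
    using pr open_cimg[OF sm] unfolding pseudo_riemannian_def chart_metric_def by blast
  then show ?thesis
  \<comment> \<open>The conditions on smooth vector fields are specialised to constant ones, which
    already determine the tensors at each point.\<close>
  proof (rule flat_chart_normal_form[where T = "endo M i" and z = "cmap M i p"])
    show "cmap M i p \<in> cimg M i" using i by (simp add: cimg_def)
    fix x u v assume x: "x \<in> cimg M i"
    show "curvature (metric M i) (\<lambda>_. u) (\<lambda>_. v) (\<lambda>_. w) x = 0" for w
      using fl x unfolding flat_def by (blast intro: smooth_on_const)
    show "linear (endo M i x)" "endo M i x (endo M i x v) = v"
      "dim {v. endo M i x v = v} = dim {v. endo M i x v = - v}"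
      using apc x unfolding almost_para_complex_def by blast+
    show "metric M i x (endo M i x u) (endo M i x v) = - metric M i x u v"
      using aph x unfolding almost_para_hermitian_def by blast
    show "cov_deriv_endo (metric M i) (endo M i) (\<lambda>_. u) (\<lambda>_. v) x =
        - cov_deriv_endo (metric M i) (endo M i) (\<lambda>_. v) (\<lambda>_. u) x"
      using npk x unfolding nearly_para_kaehler_def by (blast intro: smooth_on_const)
  next
    show "smooth_on (cimg M i) (\<lambda>x. endo M i x v)" for v
      using apc unfolding almost_para_complex_def by blast
  next
    fix W U :: "'n para_space set" and \<phi> \<psi> \<eta>
    assume W: "open W" "cmap M i p \<in> W" "W \<subseteq> cimg M i" and adm: "admissible U \<eta>"
      and model: "homeomorphism W U \<phi> \<psi>" "smooth_on W \<phi>" "smooth_on U \<psi>"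
        "\<And>x u v. x \<in> W \<Longrightarrow> g_can (frechet_derivative \<phi> (at x) u) (frechet_derivative \<phi> (at x) v) = metric M i x u v"
        "\<And>x v. x \<in> W \<Longrightarrow> frechet_derivative \<phi> (at x) (endo M i x v) = tau_eta \<eta> (\<phi> x) (frechet_derivative \<phi> (at x) v)"
    have "open U" using adm by (simp add: admissible_def)
    have "preserves_metric M M id" "intertwines_endo M M id"
      using pr apc by (simp_all add: pseudo_riemannian_def almost_para_complex_def)
    from isomorphic_M_eta_from_chart[OF sm this W(1,3) \<open>open U\<close> model]
    show ?thesis
      using openin_chart_preimage[OF sm W(1), of i] i W(2) adm
      by (intro exI[of _ "{q \<in> cdom M i. cmap M i q \<in> W}"] exI[of _ U] exI[of _ \<eta>]) simp
  qed
qed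

theorem theorem3:
  shows
  "(\<forall>(U :: 'n::finite para_space set) \<eta>. admissible U \<eta> \<longrightarrow>
      (\<exists>\<tau>. (\<forall>x\<in>U. \<tau> x = tau_eta \<eta> x) \<and>
         (almost_para_complex (can_manifold U \<tau>) \<and> \<tau> 0 = tau_can \<and>
          flat_nearly_para_kaehler (can_manifold U \<tau>) \<and> has_three_form U \<tau> \<eta>) \<and>
         (\<forall>\<tau>'. almost_para_complex (can_manifold U \<tau>') \<and> \<tau>' 0 = tau_can \<and>
            flat_nearly_para_kaehler (can_manifold U \<tau>') \<and> has_three_form U \<tau>' \<eta> \<longrightarrow>
            (\<forall>x\<in>U. \<tau>' x = \<tau> x)))) \<and>
   (\<forall>M :: ('i, 'm, 'n para_space) tensor_manifold. flat_nearly_para_kaehler M \<longrightarrow>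
      (\<forall>p\<in>topspace (mtop M). \<exists>V U \<eta>. openin (mtop M) V \<and> p \<in> V \<and>
         admissible (U :: 'n para_space set) \<eta> \<and>
         isomorphic (open_submanifold M V) (M_eta U \<eta>)))"
proof (intro conjI allI impI ballI)
  fix U :: "'n para_space set" and \<eta> assume adm: "admissible U \<eta>"
  have "almost_para_complex (can_manifold U (tau_eta \<eta>))"
    using flat_nearly_para_kaehler_M_eta[OF adm]
    by (simp add: flat_nearly_para_kaehler_def nearly_para_kaehler_def almost_para_hermitian_def)
  then show "\<exists>\<tau>. (\<forall>x\<in>U. \<tau> x = tau_eta \<eta> x) \<and>
         (almost_para_complex (can_manifold U \<tau>) \<and> \<tau> 0 = tau_can \<and>
          flat_nearly_para_kaehler (can_manifold U \<tau>) \<and> has_three_form U \<tau> \<eta>) \<and>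
         (\<forall>\<tau>'. almost_para_complex (can_manifold U \<tau>') \<and> \<tau>' 0 = tau_can \<and>
            flat_nearly_para_kaehler (can_manifold U \<tau>') \<and> has_three_form U \<tau>' \<eta> \<longrightarrow>
            (\<forall>x\<in>U. \<tau>' x = \<tau> x))"
    using flat_nearly_para_kaehler_M_eta[OF adm] has_three_form_tau_eta[OF adm] tau_eta_0[OF adm]
      tau_eta_unique[OF adm] by (intro exI[of _ "tau_eta \<eta>"]) blast
qed (rule locally_isomorphic_M_eta)

end
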